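(* Let $\mathcal H$ be a cosemisimple Hopf algebra which is weakly finite as an algebra, and let $\Lambda\in\mathcal H$ be an element of integral type. Then $S(\Lambda)=\Lambda$ if and only if $(1\otimes\Lambda)\Delta(\Lambda)=\Lambda\otimes\Lambda$. In particular, every finite-dimensional unimodular left coideal subalgebra $\mathcal A\subset\mathcal H$ satisfies $S^2(\mathcal A)=\mathcal A$, and every idempotent element of integral type in $\mathcal H$ is a two-sided group-like projection.
   Context: $k$ is a field; $\mathcal H$ is a Hopf algebra over $k$ with comultiplication $\Delta$, counit $\varepsilon$, invertible antipode $S$. A left coideal subalgebra is a subalgebra $\mathcal A\ni1$ with $\Delta(\mathcal A)\subset\mathcal H\otimes\mathcal A$. A non-zero $\Lambda$ is of integral type if $\Delta(\Lambda)(1\otimes\Lambda)=\Lambda\otimes\Lambda$. $\mathcal A$ is unimodular if $\{x\in\mathcal A: ax=\varepsilon(a)x\ \forall a\in\mathcal A\}=\{x\in\mathcal A: xa=\varepsilon(a)x\ \forall a\in\mathcal A\}$. A unital algebra is weakly finite if for all $n$ and $x,y\in M_n$ over it, $xy=1$ implies $yx=1$. A non-zero idempotent $P$ is a two-sided group-like projection if $\Delta(P)(1\otimes P)=(1\otimes P)\Delta(P)=P\otimes P$ and $\Delta(P)(P\otimes1)=(P\otimes1)\Delta(P)=P\otimes P$. *)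

theory Defs
  imports Main "HOL.Vector_Spaces"
begin

text \<open>A k-algebra H is modelled by a type 'a of class ring_1 together with a scalar
multiplication scale over a field 'k.  Elements of H (x) H (resp. H (x) H (x) H) are
represented by finite lists of pairs (resp. triples), i.e. finite sums of pure tensors;
two such representatives denote the same tensor iff they agree under all products of
linear functionals (the canonical map V (x) W to bilinear forms on V* x W* is injective).\<close>

definition lin_fun :: "('k::field \<Rightarrow> 'a::ab_group_add \<Rightarrow> 'a) \<Rightarrow> ('a \<Rightarrow> 'k) \<Rightarrow> bool" where
  "lin_fun scale \<phi> \<longleftrightarrow> Vector_Spaces.linear scale (*) \<phi>"

definition tensor_eq :: "('k::field \<Rightarrow> 'a::ab_group_add \<Rightarrow> 'a) \<Rightarrow> ('a \<times> 'a) list \<Rightarrow> ('a \<times> 'a) list \<Rightarrow> bool" where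
  "tensor_eq scale xs ys \<longleftrightarrow>
     (\<forall>\<phi> \<psi>. lin_fun scale \<phi> \<and> lin_fun scale \<psi> \<longrightarrow>
        sum_list (map (\<lambda>(a,b). \<phi> a * \<psi> b) xs) = sum_list (map (\<lambda>(a,b). \<phi> a * \<psi> b) ys))"

definition tensor_eq3 :: "('k::field \<Rightarrow> 'a::ab_group_add \<Rightarrow> 'a) \<Rightarrow> ('a \<times> 'a \<times> 'a) list \<Rightarrow> ('a \<times> 'a \<times> 'a) list \<Rightarrow> bool" where
  "tensor_eq3 scale xs ys \<longleftrightarrow>
     (\<forall>\<phi> \<psi> \<chi>. lin_fun scale \<phi> \<and> lin_fun scale \<psi> \<and> lin_fun scale \<chi> \<longrightarrow>
        sum_list (map (\<lambda>(a,b,c). \<phi> a * \<psi> b * \<chi> c) xs) = sum_list (map (\<lambda>(a,b,c). \<phi> a * \<psi> b * \<chi> c) ys))"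

definition tmul :: "('a::ring_1 \<times> 'a) list \<Rightarrow> ('a \<times> 'a) list \<Rightarrow> ('a \<times> 'a) list" where
  "tmul xs ys = concat (map (\<lambda>(a,b). map (\<lambda>(c,d). (a*c, b*d)) ys) xs)"

definition hopf_algebra ::
  "('k::field \<Rightarrow> 'a::ring_1 \<Rightarrow> 'a) \<Rightarrow> ('a \<Rightarrow> ('a \<times> 'a) list) \<Rightarrow> ('a \<Rightarrow> 'k) \<Rightarrow> ('a \<Rightarrow> 'a) \<Rightarrow> bool" where
  "hopf_algebra scale \<Delta> \<epsilon> S \<longleftrightarrow>
     \<comment> \<open>k-algebra\<close>
     vector_space scale \<and>
     (\<forall>c x y. scale c (x*y) = scale c x * y \<and> scale c (x*y) = x * scale c y) \<and>
     \<comment> \<open>comultiplication: linear, unital, multiplicative, coassociative\<close>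
     (\<forall>x y. tensor_eq scale (\<Delta> (x+y)) (\<Delta> x @ \<Delta> y)) \<and>
     (\<forall>c x. tensor_eq scale (\<Delta> (scale c x)) (map (\<lambda>(a,b). (scale c a, b)) (\<Delta> x))) \<and>
     tensor_eq scale (\<Delta> 1) [(1,1)] \<and>
     (\<forall>x y. tensor_eq scale (\<Delta> (x*y)) (tmul (\<Delta> x) (\<Delta> y))) \<and>
     (\<forall>x. tensor_eq3 scale
        (concat (map (\<lambda>(a,b). map (\<lambda>(a1,a2). (a1,a2,b)) (\<Delta> a)) (\<Delta> x)))
        (concat (map (\<lambda>(a,b). map (\<lambda>(b1,b2). (a,b1,b2)) (\<Delta> b)) (\<Delta> x)))) \<and>
     \<comment> \<open>counit: a unital algebra map satisfying the counit laws\<close>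
     lin_fun scale \<epsilon> \<and> \<epsilon> 1 = 1 \<and> (\<forall>x y. \<epsilon> (x*y) = \<epsilon> x * \<epsilon> y) \<and>
     (\<forall>x. sum_list (map (\<lambda>(a,b). scale (\<epsilon> a) b) (\<Delta> x)) = x) \<and>
     (\<forall>x. sum_list (map (\<lambda>(a,b). scale (\<epsilon> b) a) (\<Delta> x)) = x) \<and>
     \<comment> \<open>invertible antipode\<close>
     Vector_Spaces.linear scale scale S \<and>
     (\<forall>x. sum_list (map (\<lambda>(a,b). S a * b) (\<Delta> x)) = scale (\<epsilon> x) 1) \<and>
     (\<forall>x. sum_list (map (\<lambda>(a,b). a * S b) (\<Delta> x)) = scale (\<epsilon> x) 1) \<and>
     bij S"

definition subcoalgebra :: "('k::field \<Rightarrow> 'a::ring_1 \<Rightarrow> 'a) \<Rightarrow> ('a \<Rightarrow> ('a \<times> 'a) list) \<Rightarrow> 'a set \<Rightarrow> bool" where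
  "subcoalgebra scale \<Delta> C \<longleftrightarrow> module.subspace scale C \<and>
     (\<forall>c\<in>C. \<exists>xs. set xs \<subseteq> C \<times> C \<and> tensor_eq scale (\<Delta> c) xs)"

definition simple_subcoalgebra :: "('k::field \<Rightarrow> 'a::ring_1 \<Rightarrow> 'a) \<Rightarrow> ('a \<Rightarrow> ('a \<times> 'a) list) \<Rightarrow> 'a set \<Rightarrow> bool" where
  "simple_subcoalgebra scale \<Delta> C \<longleftrightarrow> subcoalgebra scale \<Delta> C \<and> C \<noteq> {0} \<and>
     (\<forall>D. subcoalgebra scale \<Delta> D \<and> D \<subseteq> C \<longrightarrow> D = {0} \<or> D = C)"

definition cosemisimple :: "('k::field \<Rightarrow> 'a::ring_1 \<Rightarrow> 'a) \<Rightarrow> ('a \<Rightarrow> ('a \<times> 'a) list) \<Rightarrow> bool" where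
  "cosemisimple scale \<Delta> \<longleftrightarrow>
     module.span scale (\<Union>{C. simple_subcoalgebra scale \<Delta> C}) = UNIV"

text \<open>Weak finiteness of the algebra 'a: n x n matrices are functions nat => nat => 'a,
only entries with indices below n matter.\<close>
definition mat_mul :: "nat \<Rightarrow> (nat \<Rightarrow> nat \<Rightarrow> 'a::ring_1) \<Rightarrow> (nat \<Rightarrow> nat \<Rightarrow> 'a) \<Rightarrow> nat \<Rightarrow> nat \<Rightarrow> 'a" where
  "mat_mul n x y = (\<lambda>i j. \<Sum>l<n. x i l * y l j)"

definition is_id_mat :: "nat \<Rightarrow> (nat \<Rightarrow> nat \<Rightarrow> 'a::ring_1) \<Rightarrow> bool" where
  "is_id_mat n m \<longleftrightarrow> (\<forall>i<n. \<forall>j<n. m i j = (if i = j then 1 else 0))"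

definition weakly_finite :: "'a::ring_1 itself \<Rightarrow> bool" where
  "weakly_finite _ \<longleftrightarrow> (\<forall>n (x::nat \<Rightarrow> nat \<Rightarrow> 'a) y.
      is_id_mat n (mat_mul n x y) \<longrightarrow> is_id_mat n (mat_mul n y x))"

definition integral_type :: "('k::field \<Rightarrow> 'a::ring_1 \<Rightarrow> 'a) \<Rightarrow> ('a \<Rightarrow> ('a \<times> 'a) list) \<Rightarrow> 'a \<Rightarrow> bool" where
  "integral_type scale \<Delta> L \<longleftrightarrow> L \<noteq> 0 \<and>
     tensor_eq scale (map (\<lambda>(a,b). (a, b * L)) (\<Delta> L)) [(L, L)]"

definition left_coideal_subalgebra :: "('k::field \<Rightarrow> 'a::ring_1 \<Rightarrow> 'a) \<Rightarrow> ('a \<Rightarrow> ('a \<times> 'a) list) \<Rightarrow> 'a set \<Rightarrow> bool" where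
  "left_coideal_subalgebra scale \<Delta> A \<longleftrightarrow>
     module.subspace scale A \<and> 1 \<in> A \<and> (\<forall>x\<in>A. \<forall>y\<in>A. x * y \<in> A) \<and>
     (\<forall>a\<in>A. \<exists>xs. set xs \<subseteq> UNIV \<times> A \<and> tensor_eq scale (\<Delta> a) xs)"

definition finite_dim_subspace :: "('k::field \<Rightarrow> 'a::ring_1 \<Rightarrow> 'a) \<Rightarrow> 'a set \<Rightarrow> bool" where
  "finite_dim_subspace scale A \<longleftrightarrow> (\<exists>B. finite B \<and> B \<subseteq> A \<and> module.span scale B = A)"

definition unimodular :: "('k::field \<Rightarrow> 'a::ring_1 \<Rightarrow> 'a) \<Rightarrow> ('a \<Rightarrow> 'k) \<Rightarrow> 'a set \<Rightarrow> bool" where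
  "unimodular scale \<epsilon> A \<longleftrightarrow>
     {x\<in>A. \<forall>a\<in>A. a * x = scale (\<epsilon> a) x} = {x\<in>A. \<forall>a\<in>A. x * a = scale (\<epsilon> a) x}"

definition two_sided_grouplike_projection :: "('k::field \<Rightarrow> 'a::ring_1 \<Rightarrow> 'a) \<Rightarrow> ('a \<Rightarrow> ('a \<times> 'a) list) \<Rightarrow> 'a \<Rightarrow> bool" where
  "two_sided_grouplike_projection scale \<Delta> P \<longleftrightarrow> P \<noteq> 0 \<and> P * P = P \<and>
     tensor_eq scale (map (\<lambda>(a,b). (a, b * P)) (\<Delta> P)) [(P, P)] \<and>
     tensor_eq scale (map (\<lambda>(a,b). (a, P * b)) (\<Delta> P)) [(P, P)] \<and>
     tensor_eq scale (map (\<lambda>(a,b). (a * P, b)) (\<Delta> P)) [(P, P)] \<and>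
     tensor_eq scale (map (\<lambda>(a,b). (P * a, b)) (\<Delta> P)) [(P, P)]"

end

theory Submission
  imports Defs "HOL-Library.Function_Algebras"
begin

text \<open>
  Let \<open>h\<close> be the Haar functional of the cosemisimple Hopf algebra. The crucial point is that \<open>h\<close>
  restricts to a nondegenerate form \<open>(a, b) \<mapsto> h (a b)\<close> on every finite-dimensional left coideal
  subalgebra \<open>A\<close>. The radical \<open>R = {a \<in> A. h (a A) = 0}\<close> is a right ideal and a subcomodule, and
  \<open>\<epsilon>\<close> does not vanish on it if \<open>R \<noteq> 0\<close>. Then \<open>A / R\<close> is a nonzero relative Hopf module whose fibre
  at the character \<open>\<epsilon>\<close> is zero. Following Skryabin, weak finiteness forbids this: choose a simple
  module \<open>V\<close> at which the rank of the relative Hopf module \<open>M\<close> is maximal; some power \<open>M\<^sup>s\<close> is then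
  generated by \<open>r\<close> elements, where \<open>r\<close> is the rank of \<open>M\<^sup>s\<close> at \<open>V\<close>. After base change to the Hopf
  algebra the surjection \<open>A\<^sup>r \<rightarrow> M\<^sup>s\<close> becomes a square matrix with a one-sided inverse, hence an
  invertible one, and this makes \<open>M\<^sup>s\<close> free unless a nonzero costable ideal annihilates \<open>V\<close>. Applied to the
  smallest nonzero costable ideal of \<open>A\<close> and then to \<open>A / R\<close> this gives \<open>R = 0\<close>.

  An element \<open>L\<close> of integral type is a left integral of the coideal subalgebra \<open>A\<close> spanned by the
  unit and the second legs of \<open>\<Delta> L\<close>, so \<open>h L \<noteq> 0\<close> by nondegeneracy. For \<open>a \<in> A\<close> one has
  \<open>L\<^sub>1 h (a L\<^sub>2) = h L S a\<close>, and \<open>L\<^sub>1 h (L\<^sub>2 a) = h L S\<^sup>-\<^sup>1 a\<close> when \<open>L\<close> is also a right integral;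
  the three assertions are read off from these identities.
\<close>

section \<open>Finite-dimensional linear algebra\<close>

text \<open>A relative Hopf module M is never a type or a quotient here. It is given by
  coefficients, and the argument runs in the dual left module \<open>Y\<close> of column vectors:
  generators of M become functionals on \<open>Y\<close>, surjectivity of a map onto M becomes
  injectivity on \<open>Y\<close>, and M = M Q becomes the statement that no nonzero vector of
  \<open>Y\<close> is annihilated by Q. Costable ideals enter as kernels: if f is the representation
  on a simple module V, base change sends a to a1 \<otimes> f(a2), and the kernel of this map is a
  costable ideal annihilating V. The square matrix needs an integer, whereas the rank at V is the
  fraction dim Hom(V, Y) / dim V; hence the power s = dim V. The freeness argument starts from a
  proper left ideal Q with M = M Q and yields only some nonzero costable ideal J with M J different
  from M. For A / R this is absurd once A is known to have no costable ideals except 0 and A, which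
  is why that case, with the ideal itself as Q, precedes the Haar form.\<close>

context vector_space
begin

text \<open>A property of a set, since the ambient type is infinite dimensional in general. As
  \<open>dim\<close> is 0 for spaces with an infinite basis, comparisons of dimensions carry this
  hypothesis.\<close>

definition fd :: "'b set \<Rightarrow> bool" where
  "fd V \<longleftrightarrow> (\<exists>B. finite B \<and> V \<subseteq> span B)"

lemma fd_subset: "fd V \<Longrightarrow> U \<subseteq> V \<Longrightarrow> fd U"
  unfolding fd_def by blast

lemma fd_independent_finite:
  assumes "fd V" "independent B" "B \<subseteq> V"
  shows "finite B"
  using assms independent_span_bound unfolding fd_def by blast

lemma fd_basis_extend:
  assumes "fd V" "subspace V" "independent C" "C \<subseteq> V"
  shows "\<exists>B. C \<subseteq> B \<and> finite B \<and> independent B \<and> B \<subseteq> V \<and> span B = V \<and> card B = dim V"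
proof -
  obtain B where B: "C \<subseteq> B" "B \<subseteq> V" "independent B" "V \<subseteq> span B"
    using maximal_independent_subset_extend[OF assms(4,3)] by blast
  have "span B = V" using B assms(2) by (simp add: span_minimal subset_antisym)
  moreover have "finite B" using fd_independent_finite[OF assms(1)] B by blast
  moreover have "card B = dim V" using basis_card_eq_dim B by blast
  ultimately show ?thesis using B by blast
qed

lemma fd_basis:
  assumes "fd V" "subspace V"
  shows "\<exists>B. finite B \<and> independent B \<and> B \<subseteq> V \<and> span B = V \<and> card B = dim V"
  using fd_basis_extend[OF assms independent_empty] by blast

lemma dim_mono_fd:
  assumes "fd W" "V \<subseteq> W" "subspace V" "subspace W"
  shows "dim V \<le> dim W"
proof -
  obtain B where "finite B" "span B = W" "card B = dim W"
    using fd_basis[OF assms(1,4)] by blast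
  then show ?thesis using dim_le_card[of V B] assms(2) by auto
qed

lemma dim_strict_mono_fd:
  assumes "fd W" "V \<subseteq> W" "subspace V" "subspace W" "x \<in> W" "x \<notin> V"
  shows "dim V < dim W"
proof -
  obtain B where B: "finite B" "independent B" "B \<subseteq> V" "span B = V" "card B = dim V"
    using fd_basis[OF fd_subset[OF assms(1,2)] assms(3)] by blast
  then have i: "independent (insert x B)" using assms(6) by (simp add: independent_insertI)
  have "insert x B \<subseteq> W" using B assms by blast
  then obtain B' where B': "insert x B \<subseteq> B'" "finite B'" "card B' = dim W"
    using fd_basis_extend[OF assms(1,4) i] by blast
  have "x \<notin> B" using B assms(6) by blast
  then have "card B < card (insert x B)" using B by simp
  also have "\<dots> \<le> card B'" by (rule card_mono[OF B'(2,1)])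
  finally show ?thesis using B B' by simp
qed

lemma dim_pos_fd:
  assumes "fd W" "subspace W" "x \<in> W" "x \<noteq> 0"
  shows "0 < dim W"
proof -
  have "dim {0} < dim W"
    by (rule dim_strict_mono_fd[OF assms(1) _ subspace_single_0 assms(2,3)])
      (use assms subspace_0 in auto)
  then show ?thesis by simp
qed

lemma span_finite_sum:
  assumes "finite B" "v \<in> span B"
  obtains f where "v = (\<Sum>b\<in>B. scale (f b) b)"
  using assms span_finite[OF assms(1)] that by auto

lemma vector_space_pair_field: "vector_space_pair scale ((*) :: 'a \<Rightarrow> 'a \<Rightarrow> 'a)"
  by unfold_locales (auto simp: algebra_simps)

lemma functional_extend:
  assumes "independent B"
  shows "\<exists>\<phi>. lin_fun scale \<phi> \<and> (\<forall>b\<in>B. \<phi> b = f b)"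
proof -
  interpret vector_space_pair scale "(*) :: 'a \<Rightarrow> 'a \<Rightarrow> 'a" by (rule vector_space_pair_field)
  show ?thesis using linear_independent_extend[OF assms, of f] unfolding lin_fun_def by blast
qed

lemma functional_separating:
  assumes "subspace V" "x \<notin> V"
  shows "\<exists>\<phi>. lin_fun scale \<phi> \<and> \<phi> x = 1 \<and> (\<forall>v\<in>V. \<phi> v = 0)"
proof -
  interpret vector_space_pair scale "(*) :: 'a \<Rightarrow> 'a \<Rightarrow> 'a" by (rule vector_space_pair_field)
  obtain B where B: "B \<subseteq> V" "independent B" "V \<subseteq> span B"
    using maximal_independent_subset[of V] by blast
  have sB: "span B = V" using B assms(1) by (simp add: span_minimal subset_antisym)
  then have i: "independent (insert x B)" using B assms(2) by (simp add: independent_insertI)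
  obtain \<phi> where \<phi>: "lin_fun scale \<phi>" "\<And>b. b \<in> insert x B \<Longrightarrow> \<phi> b = (if b = x then 1 else 0)"
    using functional_extend[OF i, where f = "\<lambda>b. if b = x then 1 else 0"] by blast
  have "\<phi> v = 0" if "v \<in> V" for v
  proof (rule linear_eq_0_on_span)
    show "Vector_Spaces.linear scale (*) \<phi>" using \<phi>(1) by (simp add: lin_fun_def)
    show "v \<in> span B" using that sB by simp
    show "\<phi> b = 0" if "b \<in> B" for b using \<phi>(2)[of b] that sB assms(2) span_base by fastforce
  qed
  then show ?thesis using \<phi> by auto
qed

lemma lin_fun_iff: "lin_fun scale \<phi> \<longleftrightarrow> (\<forall>x y. \<phi> (x + y) = \<phi> x + \<phi> y) \<and> (\<forall>c x. \<phi> (scale c x) = c * \<phi> x)"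
  using vector_space_pair_field vector_space_axioms
  unfolding lin_fun_def linear_iff vector_space_pair_def by blast

end

text \<open>Extend x to a basis of V: the images of the other basis vectors already span the image.
  The lemma serves to show that a map into a space that is at least as large as V misses a
  vector.\<close>

lemma (in vector_space_pair) dim_image_less:
  assumes "Vector_Spaces.linear s1 s2 f" "vs1.fd V" "vs1.subspace V" "x \<in> V" "x \<noteq> 0" "f x = 0"
  shows "vs2.dim (f ` V) < vs1.dim V"
proof -
  have "vs1.independent {x}" using assms(5) by simp
  then obtain B where B: "{x} \<subseteq> B" "finite B" "B \<subseteq> V" "vs1.span B = V" "card B = vs1.dim V"
    using vs1.fd_basis_extend[OF assms(2,3), of "{x}"] assms(4) by auto
  have "f ` B \<subseteq> vs2.span (f ` (B - {x}))"
  proof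
    fix y assume "y \<in> f ` B"
    then obtain b where b: "b \<in> B" "y = f b" by blast
    show "y \<in> vs2.span (f ` (B - {x}))"
      using b assms(6) vs2.span_zero by (cases "b = x") (auto intro!: vs2.span_base)
  qed
  moreover have "f ` V = vs2.span (f ` B)"
    using linear_span_image[OF assms(1), of B] B by simp
  ultimately have "f ` V \<subseteq> vs2.span (f ` (B - {x}))"
    by (simp add: vs2.span_minimal)
  then have "vs2.dim (f ` V) \<le> card (f ` (B - {x}))" using B by (intro vs2.dim_le_card) auto
  also have "\<dots> \<le> card (B - {x})" using B(2) by (intro card_image_le) simp
  also have "\<dots> < card B" using B by (intro psubset_card_mono) auto
  finally show ?thesis using B by simp
qed

lemma (in vector_space_pair) dim_image_inj_on:
  assumes "Vector_Spaces.linear s1 s2 f" "vs1.fd V" "vs1.subspace V" "\<And>v. v \<in> V \<Longrightarrow> f v = 0 \<Longrightarrow> v = 0"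
  shows "vs2.dim (f ` V) = vs1.dim V"
proof -
  obtain B where B: "finite B" "vs1.independent B" "B \<subseteq> V" "vs1.span B = V" "card B = vs1.dim V"
    using vs1.fd_basis[OF assms(2,3)] by blast
  have inj: "inj_on f V"
  proof (rule inj_onI)
    fix x y assume xy: "x \<in> V" "y \<in> V" "f x = f y"
    then have "x - y = 0"
      using assms(4)[of "x - y"] vs1.subspace_diff[OF assms(3)] linear_diff[OF assms(1), of x y] by simp
    then show "x = y" by simp
  qed
  have "vs2.independent (f ` B)"
    using linear_independent_injective_image[OF assms(1) B(2)] inj B(4) by simp
  moreover have "f ` V = vs2.span (f ` B)"
    using linear_span_image[OF assms(1), of B] B by simp
  ultimately have "vs2.dim (f ` V) = card (f ` B)"
    by (simp add: vs2.dim_eq_card_independent)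
  also have "\<dots> = card B" using inj B(3) by (meson card_image inj_on_subset)
  finally show ?thesis using B by simp
qed

section \<open>Coordinate spaces over a finite index set\<close>

definition fscale :: "'k::field \<Rightarrow> ('i \<Rightarrow> 'k) \<Rightarrow> 'i \<Rightarrow> 'k" where
  "fscale c f = (\<lambda>i. c * f i)"

lemma fscale_apply [simp]: "fscale c f i = c * f i"
  by (simp add: fscale_def)

global_interpretation fv: vector_space fscale
  by unfold_locales (auto simp: fun_eq_iff algebra_simps)

text \<open>For finite Z this is the coordinate space of dimension card Z, realised inside a
  function type so that index sets may vary without new types.\<close>

definition supp_fun :: "'i set \<Rightarrow> ('i \<Rightarrow> 'k::field) set" where
  "supp_fun Z = {f. \<forall>i. i \<notin> Z \<longrightarrow> f i = 0}"

definition unit_fun :: "'i \<Rightarrow> 'i \<Rightarrow> 'k::field" where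
  "unit_fun z = (\<lambda>i. if i = z then 1 else 0)"

lemma unit_fun_apply: "unit_fun z i = (if i = z then 1 else 0)"
  by (simp add: unit_fun_def)

lemma sum_fun_apply: "(\<Sum>a\<in>S. f a) i = (\<Sum>a\<in>S. f a i)"
  by (induction S rule: infinite_finite_induct) auto

lemma supp_fun_expand:
  assumes "finite Z" "f \<in> supp_fun Z"
  shows "f = (\<Sum>z\<in>Z. fscale (f z) (unit_fun z))"
  using assms by (auto simp: fun_eq_iff sum_fun_apply unit_fun_apply supp_fun_def if_distrib
      cong: if_cong)

lemma subspace_supp_fun: "fv.subspace (supp_fun Z)"
  by (auto simp: fv.subspace_def supp_fun_def)

lemma unit_fun_in_supp: "z \<in> Z \<Longrightarrow> unit_fun z \<in> supp_fun Z"
  by (auto simp: supp_fun_def unit_fun_apply)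

lemma supp_fun_eq_span:
  assumes "finite Z"
  shows "(supp_fun Z :: ('i \<Rightarrow> 'k::field) set) = fv.span (unit_fun ` Z)"
proof
  show "(supp_fun Z :: ('i \<Rightarrow> 'k::field) set) \<subseteq> fv.span (unit_fun ` Z)"
  proof
    fix f :: "'i \<Rightarrow> 'k" assume "f \<in> supp_fun Z"
    then have "f = (\<Sum>z\<in>Z. fscale (f z) (unit_fun z))" using assms supp_fun_expand by blast
    also have "\<dots> \<in> fv.span (unit_fun ` Z)"
      by (intro fv.span_sum fv.span_scale fv.span_base) auto
    finally show "f \<in> fv.span (unit_fun ` Z)" .
  qed
  show "fv.span (unit_fun ` Z) \<subseteq> (supp_fun Z :: ('i \<Rightarrow> 'k::field) set)"
    by (rule fv.span_minimal) (auto simp: subspace_supp_fun unit_fun_in_supp)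
qed

lemma fd_supp_fun: "finite Z \<Longrightarrow> fv.fd (supp_fun Z)"
  unfolding fv.fd_def using supp_fun_eq_span by blast

lemma inj_unit_fun: "inj (unit_fun :: 'i \<Rightarrow> 'i \<Rightarrow> 'k::field)"
  by (rule injI) (metis unit_fun_apply zero_neq_one)

lemma dim_supp_fun:
  assumes "finite Z"
  shows "fv.dim (supp_fun Z :: ('i \<Rightarrow> 'k::field) set) = card Z"
proof -
  have "fv.independent (unit_fun ` Z :: ('i \<Rightarrow> 'k) set)"
  proof (rule fv.independent_if_scalars_zero)
    show "finite (unit_fun ` Z)" using assms by simp
    fix c :: "('i \<Rightarrow> 'k) \<Rightarrow> 'k" and x :: "'i \<Rightarrow> 'k"
    assume s: "(\<Sum>x\<in>unit_fun ` Z. fscale (c x) x) = 0" and "x \<in> unit_fun ` Z"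
    then obtain z where z: "z \<in> Z" "x = unit_fun z" by blast
    have "(\<Sum>x\<in>unit_fun ` Z. fscale (c x) x) = (\<Sum>y\<in>Z. fscale (c (unit_fun y)) (unit_fun y))"
      by (rule sum.reindex_cong[of unit_fun]) (auto intro: inj_on_subset[OF inj_unit_fun])
    then have "(\<Sum>y\<in>Z. fscale (c (unit_fun y)) (unit_fun y)) z = 0" using s by simp
    then show "c x = 0" using z assms
      by (simp add: sum_fun_apply unit_fun_apply if_distrib cong: if_cong)
  qed
  then have "fv.dim (supp_fun Z :: ('i \<Rightarrow> 'k) set) = card (unit_fun ` Z :: ('i \<Rightarrow> 'k) set)"
    by (simp add: supp_fun_eq_span[OF assms] fv.dim_eq_card_independent)
  also have "\<dots> = card Z" using inj_unit_fun by (meson card_image inj_on_subset subset_UNIV)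
  finally show ?thesis .
qed

lemma lin_fun_supp_expand:
  assumes "finite Z" "f \<in> supp_fun Z" "lin_fun fscale \<phi>"
  shows "\<phi> f = (\<Sum>z\<in>Z. \<phi> (unit_fun z) * f z)"
proof -
  interpret vector_space_pair fscale "(*) :: 'b \<Rightarrow> 'b \<Rightarrow> 'b" by (rule fv.vector_space_pair_field)
  have l: "Vector_Spaces.linear fscale (*) \<phi>" using assms(3) by (simp add: lin_fun_def)
  have "\<phi> f = \<phi> (\<Sum>z\<in>Z. fscale (f z) (unit_fun z))" using supp_fun_expand[OF assms(1,2)] by simp
  also have "\<dots> = (\<Sum>z\<in>Z. f z * \<phi> (unit_fun z))"
    by (simp add: linear_sum[OF l] linear_scale[OF l])
  finally show ?thesis by (simp add: mult.commute)
qed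

text \<open>A functional that separates g from V, read on the unit vectors, gives the coefficients
  c. Surjectivity claims are proved through this: a missed vector produces a nontrivial linear
  relation on the image.\<close>

lemma annihilator_exists:
  assumes "finite Z" "fv.subspace V" "V \<subseteq> supp_fun Z" "g \<in> supp_fun Z" "g \<notin> V"
  shows "\<exists>c. (\<exists>z\<in>Z. c z \<noteq> 0) \<and> (\<forall>f\<in>V. (\<Sum>z\<in>Z. c z * f z) = 0)"
proof -
  obtain \<phi> where \<phi>: "lin_fun fscale \<phi>" "\<phi> g = 1" "\<And>v. v \<in> V \<Longrightarrow> \<phi> v = 0"
    using fv.functional_separating[OF assms(2,5)] by blast
  let ?c = "\<lambda>z. \<phi> (unit_fun z)"
  have e: "\<phi> f = (\<Sum>z\<in>Z. ?c z * f z)" if "f \<in> supp_fun Z" for f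
    using lin_fun_supp_expand[OF assms(1) that \<phi>(1)] .
  have "\<exists>z\<in>Z. ?c z \<noteq> 0"
  proof (rule ccontr)
    assume "\<not> ?thesis"
    then have "\<phi> g = 0" using e[OF assms(4)] by simp
    then show False using \<phi>(2) by simp
  qed
  moreover have "(\<Sum>z\<in>Z. ?c z * f z) = 0" if "f \<in> V" for f
    using e[of f] \<phi>(3)[OF that] that assms(3) by (metis subsetD)
  ultimately show ?thesis by (intro exI[of _ ?c]) auto
qed

text \<open>If the restrictions of F to V were a proper subspace of the dual, a nonzero vector of V
  would be annihilated by all of F, against \<open>sep\<close>.\<close>

lemma (in vector_space) functionals_onto_dual:
  assumes "fd V" "subspace V"
    and "\<And>f. f \<in> F \<Longrightarrow> lin_fun scale f"
    and "(\<lambda>_. 0) \<in> F" "\<And>f g. f \<in> F \<Longrightarrow> g \<in> F \<Longrightarrow> (\<lambda>x. f x + g x) \<in> F"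
    and "\<And>c f. f \<in> F \<Longrightarrow> (\<lambda>x. c * f x) \<in> F"
    and sep: "\<And>v. v \<in> V \<Longrightarrow> (\<And>f. f \<in> F \<Longrightarrow> f v = 0) \<Longrightarrow> v = 0"
    and \<alpha>: "lin_fun scale \<alpha>"
  shows "\<exists>f\<in>F. \<forall>v\<in>V. f v = \<alpha> v"
proof -
  interpret vector_space_pair scale "(*) :: 'a \<Rightarrow> 'a \<Rightarrow> 'a" by (rule vector_space_pair_field)
  obtain B where B: "finite B" "independent B" "B \<subseteq> V" "span B = V"
    using fd_basis[OF assms(1,2)] by blast
  define R where "R f = (\<lambda>b. if b \<in> B then f b else 0)" for f :: "'b \<Rightarrow> 'a"
  have "fv.subspace (R ` F)"
    unfolding fv.subspace_def
  proof (intro conjI ballI allI)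
    show "0 \<in> R ` F" by (rule image_eqI[OF _ assms(4)]) (simp add: R_def fun_eq_iff)
    show "x + y \<in> R ` F" if xy: "x \<in> R ` F" "y \<in> R ` F" for x y
    proof -
      obtain f g where "f \<in> F" "g \<in> F" "x = R f" "y = R g" using xy by blast
      then show ?thesis using assms(5)[of f g]
        by (intro image_eqI[of _ _ "\<lambda>x. f x + g x"]) (auto simp: R_def fun_eq_iff)
    qed
    show "fscale c x \<in> R ` F" if "x \<in> R ` F" for c x
    proof -
      obtain f where "f \<in> F" "x = R f" using \<open>x \<in> R ` F\<close> by blast
      then show ?thesis using assms(6)[of f c]
        by (intro image_eqI[of _ _ "\<lambda>x. c * f x"]) (auto simp: R_def fun_eq_iff)
    qed
  qed
  moreover have "R ` F \<subseteq> supp_fun B" by (auto simp: supp_fun_def R_def)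
  moreover have "R \<alpha> \<in> supp_fun B" by (auto simp: supp_fun_def R_def)
  moreover have False if c: "\<exists>z\<in>B. c z \<noteq> 0" "\<forall>f\<in>R ` F. (\<Sum>z\<in>B. c z * f z) = 0" for c
  proof -
    \<comment> \<open>The annihilating coefficients live on the dual of the dual; read against the
      basis B they are a vector of V itself.\<close>
    let ?v = "\<Sum>b\<in>B. scale (c b) b"
    have vV: "?v \<in> V" using assms(2) B by (intro subspace_sum subspace_scale) auto
    have "f ?v = 0" if "f \<in> F" for f
    proof -
      have l: "Vector_Spaces.linear scale (*) f" using assms(3)[OF that] by (simp add: lin_fun_def)
      have "f ?v = (\<Sum>b\<in>B. c b * R f b)" by (simp add: linear_sum[OF l] linear_scale[OF l] R_def)
      then show ?thesis using c(2) that by auto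
    qed
    then have "?v = 0" using sep vV by blast
    then show False using c(1) B independentD[of B B c] by blast
  qed
  ultimately have "R \<alpha> \<in> R ` F" using annihilator_exists[OF B(1), of "R ` F" "R \<alpha>"] by metis
  then obtain f where f: "f \<in> F" "R f = R \<alpha>" by auto
  have "f v = \<alpha> v" if "v \<in> V" for v
  proof (rule linear_eq_on)
    show "Vector_Spaces.linear scale (*) f" "Vector_Spaces.linear scale (*) \<alpha>" using f assms(3) \<alpha> by (auto simp: lin_fun_def)
    show "v \<in> span B" using that B by simp
    show "f b = \<alpha> b" if "b \<in> B" for b using fun_cong[OF f(2), of b] that by (simp add: R_def)
  qed
  then show ?thesis using f by blast
qed

section \<open>Finite-dimensional modules and cogenerators\<close>

locale alg_module = vector_space sc
  for sc :: "'k::field \<Rightarrow> 'y::ab_group_add \<Rightarrow> 'y" +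
  fixes scA :: "'k \<Rightarrow> 'a::ring_1 \<Rightarrow> 'a" and A :: "'a set" and act :: "'a \<Rightarrow> 'y \<Rightarrow> 'y" and Y :: "'y set"
  assumes one_in: "1 \<in> A"
    and mult_in: "a \<in> A \<Longrightarrow> b \<in> A \<Longrightarrow> a * b \<in> A"
    and add_in: "a \<in> A \<Longrightarrow> b \<in> A \<Longrightarrow> a + b \<in> A"
    and scale_in: "a \<in> A \<Longrightarrow> scA c a \<in> A"
    and act_add: "act a (x + y) = act a x + act a y"
    and act_scale: "act a (sc c x) = sc c (act a x)"
    and add_act: "a \<in> A \<Longrightarrow> b \<in> A \<Longrightarrow> act (a + b) y = act a y + act b y"
    and scale_act: "a \<in> A \<Longrightarrow> act (scA c a) y = sc c (act a y)"
    and one_act: "y \<in> Y \<Longrightarrow> act 1 y = y"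
    and mult_act: "a \<in> A \<Longrightarrow> b \<in> A \<Longrightarrow> y \<in> Y \<Longrightarrow> act (a * b) y = act a (act b y)"
    and act_in: "a \<in> A \<Longrightarrow> y \<in> Y \<Longrightarrow> act a y \<in> Y"
    and subspace_Y: "subspace Y"
    and fd_Y: "fd Y"
begin

definition orb :: "'y \<Rightarrow> 'y set" where
  "orb y = (\<lambda>a. act a y) ` A"

text \<open>Irreducibility of the cyclic module generated by y, phrased through its generator: every
  nonzero element of the orbit leads back to y.\<close>

definition simple :: "'y \<Rightarrow> bool" where
  "simple y \<longleftrightarrow> y \<in> Y \<and> y \<noteq> 0 \<and> (\<forall>a\<in>A. act a y \<noteq> 0 \<longrightarrow> (\<exists>b\<in>A. act b (act a y) = y))"

text \<open>Evaluation at \<open>y\<close> identifies the module homomorphisms from the cyclic module generated by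
  \<open>y\<close> to \<open>Y\<close> with \<open>dominated y\<close>.\<close>
definition dominated :: "'y \<Rightarrow> 'y set" where
  "dominated y = {z \<in> Y. \<forall>a\<in>A. act a y = 0 \<longrightarrow> act a z = 0}"

definition submod :: "'y set \<Rightarrow> bool" where
  "submod U \<longleftrightarrow> subspace U \<and> U \<subseteq> Y \<and> (\<forall>a\<in>A. \<forall>y\<in>U. act a y \<in> U)"

definition soc :: "'y set" where
  "soc = span {y. simple y}"

lemma act_0 [simp]: "act a 0 = 0"
  using act_add[of a 0 0] by simp

lemma act_minus: "act a (- x) = - act a x"
  using act_add[of a x "- x"] by (simp add: eq_neg_iff_add_eq_0 add.commute)

lemma act_diff: "act a (x - y) = act a x - act a y"
  using act_add[of a x "- y"] by (simp add: act_minus)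

lemma act_sum: "act a (\<Sum>i\<in>I. f i) = (\<Sum>i\<in>I. act a (f i))"
  by (induction I rule: infinite_finite_induct) (auto simp: act_add)


lemma subspace_orb: "subspace (orb y)"
  unfolding subspace_def orb_def
proof (intro conjI ballI allI)
  have "act (scA 0 1) y = 0" using scale_act[OF one_in, of 0 y] by simp
  then show "0 \<in> (\<lambda>a. act a y) ` A" using scale_in[OF one_in, of 0] by (metis imageI)
  fix u v assume "u \<in> (\<lambda>a. act a y) ` A" "v \<in> (\<lambda>a. act a y) ` A"
  then obtain a b where "a \<in> A" "b \<in> A" "u = act a y" "v = act b y" by blast
  then show "u + v \<in> (\<lambda>a. act a y) ` A" using add_in add_act by (metis imageI)
next
  fix c u assume "u \<in> (\<lambda>a. act a y) ` A"
  then obtain a where "a \<in> A" "u = act a y" by blast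
  then show "sc c u \<in> (\<lambda>a. act a y) ` A" using scale_in scale_act by (metis imageI)
qed

lemma orb_subset: "y \<in> Y \<Longrightarrow> orb y \<subseteq> Y"
  unfolding orb_def using act_in by blast

lemma self_in_orb: "y \<in> Y \<Longrightarrow> y \<in> orb y"
  unfolding orb_def using one_in one_act by force

lemma submod_orb: "y \<in> Y \<Longrightarrow> submod (orb y)"
  unfolding submod_def using subspace_orb orb_subset mult_act mult_in
  by (auto simp: orb_def) (metis imageI)

lemma orb_subset_submod: "submod U \<Longrightarrow> y \<in> U \<Longrightarrow> orb y \<subseteq> U"
  unfolding submod_def orb_def by blast

lemma fd_orb: "y \<in> Y \<Longrightarrow> fd (orb y)"
  using fd_subset[OF fd_Y] orb_subset by blast

lemma subspace_dominated: "subspace (dominated y)"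
  unfolding dominated_def subspace_def
  using subspace_Y by (auto simp: act_add act_scale subspace_0 subspace_add subspace_scale)

lemma fd_dominated: "fd (dominated y)"
  using fd_subset[OF fd_Y] dominated_def by blast

lemma self_dominated: "y \<in> Y \<Longrightarrow> y \<in> dominated y"
  unfolding dominated_def by blast

lemma simple_in: "simple y \<Longrightarrow> y \<in> Y"
  by (simp add: simple_def)

lemma simple_act:
  assumes "simple y" "a \<in> A" "act a y \<noteq> 0"
  shows "simple (act a y)"
proof -
  obtain b where b: "b \<in> A" "act b (act a y) = y" using assms by (auto simp: simple_def)
  have y: "y \<in> Y" using assms by (simp add: simple_def)
  have "\<exists>d\<in>A. act d (act c (act a y)) = act a y" if c: "c \<in> A" "act c (act a y) \<noteq> 0" for c
  proof -
    have "act (c * a) y \<noteq> 0" using c assms y by (simp add: mult_act)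
    then obtain d where d: "d \<in> A" "act d (act (c * a) y) = y"
      using assms c mult_in by (auto simp: simple_def)
    have "act (a * d) (act c (act a y)) = act a (act d (act c (act a y)))"
      using assms d c y by (intro mult_act) (auto simp: act_in)
    then have "act (a * d) (act c (act a y)) = act a y"
      using d c assms y by (simp add: mult_act)
    then show ?thesis using mult_in assms d by blast
  qed
  then show ?thesis using assms y by (simp add: simple_def act_in)
qed

text \<open>A nonzero vector of U whose orbit has the smallest dimension is simple: an element of
  its orbit that does not lead back would have a strictly smaller orbit.\<close>

lemma submod_contains_simple:
  assumes "submod U" "u \<in> U" "u \<noteq> 0"
  shows "\<exists>w\<in>U. simple w"
proof -
  let ?P = "\<lambda>w. w \<in> U \<and> w \<noteq> 0"
  obtain w where w: "?P w" "\<And>v. ?P v \<Longrightarrow> dim (orb w) \<le> dim (orb v)"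
    using ex_has_least_nat[of ?P u "\<lambda>v. dim (orb v)"] assms by blast
  have wY: "w \<in> Y" using w assms by (auto simp: submod_def)
  have "\<exists>b\<in>A. act b (act a w) = w" if a: "a \<in> A" "act a w \<noteq> 0" for a
  proof (rule ccontr)
    assume n: "\<not> ?thesis"
    let ?v = "act a w"
    have vU: "?v \<in> U" using w a assms by (auto simp: submod_def)
    have sub: "orb ?v \<subseteq> orb w"
      using orb_subset_submod[OF submod_orb[OF wY]] a by (auto simp: orb_def)
    have "w \<notin> orb ?v" using n by (auto simp: orb_def)
    then have "dim (orb ?v) < dim (orb w)"
      using dim_strict_mono_fd[OF fd_orb[OF wY] sub subspace_orb subspace_orb self_in_orb[OF wY]] by blast
    then show False using w(2)[of ?v] vU a by simp
  qed
  then have "simple w" using w wY by (simp add: simple_def)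
  then show ?thesis using w by blast
qed

lemma submod_soc: "submod soc"
proof -
  have "soc \<subseteq> Y" unfolding soc_def
    by (rule span_minimal) (auto simp: simple_in subspace_Y)
  moreover have "act a y \<in> soc" if "a \<in> A" "y \<in> soc" for a y
    using that(2) unfolding soc_def
  proof (induction rule: span_induct_alt)
    case base then show ?case by (simp add: span_zero)
  next
    case (step c x y)
    have "act a x \<in> span {y. simple y}"
      using simple_act[of x a] step that(1) by (cases "act a x = 0") (auto intro: span_base span_zero)
    then show ?case using step by (simp add: act_add act_scale span_add span_scale)
  qed
  ultimately show ?thesis unfolding submod_def by (auto simp: soc_def)
qed

text \<open>Semisimplicity of the socle. C has maximal dimension among the submodules meeting U
  trivially, encoded as minimality of \<open>dim Y - dim C\<close>. A simple y outside U + C could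
  be adjoined to C without meeting U, because any element of its orbit inside U + C would lead back
  to y.\<close>

lemma submod_complement:
  assumes "submod U"
  shows "\<exists>C. submod C \<and> U \<inter> C = {0} \<and> (\<forall>y\<in>soc. \<exists>u\<in>U. \<exists>c\<in>C. y = u + c)"
proof -
  let ?P = "\<lambda>C. submod C \<and> U \<inter> C = {0}"
  have U: "subspace U" "U \<subseteq> Y" using assms by (auto simp: submod_def)
  have "?P {0}" using U subspace_0 by (auto simp: submod_def subspace_single_0)
  then obtain C where C: "?P C" and Cmin: "\<forall>D. ?P D \<longrightarrow> dim Y - dim C \<le> dim Y - dim D"
    using ex_has_least_nat[of ?P "{0}" "\<lambda>C. dim Y - dim C"] by blast
  have sC: "subspace C" "C \<subseteq> Y" using C by (auto simp: submod_def)
  define S where "S = {u + c |u c. u \<in> U \<and> c \<in> C}"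
  have sS: "subspace S" unfolding S_def by (rule subspace_sums[OF U(1) sC(1)])
  have S_act: "act a x \<in> S" if "a \<in> A" "x \<in> S" for a x
    using that C assms unfolding S_def submod_def by (auto simp: act_add) blast
  have "y \<in> S" if y: "simple y" for y
  proof (rule ccontr)
    assume nS: "y \<notin> S"
    define D where "D = {c + z |c z. c \<in> C \<and> z \<in> orb y}"
    have yY: "y \<in> Y" using y simple_in by blast
    have sD: "subspace D" unfolding D_def by (rule subspace_sums[OF sC(1) subspace_orb])
    have "submod D"
      unfolding submod_def
    proof (intro conjI ballI)
      show "D \<subseteq> Y" unfolding D_def using sC orb_subset[OF yY] subspace_add[OF subspace_Y] by blast
      fix a x assume ax: "a \<in> A" "x \<in> D"
      then obtain c z where cz: "c \<in> C" "z \<in> orb y" "x = c + z" by (auto simp: D_def)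
      then have "act a c \<in> C" "act a z \<in> orb y"
        using ax C submod_orb[OF yY] by (auto simp: submod_def)
      then show "act a x \<in> D" using cz unfolding D_def by (auto simp: act_add)
    qed (rule sD)
    moreover have "U \<inter> D = {0}"
    proof -
      have "x = 0" if x: "x \<in> U" "x \<in> D" for x
      proof -
        obtain c a where ca: "c \<in> C" "a \<in> A" "x = c + act a y" using x by (auto simp: D_def orb_def)
        have "act a y = x + (- c)" using ca by simp
        then have aS: "act a y \<in> S"
          unfolding S_def using x subspace_neg[OF sC(1) ca(1)] by blast
        have "act a y = 0"
        proof (rule ccontr)
          assume "act a y \<noteq> 0"
          then obtain b where "b \<in> A" "act b (act a y) = y" using y ca by (auto simp: simple_def)
          then show False using S_act[OF _ aS, of b] nS by simp
        qed
        then show "x = 0" using ca x C by auto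
      qed
      then show ?thesis using subspace_0[OF U(1)] subspace_0[OF sD] by blast
    qed
    ultimately have "dim Y - dim C \<le> dim Y - dim D" using Cmin by blast
    moreover have "dim D \<le> dim Y"
      using \<open>submod D\<close> dim_mono_fd[OF fd_Y] subspace_Y by (simp add: submod_def)
    moreover have "C \<subseteq> D"
      unfolding D_def using subspace_0[OF subspace_orb[of y]] by force
    moreover have yD: "y \<in> D"
      unfolding D_def using self_in_orb[OF yY] subspace_0[OF sC(1)] by force
    moreover have "y \<notin> C"
    proof
      assume "y \<in> C"
      then have "0 + y \<in> S" unfolding S_def using subspace_0[OF U(1)] by blast
      then show False using nS by simp
    qed
    moreover have "fd D" using \<open>submod D\<close> fd_subset[OF fd_Y] by (auto simp: submod_def)
    ultimately show False
      using dim_strict_mono_fd[of D C y] sC(1) sD by simp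
  qed
  then have "soc \<subseteq> S" unfolding soc_def by (intro span_minimal) (auto simp: sS)
  then show ?thesis using C unfolding S_def by blast
qed

text \<open>The functionals g k are elements of the right module dual to Y. This set is the
  annihilator, within the socle, of the submodule they generate, hence dual to the head of the
  cokernel of the map from a free module of rank r. It is zero exactly when they generate.\<close>

definition coker :: "nat \<Rightarrow> (nat \<Rightarrow> 'y \<Rightarrow> 'k) \<Rightarrow> 'y set" where
  "coker r g = {y \<in> soc. \<forall>k<r. \<forall>a\<in>A. g k (act a y) = 0}"

lemma submod_coker:
  assumes "\<And>k. k < r \<Longrightarrow> lin_fun sc (g k)"
  shows "submod (coker r g)"
proof -
  have s: "submod soc" by (rule submod_soc)
  then have ss: "subspace soc" by (simp add: submod_def)
  have g: "g k (x + y) = g k x + g k y" "g k (sc c x) = c * g k x" if "k < r" for k x y c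
    using assms[OF that] lin_fun_iff by auto
  have g0: "g k 0 = 0" if "k < r" for k using g(2)[OF that, of 0 0] by simp
  have "subspace (coker r g)"
    unfolding subspace_def coker_def
    using ss g g0 by (auto simp: subspace_0 subspace_add subspace_scale act_add act_scale)
  moreover have "act a y \<in> coker r g" if "a \<in> A" "y \<in> coker r g" for a y
  proof -
    have y: "y \<in> soc" "y \<in> Y" using that s by (auto simp: coker_def submod_def)
    have "g k (act b (act a y)) = 0" if "k < r" "b \<in> A" for k b
    proof -
      have "act b (act a y) = act (b * a) y" using mult_act \<open>a \<in> A\<close> that y by simp
      then show ?thesis using \<open>y \<in> coker r g\<close> that \<open>a \<in> A\<close> mult_in by (simp add: coker_def)
    qed
    moreover have "act a y \<in> soc" using s y that by (simp add: submod_def)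
    ultimately show ?thesis by (simp add: coker_def)
  qed
  ultimately show ?thesis using s by (auto simp: submod_def coker_def)
qed

lemma orb_basis:
  assumes "w \<in> Y"
  shows "\<exists>c. (\<forall>e<dim (orb w). c e \<in> A) \<and> inj_on (\<lambda>e. act (c e) w) {..<dim (orb w)}
    \<and> independent ((\<lambda>e. act (c e) w) ` {..<dim (orb w)})
    \<and> span ((\<lambda>e. act (c e) w) ` {..<dim (orb w)}) = orb w"
proof -
  let ?d = "dim (orb w)"
  obtain B where B: "finite B" "independent B" "B \<subseteq> orb w" "span B = orb w" "card B = ?d"
    using fd_basis[OF fd_orb[OF assms] subspace_orb] by blast
  obtain h where h: "bij_betw h {..<?d} B"
    using B ex_bij_betw_nat_finite[of B] by (auto simp: atLeast0LessThan)
  have "\<exists>a\<in>A. act a w = h e" if "e < ?d" for e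
    using bij_betwE[OF h] that B(3) by (fastforce simp: orb_def)
  then obtain c where c: "\<And>e. e < ?d \<Longrightarrow> c e \<in> A \<and> act (c e) w = h e" by metis
  have im: "(\<lambda>e. act (c e) w) ` {..<?d} = B"
    using h c by (auto simp: bij_betw_def)
  have "inj_on (\<lambda>e. act (c e) w) {..<?d}"
    using h c by (auto simp: bij_betw_def inj_on_def)
  then show ?thesis using c im B by (intro exI[of _ c]) auto
qed

lemma linear_eval:
  assumes "\<And>k. k < r \<Longrightarrow> lin_fun sc (g k)"
  shows "Vector_Spaces.linear sc fscale
    (\<lambda>z (k, e). if k < r \<and> e < d then g k (act (c e) z) else 0)"
proof -
  have g: "g k (x + y) = g k x + g k y" "g k (sc c x) = c * g k x" if "k < r" for k x y c
    using assms[OF that] lin_fun_iff by auto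
  show ?thesis
    unfolding linear_iff using g vector_space_axioms fv.vector_space_axioms
    by (auto simp: fun_eq_iff act_add act_scale)
qed

text \<open>A dimension count. The space \<open>dominated w\<close> is mapped by \<open>ev\<close>
  to r * dim (orb w) coordinates and w goes to 0, so by \<open>le\<close> some vector l is missed.
  Changing the functionals by values prescribed by l on the orbit of w, and not at all on a
  complement of that orbit, removes w from the cokernel and adds nothing to it.\<close>

lemma coker_perturb:
  assumes g: "\<And>k. k < r \<Longrightarrow> lin_fun sc (g k)"
    and w: "simple w" "w \<in> coker r g"
    and le: "dim (dominated w) \<le> r * dim (orb w)"
  shows "\<exists>g'. (\<forall>k<r. lin_fun sc (g' k)) \<and> dim (coker r g') < dim (coker r g)"
proof -
  interpret P: vector_space_pair sc "fscale :: 'k \<Rightarrow> (nat \<times> nat \<Rightarrow> 'k) \<Rightarrow> nat \<times> nat \<Rightarrow> 'k" by unfold_locales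
  let ?d = "dim (orb w)"
  have wY: "w \<in> Y" "w \<noteq> 0" using w(1) by (auto simp: simple_def)
  obtain c where c: "\<And>e. e < ?d \<Longrightarrow> c e \<in> A" "inj_on (\<lambda>e. act (c e) w) {..<?d}"
      "independent ((\<lambda>e. act (c e) w) ` {..<?d})"
      "span ((\<lambda>e. act (c e) w) ` {..<?d}) = orb w"
    using orb_basis[OF wY(1)] by blast
  \<comment> \<open>If z is dominated by w and f is the homomorphism with f(w) = z, then
    \<open>ev z\<close> lists the values of the functionals on the f-images of the basis c e w of
    the orbit.\<close>
  define ev where "ev = (\<lambda>z (k, e). if k < r \<and> e < ?d then g k (act (c e) z) else (0::'k))"
  have lev: "Vector_Spaces.linear sc fscale ev" unfolding ev_def by (rule linear_eval[OF g])
  let ?Z = "{..<r} \<times> {..<?d}"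
  have evw: "ev w = 0"
    using w(2) c(1) by (auto simp: ev_def fun_eq_iff coker_def)
  have "fv.dim (ev ` dominated w) < dim (dominated w)"
    by (rule P.dim_image_less[OF lev fd_dominated subspace_dominated self_dominated[OF wY(1)] wY(2) evw])
  also have "\<dots> \<le> fv.dim (supp_fun ?Z :: (nat \<times> nat \<Rightarrow> 'k) set)"
    using le by (simp add: dim_supp_fun)
  finally have dlt: "fv.dim (ev ` dominated w) < fv.dim (supp_fun ?Z :: (nat \<times> nat \<Rightarrow> 'k) set)" .
  have "\<not> (supp_fun ?Z :: (nat \<times> nat \<Rightarrow> 'k) set) \<subseteq> ev ` dominated w"
  proof
    assume sub: "(supp_fun ?Z :: (nat \<times> nat \<Rightarrow> 'k) set) \<subseteq> ev ` dominated w"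
    have "ev ` dominated w \<subseteq> supp_fun ?Z" by (auto simp: ev_def supp_fun_def)
    with sub have "ev ` dominated w = (supp_fun ?Z :: (nat \<times> nat \<Rightarrow> 'k) set)" by blast
    then show False using dlt by simp
  qed
  then obtain l :: "nat \<times> nat \<Rightarrow> 'k" where l: "l \<in> supp_fun ?Z" "l \<notin> ev ` dominated w" by blast
  obtain D where D: "submod D" "orb w \<inter> D = {0}"
      "\<forall>y\<in>soc. \<exists>u\<in>orb w. \<exists>x\<in>D. y = u + x"
    using submod_complement[OF submod_orb[OF wY(1)]] by blast
  have sD: "subspace D" using D(1) by (simp add: submod_def)
  define Q where "Q e \<chi> \<longleftrightarrow> lin_fun sc \<chi> \<and> \<chi> (act (c e) w) = 1
      \<and> (\<forall>e'<?d. e' \<noteq> e \<longrightarrow> \<chi> (act (c e') w) = 0) \<and> (\<forall>x\<in>D. \<chi> x = 0)" for e \<chi>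
  have "\<exists>\<chi>. Q e \<chi>" if e: "e < ?d" for e
  proof -
    let ?O = "span ((\<lambda>e. act (c e) w) ` ({..<?d} - {e}))"
    let ?V = "{x + y |x y. x \<in> D \<and> y \<in> ?O}"
    have sV: "subspace ?V" by (rule subspace_sums[OF sD subspace_span])
    have "act (c e) w \<notin> ?V"
    proof
      assume "act (c e) w \<in> ?V"
      then obtain x y where xy: "x \<in> D" "y \<in> ?O" "act (c e) w = x + y" by blast
      have "y \<in> orb w"
        using xy(2) span_mono[of "(\<lambda>e. act (c e) w) ` ({..<?d} - {e})" "(\<lambda>e. act (c e) w) ` {..<?d}"]
        unfolding c(4) by blast
      moreover have "act (c e) w \<in> orb w" using c(1)[OF e] by (simp add: orb_def)
      ultimately have "act (c e) w - y \<in> orb w" using subspace_diff[OF subspace_orb] by blast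
      then have "x = 0" using xy D(2) by auto
      then have "act (c e) w \<in> ?O" using xy by simp
      moreover have "(\<lambda>e. act (c e) w) ` ({..<?d} - {e}) = (\<lambda>e. act (c e) w) ` {..<?d} - {act (c e) w}"
        using c(2) e by (auto simp: inj_on_def)
      ultimately show False using c(3) e unfolding dependent_def by auto
    qed
    then obtain \<chi> where \<chi>: "lin_fun sc \<chi>" "\<chi> (act (c e) w) = 1" "\<forall>v\<in>?V. \<chi> v = 0"
      using functional_separating[OF sV] by blast
    have "\<chi> (act (c e') w) = 0" if "e' < ?d" "e' \<noteq> e" for e'
    proof -
      have "act (c e') w \<in> ?O" using that by (intro span_base) auto
      then have "0 + act (c e') w \<in> ?V" using subspace_0[OF sD] by blast
      then have "\<chi> (0 + act (c e') w) = 0" using \<chi>(3) by blast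
      then show ?thesis by simp
    qed
    moreover have "\<chi> x = 0" if "x \<in> D" for x
    proof -
      have "x + 0 \<in> ?V" using that span_zero by blast
      then have "\<chi> (x + 0) = 0" using \<chi>(3) by blast
      then show ?thesis by simp
    qed
    ultimately have "Q e \<chi>" unfolding Q_def using \<chi> by blast
    then show ?thesis by blast
  qed
  then obtain \<chi> where "\<And>e. e < ?d \<Longrightarrow> Q e (\<chi> e)" by metis
  then have \<chi>: "\<And>e. e < ?d \<Longrightarrow> lin_fun sc (\<chi> e)"
      "\<And>e. e < ?d \<Longrightarrow> \<chi> e (act (c e) w) = 1"
      "\<And>e e'. e < ?d \<Longrightarrow> e' < ?d \<Longrightarrow> e' \<noteq> e \<Longrightarrow> \<chi> e (act (c e') w) = 0"
      "\<And>e x. e < ?d \<Longrightarrow> x \<in> D \<Longrightarrow> \<chi> e x = 0"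
    unfolding Q_def by blast+
  \<comment> \<open>The \<chi> e are dual to the basis c e w of the orbit and vanish on the
    complement D, so this correction takes the values l on the orbit and 0 on D.\<close>
  define \<eta> where "\<eta> k x = (\<Sum>e<?d. l (k, e) * \<chi> e x)" for k x
  have \<eta>lin: "lin_fun sc (\<eta> k)" for k
    using \<chi>(1) unfolding lin_fun_iff \<eta>_def
    by (auto simp: sum.distrib sum_distrib_left algebra_simps)
  have \<eta>D: "\<eta> k x = 0" if "x \<in> D" for k x using \<chi>(4) that by (simp add: \<eta>_def)
  have \<eta>c: "\<eta> k (act (c e) w) = l (k, e)" if "e < ?d" for k e
  proof -
    have "\<eta> k (act (c e) w) = (\<Sum>e'<?d. if e' = e then l (k, e) else 0)"
      unfolding \<eta>_def using \<chi>(2,3) that by (intro sum.cong) auto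
    then show ?thesis using that by simp
  qed
  define g' where "g' k x = g k x + \<eta> k x" for k x
  have g'lin: "lin_fun sc (g' k)" if "k < r" for k
    using g[OF that] \<eta>lin[of k] unfolding lin_fun_iff g'_def by (auto simp: algebra_simps)
  have smg: "submod (coker r g)" by (rule submod_coker[OF g])
  have smg': "submod (coker r g')" by (rule submod_coker[OF g'lin])
  obtain C where C: "submod C" "coker r g \<inter> C = {0}" "\<forall>y\<in>soc. \<exists>u\<in>coker r g. \<exists>x\<in>C. y = u + x"
    using submod_complement[OF smg] by blast
  \<comment> \<open>Splitting -y along the old cokernel and a complement C leaves a vector z in C
    that is dominated by w and has evaluation l, contrary to the choice of l.\<close>
  have key: False if y: "y \<in> coker r g'" and yx: "y = w + x" "x \<in> D" for y x
  proof -
    have ys: "y \<in> soc" using y by (simp add: coker_def)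
    have gy: "g k (act a y) = - \<eta> k (act a w)" if "k < r" "a \<in> A" for k a
    proof -
      have "g k (act a y) + \<eta> k (act a y) = 0" using y that by (simp add: coker_def g'_def)
      moreover have "\<eta> k (act a y) = \<eta> k (act a w) + \<eta> k (act a x)"
        using \<eta>lin[of k] by (simp add: yx act_add lin_fun_iff)
      moreover have "\<eta> k (act a x) = 0" using yx D(1) that by (intro \<eta>D) (simp add: submod_def)
      ultimately show ?thesis by (simp add: eq_neg_iff_add_eq_0)
    qed
    have "- y \<in> soc" using ys submod_soc subspace_neg by (simp add: submod_def)
    then obtain u z where uz: "u \<in> coker r g" "z \<in> C" "- y = u + z" using C(3) by blast
    have zY: "z \<in> Y" using uz C(1) by (auto simp: submod_def)
    have gz: "g k (act a z) = \<eta> k (act a w)" if "k < r" "a \<in> A" for k a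
    proof -
      have "z = - y - u" using uz(3) by simp
      then have z: "act a z = sc (-1) (act a y) + sc (-1) (act a u)"
        by (simp add: act_minus act_diff)
      have gk: "g k (p + q) = g k p + g k q" "g k (sc e p) = e * g k p" for p q e
        using g[OF that(1)] unfolding lin_fun_iff by blast+
      have "g k (act a z) = - g k (act a y) - g k (act a u)"
        unfolding z gk by simp
      moreover have "g k (act a u) = 0" using uz that by (simp add: coker_def)
      ultimately show ?thesis using gy[OF that] by simp
    qed
    \<comment> \<open>The vector a z lies in the submodule C, and also in the old cokernel, because
      g k (b a z) equals the correction at b a w = 0.\<close>
    have "act a z = 0" if a: "a \<in> A" "act a w = 0" for a
    proof -
      have az: "act a z \<in> C" using C(1) uz a by (simp add: submod_def)
      have "g k (act b (act a z)) = 0" if "k < r" "b \<in> A" for k b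
      proof -
        have "act b (act a z) = act (b * a) z" using a that zY by (simp add: mult_act)
        then have "g k (act b (act a z)) = \<eta> k (act (b * a) w)"
          using gz that a mult_in by simp
        also have "act (b * a) w = 0" using a that wY by (simp add: mult_act)
        finally show ?thesis using \<eta>D[OF subspace_0[OF sD]] by simp
      qed
      moreover have "act a z \<in> soc"
      proof -
        have "z = - y - u" using uz(3) by simp
        then have "z \<in> soc"
          using \<open>- y \<in> soc\<close> uz(1) submod_soc subspace_diff by (auto simp: coker_def submod_def)
        then show ?thesis using submod_soc a by (simp add: submod_def)
      qed
      ultimately have "act a z \<in> coker r g" by (simp add: coker_def)
      then show ?thesis using az C(2) by blast
    qed
    then have "z \<in> dominated w" using zY by (simp add: dominated_def)
    moreover have "ev z = l"
    proof
      fix p :: "nat \<times> nat"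
      obtain k e where p: "p = (k, e)" by (cases p)
      show "ev z p = l p"
        using gz[of k "c e"] c(1)[of e] \<eta>c[of e k] l(1) p by (auto simp: ev_def supp_fun_def)
    qed
    ultimately show False using l(2) by blast
  qed
  have sub: "coker r g' \<subseteq> coker r g \<inter> D"
  proof
    fix y assume y: "y \<in> coker r g'"
    then obtain a x where ax: "a \<in> A" "x \<in> D" "y = act a w + x"
      using D(3) by (auto simp: coker_def orb_def)
    have "act a w = 0"
    proof (rule ccontr)
      assume "act a w \<noteq> 0"
      then obtain b where b: "b \<in> A" "act b (act a w) = w" using w(1) ax by (auto simp: simple_def)
      have "act b y \<in> coker r g'" using smg' y b by (simp add: submod_def)
      moreover have "act b y = w + act b x" using ax b by (simp add: act_add)
      moreover have "act b x \<in> D" using D(1) ax b by (simp add: submod_def)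
      ultimately show False using key by blast
    qed
    then have yD: "y \<in> D" using ax by simp
    have "g k (act a y) = 0" if "k < r" "a \<in> A" for k a
    proof -
      have "\<eta> k (act a y) = 0" using yD D(1) that by (intro \<eta>D) (simp add: submod_def)
      moreover have "g k (act a y) + \<eta> k (act a y) = 0"
        using y that unfolding coker_def g'_def by blast
      ultimately show ?thesis by simp
    qed
    then show "y \<in> coker r g \<inter> D" using y yD by (simp add: coker_def)
  qed
  have "w \<notin> coker r g'" using sub D(2) self_in_orb[OF wY(1)] wY(2) by blast
  then have "dim (coker r g') < dim (coker r g)"
    using dim_strict_mono_fd[of "coker r g" "coker r g'" w] sub smg smg' w(2) fd_subset[OF fd_Y]
    by (auto simp: submod_def)
  then show ?thesis using g'lin by blast
qed

text \<open>Criterion for the dual of Y to be generated by r elements. Since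
  \<open>dominated w\<close> is Hom(A w, Y), the hypothesis bounds the multiplicity of each simple
  module in the socle of Y by r times its multiplicity for a free module of rank one. Functionals
  with the smallest cokernel have none, since otherwise a simple vector of it would allow a
  perturbation.\<close>

lemma cogenerators_exist:
  assumes "\<And>w. simple w \<Longrightarrow> dim (dominated w) \<le> r * dim (orb w)"
  shows "\<exists>g. (\<forall>k<r. lin_fun sc (g k)) \<and> (\<forall>y\<in>Y. (\<forall>k<r. \<forall>a\<in>A. g k (act a y) = 0) \<longrightarrow> y = 0)"
proof -
  let ?P = "\<lambda>g. \<forall>k<r. lin_fun sc (g k)"
  have "?P (\<lambda>_ _. 0)" by (simp add: lin_fun_iff)
  then obtain g where g: "?P g" and gmin: "\<And>g'. ?P g' \<Longrightarrow> dim (coker r g) \<le> dim (coker r g')"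
    using ex_has_least_nat[of ?P "\<lambda>_ _. 0" "\<lambda>g. dim (coker r g)"] by blast
  have smg: "submod (coker r g)" using submod_coker[of r g] g by blast
  have z: "u = 0" if u: "u \<in> coker r g" for u
  proof (rule ccontr)
    assume "u \<noteq> 0"
    then obtain w where w: "w \<in> coker r g" "simple w"
      using submod_contains_simple[OF smg u] by blast
    then obtain g' where "?P g'" "dim (coker r g') < dim (coker r g)"
      using coker_perturb[of r g w] g assms by blast
    then show False using gmin[of g'] by simp
  qed
  have "y = 0" if y: "y \<in> Y" "\<forall>k<r. \<forall>a\<in>A. g k (act a y) = 0" for y
  proof (rule ccontr)
    assume "y \<noteq> 0"
    then obtain w where w: "w \<in> orb y" "simple w"
      using submod_contains_simple[OF submod_orb self_in_orb] y by blast
    then obtain a where a: "a \<in> A" "w = act a y" by (auto simp: orb_def)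
    have "g k (act b w) = 0" if "k < r" "b \<in> A" for k b
    proof -
      have "act b w = act (b * a) y" using a that y by (simp add: mult_act)
      then show ?thesis using y that a mult_in by simp
    qed
    moreover have "w \<in> soc" using w by (simp add: soc_def span_base)
    ultimately have "w \<in> coker r g" by (simp add: coker_def)
    then show False using z w by (auto simp: simple_def)
  qed
  then show ?thesis using g by blast
qed

end

section \<open>Hopf algebras in Sweedler notation\<close>

lemma sum_list_sum_swap:
  "sum_list (map (\<lambda>x. \<Sum>p\<in>P. g x p) xs) = (\<Sum>p\<in>P. sum_list (map (\<lambda>x. g x p) xs))"
  by (induction xs) (auto simp: sum.distrib)

lemma sum_list_concat_map: "sum_list (concat xss) = sum_list (map sum_list xss)"
  by (induction xss) auto

lemma sum_list_hom:
  assumes "\<And>x y. f (x + y) = f x + f y" "f 0 = 0"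
  shows "f (sum_list (map g xs)) = sum_list (map (\<lambda>x. f (g x)) xs)"
  by (induction xs) (auto simp: assms)

section \<open>Evaluating tensors under multilinear maps\<close>

context vector_space
begin

text \<open>Linearity without the vector space axioms of source and target that
  \<open>Vector_Spaces.linear\<close> carries; composite expressions are then shown linear by plain
  introduction rules.\<close>

definition lin :: "('a \<Rightarrow> 'c::ab_group_add \<Rightarrow> 'c) \<Rightarrow> ('b \<Rightarrow> 'c) \<Rightarrow> bool" where
  "lin s f \<longleftrightarrow> (\<forall>x y. f (x + y) = f x + f y) \<and> (\<forall>c x. f (scale c x) = s c (f x))"

lemma lin_fun_lin: "lin_fun scale \<phi> \<longleftrightarrow> lin (*) \<phi>"
  by (simp add: lin_fun_iff lin_def)

lemma lin_addD: "lin s f \<Longrightarrow> f (x + y) = f x + f y"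
  and lin_scaleD: "lin s f \<Longrightarrow> f (scale c x) = s c (f x)"
  by (simp_all add: lin_def)

lemma lin_zeroD: "lin s f \<Longrightarrow> f 0 = 0"
  using lin_addD[of s f 0 0] by simp

lemma lin_sumD: "lin s f \<Longrightarrow> f (\<Sum>i\<in>I. g i) = (\<Sum>i\<in>I. f (g i))"
  by (induction I rule: infinite_finite_induct) (auto simp: lin_zeroD lin_addD)

text \<open>The coefficient of x at p in a fixed basis of the whole space, and 0 if p is not in that
  basis. Products of these functionals suffice to test equality of tensors.\<close>

definition coordinate :: "'b \<Rightarrow> 'b \<Rightarrow> 'a" where
  "coordinate p x = representation (extend_basis {}) x p"

lemma lin_coordinate: "lin (*) (coordinate p)"
  unfolding lin_def coordinate_def
  using independent_extend_basis[OF independent_empty]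
  by (simp add: representation_add representation_scale independent_empty)

lemma finite_coordinate: "finite {p. coordinate p x \<noteq> 0}"
  unfolding coordinate_def by (rule finite_representation)

lemma coordinate_expand:
  assumes "finite Z" "{p. coordinate p x \<noteq> 0} \<subseteq> Z"
  shows "(\<Sum>p\<in>Z. scale (coordinate p x) p) = x"
proof -
  have "(\<Sum>p\<in>Z. scale (coordinate p x) p) = (\<Sum>p | coordinate p x \<noteq> 0. scale (coordinate p x) p)"
    using assms by (intro sum.mono_neutral_right) auto
  also have "\<dots> = x"
    unfolding coordinate_def
    by (intro sum_nonzero_representation_eq independent_extend_basis)
      (auto simp: independent_empty)
  finally show ?thesis .
qed

lemma lin_expand:
  assumes "lin s f" "finite Z" "{p. coordinate p x \<noteq> 0} \<subseteq> Z"
  shows "f x = (\<Sum>p\<in>Z. s (coordinate p x) (f p))"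
proof -
  have "f x = f (\<Sum>p\<in>Z. scale (coordinate p x) p)" using coordinate_expand[OF assms(2,3)] by simp
  also have "\<dots> = (\<Sum>p\<in>Z. s (coordinate p x) (f p))"
    by (simp add: lin_sumD[OF assms(1)] lin_scaleD[OF assms(1)])
  finally show ?thesis .
qed

lemma finite_coordinate_support: "finite S \<Longrightarrow> finite (\<Union>x\<in>S. {p. coordinate p x \<noteq> 0})"
  using finite_coordinate by blast

text \<open>The universal property of the tensor product for this encoding. Finitely many vectors
  involve a finite set Z of basis elements, and there F is a combination of products of two
  coordinate functionals with coefficients F p q; on such products the two lists agree by
  definition.\<close>

lemma tensor_eq_bilinear:
  fixes s :: "'a \<Rightarrow> 'c::ab_group_add \<Rightarrow> 'c"
  assumes t: "tensor_eq scale xs ys" and s: "vector_space s"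
    and F: "\<And>b. lin s (\<lambda>a. F a b)" "\<And>a. lin s (F a)"
  shows "sum_list (map (\<lambda>(a, b). F a b) xs) = sum_list (map (\<lambda>(a, b). F a b) ys)"
proof -
  interpret s: vector_space s by (rule s)
  let ?E = "fst ` set (xs @ ys) \<union> snd ` set (xs @ ys)"
  define Z where "Z = (\<Union>x\<in>?E. {p. coordinate p x \<noteq> 0})"
  have Z: "finite Z" unfolding Z_def by (rule finite_coordinate_support) simp
  have e: "F a b = (\<Sum>p\<in>Z. \<Sum>q\<in>Z. s (coordinate p a * coordinate q b) (F p q))"
    if "(a, b) \<in> set (xs @ ys)" for a b
  proof -
    have "a \<in> ?E" "b \<in> ?E" using that by force+
    then have ab: "{p. coordinate p a \<noteq> 0} \<subseteq> Z" "{p. coordinate p b \<noteq> 0} \<subseteq> Z"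
      unfolding Z_def by blast+
    have "F a b = (\<Sum>p\<in>Z. s (coordinate p a) (F p b))"
      by (rule lin_expand[OF F(1) Z ab(1)])
    also have "\<dots> = (\<Sum>p\<in>Z. s (coordinate p a) (\<Sum>q\<in>Z. s (coordinate q b) (F p q)))"
      by (intro sum.cong refl arg_cong2[where f = s] lin_expand[OF F(2) Z ab(2)])
    finally show ?thesis by (simp add: s.scale_sum_right)
  qed
  have sub: "sum_list (map (\<lambda>(a, b). F a b) zs) =
      (\<Sum>p\<in>Z. \<Sum>q\<in>Z. s (sum_list (map (\<lambda>(a, b). coordinate p a * coordinate q b) zs)) (F p q))"
    if "set zs \<subseteq> set (xs @ ys)" for zs
  proof -
    have h: "s (sum_list (map f zs)) v = sum_list (map (\<lambda>x. s (f x) v) zs)" for f v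
      by (rule sum_list_hom[where f = "\<lambda>c. s c v"]) (auto simp: s.scale_left_distrib)
    have "sum_list (map (\<lambda>(a, b). F a b) zs) =
        sum_list (map (\<lambda>(a, b). \<Sum>p\<in>Z. \<Sum>q\<in>Z. s (coordinate p a * coordinate q b) (F p q)) zs)"
      using that e by (intro arg_cong[where f = sum_list] map_cong) auto
    also have "\<dots> = (\<Sum>p\<in>Z. \<Sum>q\<in>Z. sum_list (map (\<lambda>(a, b). s (coordinate p a * coordinate q b) (F p q)) zs))"
      by (simp add: case_prod_unfold sum_list_sum_swap)
    finally show ?thesis by (simp add: h case_prod_unfold)
  qed
  have "sum_list (map (\<lambda>(a, b). coordinate p a * coordinate q b) xs) =
      sum_list (map (\<lambda>(a, b). coordinate p a * coordinate q b) ys)" for p q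
    using t lin_coordinate unfolding tensor_eq_def lin_fun_lin by blast
  then show ?thesis using sub[of xs] sub[of ys] by simp
qed

lemma tensor_eq3_trilinear:
  fixes s :: "'a \<Rightarrow> 'c::ab_group_add \<Rightarrow> 'c"
  assumes t: "tensor_eq3 scale xs ys" and s: "vector_space s"
    and F: "\<And>b c. lin s (\<lambda>a. F a b c)" "\<And>a c. lin s (\<lambda>b. F a b c)" "\<And>a b. lin s (\<lambda>c. F a b c)"
  shows "sum_list (map (\<lambda>(a, b, c). F a b c) xs) = sum_list (map (\<lambda>(a, b, c). F a b c) ys)"
proof -
  interpret s: vector_space s by (rule s)
  let ?E = "fst ` set (xs @ ys) \<union> (fst \<circ> snd) ` set (xs @ ys) \<union> (snd \<circ> snd) ` set (xs @ ys)"
  define Z where "Z = (\<Union>x\<in>?E. {p. coordinate p x \<noteq> 0})"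
  have Z: "finite Z" unfolding Z_def by (rule finite_coordinate_support) simp
  have e: "F a b c = (\<Sum>p\<in>Z. \<Sum>q\<in>Z. \<Sum>r\<in>Z. s (coordinate p a * coordinate q b * coordinate r c) (F p q r))"
    if "(a, b, c) \<in> set (xs @ ys)" for a b c
  proof -
    have "a \<in> ?E" "b \<in> ?E" "c \<in> ?E" using that by force+
    then have abc: "{p. coordinate p a \<noteq> 0} \<subseteq> Z" "{p. coordinate p b \<noteq> 0} \<subseteq> Z"
        "{p. coordinate p c \<noteq> 0} \<subseteq> Z"
      unfolding Z_def by blast+
    have "F a b c = (\<Sum>p\<in>Z. s (coordinate p a) (F p b c))"
      by (rule lin_expand[OF F(1) Z abc(1)])
    also have "\<dots> = (\<Sum>p\<in>Z. s (coordinate p a) (\<Sum>q\<in>Z. s (coordinate q b) (F p q c)))"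
      by (intro sum.cong refl arg_cong2[where f = s] lin_expand[OF F(2) Z abc(2)])
    also have "\<dots> = (\<Sum>p\<in>Z. s (coordinate p a) (\<Sum>q\<in>Z. s (coordinate q b)
        (\<Sum>r\<in>Z. s (coordinate r c) (F p q r))))"
      by (intro sum.cong refl arg_cong2[where f = s] lin_expand[OF F(3) Z abc(3)])
    finally show ?thesis by (simp add: s.scale_sum_right mult.assoc)
  qed
  have sub: "sum_list (map (\<lambda>(a, b, c). F a b c) zs) = (\<Sum>p\<in>Z. \<Sum>q\<in>Z. \<Sum>r\<in>Z.
      s (sum_list (map (\<lambda>(a, b, c). coordinate p a * coordinate q b * coordinate r c) zs)) (F p q r))"
    if "set zs \<subseteq> set (xs @ ys)" for zs
  proof -
    have h: "s (sum_list (map f zs)) v = sum_list (map (\<lambda>x. s (f x) v) zs)" for f v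
      by (rule sum_list_hom[where f = "\<lambda>c. s c v"]) (auto simp: s.scale_left_distrib)
    have "sum_list (map (\<lambda>(a, b, c). F a b c) zs) = sum_list (map (\<lambda>(a, b, c).
        \<Sum>p\<in>Z. \<Sum>q\<in>Z. \<Sum>r\<in>Z. s (coordinate p a * coordinate q b * coordinate r c) (F p q r)) zs)"
      using that e by (intro arg_cong[where f = sum_list] map_cong) auto
    also have "\<dots> = (\<Sum>p\<in>Z. \<Sum>q\<in>Z. \<Sum>r\<in>Z.
        sum_list (map (\<lambda>(a, b, c). s (coordinate p a * coordinate q b * coordinate r c) (F p q r)) zs))"
      by (simp add: case_prod_unfold sum_list_sum_swap)
    finally show ?thesis by (simp add: h case_prod_unfold)
  qed
  have "sum_list (map (\<lambda>(a, b, c). coordinate p a * coordinate q b * coordinate r c) xs) =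
      sum_list (map (\<lambda>(a, b, c). coordinate p a * coordinate q b * coordinate r c) ys)" for p q r
    using t lin_coordinate unfolding tensor_eq3_def lin_fun_lin by blast
  then show ?thesis using sub[of xs] sub[of ys] by simp
qed

end

section \<open>The Sweedler calculus and the antipode\<close>

locale hopf =
  fixes scale :: "'k::field \<Rightarrow> 'a::ring_1 \<Rightarrow> 'a"
    and \<Delta> :: "'a \<Rightarrow> ('a \<times> 'a) list"
    and \<epsilon> :: "'a \<Rightarrow> 'k"
    and S :: "'a \<Rightarrow> 'a"
  assumes hopf: "hopf_algebra scale \<Delta> \<epsilon> S"

sublocale hopf \<subseteq> vector_space scale
  using hopf by (simp add: hopf_algebra_def)

context hopf
begin

lemma scale_mult_left: "scale c x * y = scale c (x * y)"
  and scale_mult_right: "x * scale c y = scale c (x * y)"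
  using hopf by (simp_all add: hopf_algebra_def) (metis)+

text \<open>Sweedler notation: \<open>sw x F\<close> is the value on \<open>\<Delta> x\<close> of the linear map that sends \<open>a \<otimes> b\<close>
  to \<open>F a b\<close>; it is independent of the representative of \<open>\<Delta> x\<close> when \<open>F\<close> is bilinear.\<close>
definition sw :: "'a \<Rightarrow> ('a \<Rightarrow> 'a \<Rightarrow> 'c::ab_group_add) \<Rightarrow> 'c" where
  "sw x F = sum_list (map (\<lambda>(a, b). F a b) (\<Delta> x))"

lemma vs_scale: "vector_space scale"
  by (rule vector_space_axioms)

lemma vs_field: "vector_space ((*) :: 'k \<Rightarrow> 'k \<Rightarrow> 'k)"
  using vector_space_pair_field by (simp add: vector_space_pair_def)

lemma sw_cong: "(\<And>a b. F a b = G a b) \<Longrightarrow> sw x F = sw x G"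
  by (simp add: sw_def)

lemma sw_hom:
  assumes "\<And>u v. f (u + v) = f u + f v"
  shows "f (sw x F) = sw x (\<lambda>a b. f (F a b))"
proof -
  have "f 0 + f 0 = f 0" using assms[of 0 0] by simp
  then have "f 0 = 0" by simp
  then show ?thesis unfolding sw_def using sum_list_hom[of f] assms by (simp add: case_prod_unfold)
qed

lemma sw_lin: "lin s f \<Longrightarrow> f (sw x F) = sw x (\<lambda>a b. f (F a b))"
  by (rule sw_hom) (simp add: lin_def)

lemma sw_sum: "sw x (\<lambda>a b. \<Sum>i\<in>I. F i a b) = (\<Sum>i\<in>I. sw x (F i))"
  unfolding sw_def by (simp add: case_prod_unfold sum_list_sum_swap)

lemma sw_plus: "sw x (\<lambda>a b. F a b + G a b) = sw x F + sw x G"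
  unfolding sw_def by (simp add: case_prod_unfold sum_list_addf)

lemma sw_minus: "sw x (\<lambda>a b. F a b - G a b) = sw x F - sw x (G :: 'a \<Rightarrow> 'a \<Rightarrow> 'c::ab_group_add)"
  unfolding sw_def by (simp add: case_prod_unfold sum_list_subtractf)

lemma sw_scaled: "vector_space s \<Longrightarrow> sw x (\<lambda>a b. s c (F a b)) = s c (sw x F)"
  by (rule sw_hom[symmetric]) (simp add: vector_space_def)

lemma sw_mult_right: "sw x (\<lambda>a b. F a b * c) = sw x F * (c :: 'c::ring)"
  by (rule sw_hom[where f = "\<lambda>u. u * c", symmetric]) (simp add: distrib_right)

lemma sw_mult_left: "sw x (\<lambda>a b. c * F a b) = c * (sw x F :: 'c::ring)"
  by (rule sw_hom[where f = "\<lambda>u. c * u", symmetric]) (simp add: distrib_left)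

lemma sw_swap: "sw x (\<lambda>a b. sw y (\<lambda>c d. F a b c d)) = sw y (\<lambda>c d. sw x (\<lambda>a b. F a b c d))"
proof -
  have "sum_list (map (\<lambda>u. sum_list (map (\<lambda>v. f u v) ys)) xs) =
      sum_list (map (\<lambda>v. sum_list (map (\<lambda>u. f u v) xs)) ys)"
    for f :: "'a \<times> 'a \<Rightarrow> 'a \<times> 'a \<Rightarrow> 'b" and xs ys
    by (induction xs) (auto simp: sum_list_addf)
  then show ?thesis unfolding sw_def by (simp add: case_prod_unfold)
qed

lemma
  assumes "vector_space s" "\<And>b. lin s (\<lambda>a. F a b)" "\<And>a. lin s (\<lambda>b. F a b)"
  shows sw_add: "sw (x + y) F = sw x F + sw y F"
    and sw_scale: "sw (scale c x) F = s c (sw x F)"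
    and sw_one: "sw 1 F = F 1 1"
    and sw_mult: "sw (x * y) F = sw x (\<lambda>a b. sw y (\<lambda>c d. F (a * c) (b * d)))"
proof -
  note t = tensor_eq_bilinear[OF _ assms]
  interpret s: vector_space s by (rule assms)
  have "tensor_eq scale (\<Delta> (x + y)) (\<Delta> x @ \<Delta> y)" using hopf by (simp add: hopf_algebra_def)
  from t[OF this] show "sw (x + y) F = sw x F + sw y F" by (simp add: sw_def)
  have "tensor_eq scale (\<Delta> (scale c x)) (map (\<lambda>(a, b). (scale c a, b)) (\<Delta> x))"
    using hopf by (simp add: hopf_algebra_def)
  from t[OF this] have "sw (scale c x) F = sw x (\<lambda>a b. F (scale c a) b)"
    by (simp add: sw_def case_prod_unfold o_def)
  also have "\<dots> = s c (sw x F)"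
    using lin_scaleD[OF assms(2)] by (simp add: sw_scaled[OF assms(1)])
  finally show "sw (scale c x) F = s c (sw x F)" .
  have "tensor_eq scale (\<Delta> 1) [(1, 1)]" using hopf by (simp add: hopf_algebra_def)
  from t[OF this] show "sw 1 F = F 1 1" by (simp add: sw_def)
  have "tensor_eq scale (\<Delta> (x * y)) (tmul (\<Delta> x) (\<Delta> y))" using hopf by (simp add: hopf_algebra_def)
  from t[OF this] have "sw (x * y) F = sum_list (map (\<lambda>(a, b). F a b) (tmul (\<Delta> x) (\<Delta> y)))"
    by (simp add: sw_def)
  also have "\<dots> = sw x (\<lambda>a b. sw y (\<lambda>c d. F (a * c) (b * d)))"
    unfolding sw_def tmul_def
    by (simp add: map_concat sum_list_concat_map case_prod_unfold o_def)
  finally show "sw (x * y) F = sw x (\<lambda>a b. sw y (\<lambda>c d. F (a * c) (b * d)))" .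
qed

lemma sw_coassoc:
  assumes "vector_space s" "\<And>b c. lin s (\<lambda>a. F a b c)" "\<And>a c. lin s (\<lambda>b. F a b c)" "\<And>a b. lin s (\<lambda>c. F a b c)"
  shows "sw x (\<lambda>a b. sw a (\<lambda>a1 a2. F a1 a2 b)) = sw x (\<lambda>a b. sw b (\<lambda>b1 b2. F a b1 b2))"
proof -
  have "tensor_eq3 scale
        (concat (map (\<lambda>(a,b). map (\<lambda>(a1,a2). (a1,a2,b)) (\<Delta> a)) (\<Delta> x)))
        (concat (map (\<lambda>(a,b). map (\<lambda>(b1,b2). (a,b1,b2)) (\<Delta> b)) (\<Delta> x)))"
    using hopf by (simp add: hopf_algebra_def)
  from tensor_eq3_trilinear[OF this assms] show ?thesis
    unfolding sw_def by (simp add: map_concat sum_list_concat_map case_prod_unfold o_def)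
qed

lemma lin_id: "lin scale (\<lambda>x. x)"
  by (simp add: lin_def)

lemma lin_ml: "lin scale f \<Longrightarrow> lin scale (\<lambda>x. f x * y)"
  by (simp add: lin_def distrib_right scale_mult_left)

lemma lin_mr: "lin scale f \<Longrightarrow> lin scale (\<lambda>x. y * f x)"
  by (simp add: lin_def distrib_left scale_mult_right)

lemma lin_S: "lin scale f \<Longrightarrow> lin scale (\<lambda>x. S (f x))"
  using hopf by (auto simp: lin_def hopf_algebra_def linear_iff)

lemma lin_eps: "lin scale f \<Longrightarrow> lin (*) (\<lambda>x. \<epsilon> (f x))"
  using hopf by (auto simp: lin_def hopf_algebra_def lin_fun_iff)

lemma lin_scalar_left: "vector_space s \<Longrightarrow> lin (*) f \<Longrightarrow> lin s (\<lambda>x. s (f x) y)"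
proof -
  assume "vector_space s"
  then interpret s: vector_space s .
  show "lin (*) f \<Longrightarrow> ?thesis" by (simp add: lin_def s.scale_left_distrib)
qed

lemma lin_scalar_right: "vector_space s \<Longrightarrow> lin s f \<Longrightarrow> lin s (\<lambda>x. s c (f x))"
proof -
  assume "vector_space s"
  then interpret s: vector_space s .
  show "lin s f \<Longrightarrow> ?thesis" by (simp add: lin_def s.scale_right_distrib mult.commute)
qed

lemma lin_comp: "lin s g \<Longrightarrow> lin scale f \<Longrightarrow> lin s (\<lambda>x. g (f x))"
  by (simp add: lin_def)

lemma lin_sw_arg:
  assumes "vector_space s" "\<And>b. lin s (\<lambda>a. F a b)" "\<And>a. lin s (\<lambda>b. F a b)" "lin scale f"
  shows "lin s (\<lambda>x. sw (f x) F)"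
  using sw_add[OF assms(1-3)] sw_scale[OF assms(1-3)] assms(4) by (simp add: lin_def)

lemma lin_sw_body:
  assumes "vector_space s" "\<And>a b. lin s (\<lambda>x. F x a b)"
  shows "lin s (\<lambda>x. sw c (F x))"
  unfolding lin_def
  by (simp add: lin_addD[OF assms(2)] lin_scaleD[OF assms(2)] sw_plus sw_scaled[OF assms(1)] cong: sw_cong)

lemma lin_zero: "vector_space s \<Longrightarrow> lin s (\<lambda>x. 0)"
proof -
  assume "vector_space s"
  then interpret s: vector_space s .
  show ?thesis by (simp add: lin_def)
qed

lemma lin_plus: "vector_space s \<Longrightarrow> lin s f \<Longrightarrow> lin s g \<Longrightarrow> lin s (\<lambda>x. f x + g x)"
proof -
  assume "vector_space s"
  then interpret s: vector_space s .
  show "lin s f \<Longrightarrow> lin s g \<Longrightarrow> ?thesis" by (simp add: lin_def s.scale_right_distrib)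
qed

lemma lin_minus: "vector_space s \<Longrightarrow> lin s f \<Longrightarrow> lin s g \<Longrightarrow> lin s (\<lambda>x. f x - g x)"
proof -
  assume "vector_space s"
  then interpret s: vector_space s .
  show "lin s f \<Longrightarrow> lin s g \<Longrightarrow> ?thesis" by (simp add: lin_def s.scale_right_diff_distrib)
qed

lemma lin_sum: "vector_space s \<Longrightarrow> (\<And>i. lin s (f i)) \<Longrightarrow> lin s (\<lambda>x. \<Sum>i\<in>I. f i x)"
proof -
  assume "vector_space s"
  then interpret s: vector_space s .
  show "(\<And>i. lin s (f i)) \<Longrightarrow> ?thesis" by (simp add: lin_def sum.distrib s.scale_sum_right)
qed

lemmas lin_intros = vs_scale vs_field lin_id lin_ml lin_mr lin_S lin_eps
  lin_scalar_left[OF vs_scale] lin_scalar_right[OF vs_scale]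
  lin_scalar_left[OF vs_field] lin_scalar_right[OF vs_field] lin_sw_arg lin_sw_body lin_zero lin_plus lin_minus lin_sum

lemma eps_one: "\<epsilon> 1 = 1" and eps_mult: "\<epsilon> (x * y) = \<epsilon> x * \<epsilon> y"
  using hopf by (simp_all add: hopf_algebra_def)

lemma lin_eps_id: "lin (*) \<epsilon>"
  using lin_eps[OF lin_id] .

lemma eps_scale: "\<epsilon> (scale c x) = c * \<epsilon> x"
  using lin_scaleD[OF lin_eps_id] .

text \<open>This and the next three rules carry an arbitrary linear f, because the axioms are
  applied inside integrands whose values may lie in any vector space.\<close>

lemma counit_left: "lin s f \<Longrightarrow> sw x (\<lambda>a b. s (\<epsilon> a) (f b)) = f x"
proof -
  assume f: "lin s f"
  have "f (sw x (\<lambda>a b. scale (\<epsilon> a) b)) = f x" using hopf by (simp add: hopf_algebra_def sw_def)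
  then show ?thesis by (simp add: sw_lin[OF f] lin_scaleD[OF f])
qed

lemma counit_right: "lin s f \<Longrightarrow> sw x (\<lambda>a b. s (\<epsilon> b) (f a)) = f x"
proof -
  assume f: "lin s f"
  have "f (sw x (\<lambda>a b. scale (\<epsilon> b) a)) = f x" using hopf by (simp add: hopf_algebra_def sw_def)
  then show ?thesis by (simp add: sw_lin[OF f] lin_scaleD[OF f])
qed

lemma antipode_left: "lin s f \<Longrightarrow> sw x (\<lambda>a b. f (S a * b)) = s (\<epsilon> x) (f 1)"
proof -
  assume f: "lin s f"
  have "f (sw x (\<lambda>a b. S a * b)) = f (scale (\<epsilon> x) 1)" using hopf by (simp add: hopf_algebra_def sw_def)
  then show ?thesis by (simp add: sw_lin[OF f] lin_scaleD[OF f])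
qed

lemma antipode_right: "lin s f \<Longrightarrow> sw x (\<lambda>a b. f (a * S b)) = s (\<epsilon> x) (f 1)"
proof -
  assume f: "lin s f"
  have "f (sw x (\<lambda>a b. a * S b)) = f (scale (\<epsilon> x) 1)" using hopf by (simp add: hopf_algebra_def sw_def)
  then show ?thesis by (simp add: sw_lin[OF f] lin_scaleD[OF f])
qed

text \<open>Both sides are convolution inverses of the multiplication map. The expression S(x1 y1)
  x2 y2 S(y3) S(x3) collapses from the right to S(x y) and from the left to S(y) S(x).\<close>

lemma S_mult: "S (x * y) = S y * S x"
proof -
  let ?G = "\<lambda>a c d p r t. S (a * p) * (c * r) * (S t * S d)"
  have "sw x (\<lambda>a b. sw b (\<lambda>c d. sw y (\<lambda>p q. sw q (\<lambda>r t. ?G a c d p r t)))) = S (x * y)"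
  proof -
    have "sw q (\<lambda>r t. ?G a c d p r t) = scale (\<epsilon> q) (S (a * p) * c * S d)" for a c d p q
      using antipode_right[of scale "\<lambda>u. S (a * p) * c * u * S d" q] lin_intros
      by (simp add: lin_mr lin_ml lin_id mult.assoc)
    moreover have "sw y (\<lambda>p q. scale (\<epsilon> q) (S (a * p) * c * S d)) = S (a * y) * c * S d" for a c d
      by (rule counit_right) (intro lin_intros)
    moreover have "sw b (\<lambda>c d. S (a * y) * c * S d) = scale (\<epsilon> b) (S (a * y))" for a b
      using antipode_right[of scale "\<lambda>u. S (a * y) * u" b] by (simp add: lin_mr lin_id mult.assoc)
    moreover have "sw x (\<lambda>a b. scale (\<epsilon> b) (S (a * y))) = S (x * y)"
      by (rule counit_right) (intro lin_intros)
    ultimately show ?thesis by simp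
  qed
  moreover have "sw x (\<lambda>a b. sw b (\<lambda>c d. sw y (\<lambda>p q. sw q (\<lambda>r t. ?G a c d p r t)))) = S y * S x"
  proof -
    have "sw y (\<lambda>p q. sw q (\<lambda>r t. ?G a c d p r t)) = sw y (\<lambda>q t. sw q (\<lambda>p r. ?G a c d p r t))" for a c d
      by (rule sw_coassoc[OF vs_scale, symmetric]) (intro lin_intros)+
    moreover have "sw x (\<lambda>a b. sw b (\<lambda>c d. sw y (\<lambda>q t. sw q (\<lambda>p r. ?G a c d p r t)))) =
        sw x (\<lambda>b d. sw b (\<lambda>a c. sw y (\<lambda>q t. sw q (\<lambda>p r. ?G a c d p r t))))"
      by (rule sw_coassoc[OF vs_scale, symmetric]) (intro lin_intros)+
    moreover have "sw b (\<lambda>a c. sw y (\<lambda>q t. sw q (\<lambda>p r. ?G a c d p r t))) =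
        sw y (\<lambda>q t. scale (\<epsilon> b * \<epsilon> q) (S t * S d))" for b d
    proof -
      have "sw b (\<lambda>a c. sw q (\<lambda>p r. ?G a c d p r t)) = scale (\<epsilon> b * \<epsilon> q) (S t * S d)" for q t
      proof -
        have "sw b (\<lambda>a c. sw q (\<lambda>p r. ?G a c d p r t)) = sw (b * q) (\<lambda>u v. S u * v * (S t * S d))"
          by (rule sw_mult[OF vs_scale, symmetric]) (intro lin_intros)+
        also have "\<dots> = scale (\<epsilon> (b * q)) (1 * (S t * S d))"
          by (rule antipode_left) (intro lin_intros)
        finally show ?thesis by (simp add: eps_mult)
      qed
      then show ?thesis by (subst sw_swap) simp
    qed
    moreover have "sw y (\<lambda>q t. scale (\<epsilon> b * \<epsilon> q) (S t * S d)) = scale (\<epsilon> b) (S y * S d)" for b d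
    proof -
      have "sw y (\<lambda>q t. scale (\<epsilon> q) (scale (\<epsilon> b) (S t * S d))) = scale (\<epsilon> b) (S y * S d)"
        by (rule counit_left) (intro lin_intros)
      then show ?thesis by (simp add: mult.commute)
    qed
    moreover have "sw x (\<lambda>b d. scale (\<epsilon> b) (S y * S d)) = S y * S x"
      by (rule counit_left) (intro lin_intros)
    ultimately show ?thesis by simp
  qed
  ultimately show ?thesis by simp
qed

definition T :: "'a \<Rightarrow> 'a" where
  "T = inv S"

lemma S_T: "S (T x) = x" and T_S: "T (S x) = x"
  using hopf unfolding T_def hopf_algebra_def by (simp_all add: bij_is_surj surj_f_inv_f bij_is_inj)

lemma S_eq_iff: "S x = S y \<longleftrightarrow> x = y"
  by (metis T_S)

lemma S_scale: "S (scale c x) = scale c (S x)"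
  using lin_scaleD[OF lin_S[OF lin_id]] .

lemma S_one: "S 1 = 1"
proof -
  have "sw 1 (\<lambda>a b. S a * b) = scale (\<epsilon> 1) 1" using antipode_left[OF lin_id] .
  moreover have "sw 1 (\<lambda>a b. S a * b) = S 1 * 1" by (rule sw_one[OF vs_scale]) (intro lin_intros)+
  ultimately show ?thesis by (simp add: eps_one)
qed

lemma lin_T: "lin scale f \<Longrightarrow> lin scale (\<lambda>x. T (f x))"
  unfolding lin_def using S_eq_iff S_T lin_addD[OF lin_S[OF lin_id]] S_scale by metis

text \<open>S reverses products, so applying it to the sum of x2 T(x1) gives the sum of x1 S(x2); S
  is injective and fixes scalar multiples of 1.\<close>

lemma T_skew_antipode: "lin s f \<Longrightarrow> sw x (\<lambda>a b. f (b * T a)) = s (\<epsilon> x) (f 1)"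
proof -
  assume f: "lin s f"
  have "S (sw x (\<lambda>a b. b * T a)) = sw x (\<lambda>a b. a * S b)"
    by (simp add: sw_lin[OF lin_S[OF lin_id]] S_mult S_T)
  also have "\<dots> = S (scale (\<epsilon> x) 1)" using antipode_right[OF lin_id] by (simp add: S_scale S_one)
  finally have "sw x (\<lambda>a b. b * T a) = scale (\<epsilon> x) 1" by (simp add: S_eq_iff)
  then have "f (sw x (\<lambda>a b. b * T a)) = s (\<epsilon> x) (f 1)" by (simp add: lin_scaleD[OF f])
  then show ?thesis by (simp add: sw_lin[OF f])
qed

text \<open>A left subcomodule: the comultiplication maps X into H \<otimes> X. Slicing the first
  leg by functionals expresses this without choosing representatives whose second legs lie in
  X.\<close>

definition costable :: "'a set \<Rightarrow> bool" where
  "costable X \<longleftrightarrow> subspace X \<and> (\<forall>x\<in>X. \<forall>\<mu>. lin (*) \<mu> \<longrightarrow> sw x (\<lambda>p q. scale (\<mu> p) q) \<in> X)"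

lemma costable_subspace: "costable X \<Longrightarrow> subspace X"
  by (simp add: costable_def)

lemma costable_sw_in:
  assumes X: "costable X" "x \<in> X" and s: "vector_space s"
    and F: "\<And>b. lin s (\<lambda>a. F a b)" "\<And>a. lin s (\<lambda>b. F a b)"
    and V: "module.subspace s V" "\<And>p q. q \<in> X \<Longrightarrow> F p q \<in> V"
  shows "sw x F \<in> V"
proof -
  interpret s: vector_space s by (rule s)
  define Z where "Z = (\<Union>y\<in>fst ` set (\<Delta> x). {p. coordinate p y \<noteq> 0})"
  have Z: "finite Z" unfolding Z_def by (rule finite_coordinate_support) simp
  have "F a b = (\<Sum>p\<in>Z. s (coordinate p a) (F p b))" if "(a, b) \<in> set (\<Delta> x)" for a b
    using lin_expand[OF F(1) Z, of a b] that by (force simp: Z_def)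
  then have "sw x F = sw x (\<lambda>a b. \<Sum>p\<in>Z. s (coordinate p a) (F p b))"
    unfolding sw_def by (intro arg_cong[where f = sum_list] map_cong) auto
  also have "\<dots> = (\<Sum>p\<in>Z. sw x (\<lambda>a b. s (coordinate p a) (F p b)))" by (rule sw_sum)
  also have "\<dots> = (\<Sum>p\<in>Z. F p (sw x (\<lambda>a b. scale (coordinate p a) b)))"
    by (simp add: sw_lin[OF F(2)] lin_scaleD[OF F(2)])
  also have "\<dots> \<in> V"
    using X V lin_coordinate by (intro s.subspace_sum) (auto simp: costable_def)
  finally show ?thesis .
qed

lemma costable_sw_cong:
  assumes X: "costable X" "x \<in> X" and s: "vector_space s"
    and F: "\<And>b. lin s (\<lambda>a. F a b)" "\<And>a. lin s (\<lambda>b. F a b)"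
    and G: "\<And>b. lin s (\<lambda>a. G a b)" "\<And>a. lin s (\<lambda>b. G a b)"
    and eq: "\<And>p q. q \<in> X \<Longrightarrow> F p q = G p q"
  shows "sw x F = sw x G"
proof -
  interpret s: vector_space s by (rule s)
  have "sw x (\<lambda>a b. F a b - G a b) \<in> {0}"
    by (rule costable_sw_in[OF X s]) (auto simp: eq intro!: lin_minus s F G)
  then show ?thesis by (simp add: sw_minus)
qed

end

section \<open>Antipode shifts and the Haar functional\<close>

context hopf
begin

text \<open>Evaluate S(a1) a2 L1 \<otimes> a3 L2 twice: a2 and a3 combine with L to the
  comultiplication of a2 L, where A acts by the counit, while S(a1) a2 contracts by the antipode
  axiom. Of A only costability and the action on L are assumed, not closure under products; for
  elements of integral type that closure is deduced from this identity.\<close>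

lemma antipode_shift_left:
  assumes A: "costable A" "a \<in> A" and L: "\<And>x. x \<in> A \<Longrightarrow> x * L = scale (\<epsilon> x) L"
    and s: "vector_space s" and F: "\<And>b. lin s (\<lambda>a. F a b)" "\<And>a. lin s (\<lambda>b. F a b)"
  shows "sw L (\<lambda>p q. F p (a * q)) = sw L (\<lambda>p q. F (S a * p) q)"
proof -
  have Fl: "lin s (\<lambda>x. F (f x) b)" if "lin scale f" for f b using lin_comp[OF F(1) that] .
  have Fr: "lin s (\<lambda>x. F b (f x))" if "lin scale f" for f b using lin_comp[OF F(2) that] .
  note I = s Fl Fr lin_intros
  let ?K = "sw a (\<lambda>u v. sw v (\<lambda>x y. sw L (\<lambda>p q. F (S u * (x * p)) (y * q))))"
  have "?K = sw a (\<lambda>u v. sw (v * L) (\<lambda>p q. F (S u * p) q))"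
    by (subst sw_mult[OF s]) (intro I refl)+
  also have "\<dots> = sw a (\<lambda>u v. s (\<epsilon> v) (sw L (\<lambda>p q. F (S u * p) q)))"
  proof (rule costable_sw_cong[OF A s])
    fix u v assume "v \<in> A"
    then have "sw (v * L) (\<lambda>p q. F (S u * p) q) = sw (scale (\<epsilon> v) L) (\<lambda>p q. F (S u * p) q)" by (simp add: L)
    also have "\<dots> = s (\<epsilon> v) (sw L (\<lambda>p q. F (S u * p) q))" by (rule sw_scale[OF s]) (intro I)+
    finally show "sw (v * L) (\<lambda>p q. F (S u * p) q) = s (\<epsilon> v) (sw L (\<lambda>p q. F (S u * p) q))" .
  qed (intro I lin_scalar_left[OF s] lin_scalar_right[OF s])+
  also have "\<dots> = sw L (\<lambda>p q. F (S a * p) q)" by (rule counit_right) (intro I)+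
  finally have 1: "?K = sw L (\<lambda>p q. F (S a * p) q)" .
  have "?K = sw a (\<lambda>u v. sw u (\<lambda>x y. sw L (\<lambda>p q. F (S x * (y * p)) (v * q))))"
    by (rule sw_coassoc[OF s, symmetric]) (intro I)+
  also have "\<dots> = sw a (\<lambda>u v. sw u (\<lambda>x y. sw L (\<lambda>p q. F (S x * y * p) (v * q))))"
    by (simp add: mult.assoc)
  also have "\<dots> = sw a (\<lambda>u v. s (\<epsilon> u) (sw L (\<lambda>p q. F (1 * p) (v * q))))"
    by (intro sw_cong antipode_left[where f = "\<lambda>z. sw L (\<lambda>p q. F (z * p) (_ * q))"] I)
  also have "\<dots> = sw L (\<lambda>p q. F p (a * q))"
    by (subst counit_left) (intro I | simp)+
  finally show ?thesis using 1 by simp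
qed

text \<open>The mirror image, from L1 a2 T(a1) \<otimes> L2 a3. The factor a2 T(a1) appears in
  reversed order, so the inverse antipode takes the place of S.\<close>

lemma antipode_shift_right:
  assumes A: "costable A" "a \<in> A" and L: "\<And>x. x \<in> A \<Longrightarrow> L * x = scale (\<epsilon> x) L"
    and s: "vector_space s" and F: "\<And>b. lin s (\<lambda>a. F a b)" "\<And>a. lin s (\<lambda>b. F a b)"
  shows "sw L (\<lambda>p q. F p (q * a)) = sw L (\<lambda>p q. F (p * T a) q)"
proof -
  have Fl: "lin s (\<lambda>x. F (f x) b)" if "lin scale f" for f b using lin_comp[OF F(1) that] .
  have Fr: "lin s (\<lambda>x. F b (f x))" if "lin scale f" for f b using lin_comp[OF F(2) that] .
  note I = s Fl Fr lin_T lin_intros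
  let ?K = "sw a (\<lambda>u v. sw v (\<lambda>x y. sw L (\<lambda>p q. F (p * x * T u) (q * y))))"
  have "sw v (\<lambda>x y. sw L (\<lambda>p q. F (p * x * T u) (q * y))) = sw (L * v) (\<lambda>p q. F (p * T u) q)" for u v
  proof -
    have "sw (L * v) (\<lambda>p q. F (p * T u) q) = sw L (\<lambda>p q. sw v (\<lambda>x y. F (p * x * T u) (q * y)))"
      by (rule sw_mult[OF s]) (intro I)+
    then show ?thesis by (subst sw_swap) simp
  qed
  then have "?K = sw a (\<lambda>u v. sw (L * v) (\<lambda>p q. F (p * T u) q))" by simp
  also have "\<dots> = sw a (\<lambda>u v. s (\<epsilon> v) (sw L (\<lambda>p q. F (p * T u) q)))"
  proof (rule costable_sw_cong[OF A s])
    fix u v assume "v \<in> A"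
    then have "sw (L * v) (\<lambda>p q. F (p * T u) q) = sw (scale (\<epsilon> v) L) (\<lambda>p q. F (p * T u) q)" by (simp add: L)
    also have "\<dots> = s (\<epsilon> v) (sw L (\<lambda>p q. F (p * T u) q))" by (rule sw_scale[OF s]) (intro I)+
    finally show "sw (L * v) (\<lambda>p q. F (p * T u) q) = s (\<epsilon> v) (sw L (\<lambda>p q. F (p * T u) q))" .
  qed (intro I lin_scalar_left[OF s] lin_scalar_right[OF s])+
  also have "\<dots> = sw L (\<lambda>p q. F (p * T a) q)" by (rule counit_right) (intro I)+
  finally have 1: "?K = sw L (\<lambda>p q. F (p * T a) q)" .
  have "?K = sw a (\<lambda>u v. sw u (\<lambda>x y. sw L (\<lambda>p q. F (p * y * T x) (q * v))))"
    by (rule sw_coassoc[OF s, symmetric]) (intro I)+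
  also have "\<dots> = sw a (\<lambda>u v. sw u (\<lambda>x y. sw L (\<lambda>p q. F (p * (y * T x)) (q * v))))"
    by (simp add: mult.assoc)
  also have "\<dots> = sw a (\<lambda>u v. s (\<epsilon> u) (sw L (\<lambda>p q. F (p * 1) (q * v))))"
    by (intro sw_cong T_skew_antipode[where f = "\<lambda>z. sw L (\<lambda>p q. F (p * z) (q * _))"] I)
  also have "\<dots> = sw L (\<lambda>p q. F p (q * a))"
    by (subst counit_left) (intro I | simp)+
  finally show ?thesis using 1 by simp
qed

text \<open>Evaluate x1 y2 T(y1) h(x2 y3) twice, by invariance at x y2 and by the skew antipode
  axiom. The identity moves a slice of x to a slice of y under h, which makes the radical of the
  Haar form a subcomodule.\<close>

lemma invariant_functional_shift:
  assumes h: "lin (*) h" "\<And>x. sw x (\<lambda>p q. scale (h q) p) = scale (h x) 1"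
  shows "sw x (\<lambda>p q. scale (h (q * y)) p) = sw y (\<lambda>u v. scale (h (x * v)) (T u))"
proof -
  have hI: "lin (*) (\<lambda>x. h (f x))" if "lin scale f" for f using lin_comp[OF h(1) that] .
  note I = hI lin_T lin_intros
  let ?K = "sw y (\<lambda>u v. sw v (\<lambda>r t. sw x (\<lambda>p q. scale (h (q * t)) (p * (r * T u)))))"
  have "sw v (\<lambda>r t. sw x (\<lambda>p q. scale (h (q * t)) (p * (r * T u)))) = scale (h (x * v)) (T u)" for u v
  proof -
    have "sw x (\<lambda>p q. sw v (\<lambda>r t. scale (h (q * t)) (p * r))) = sw (x * v) (\<lambda>p q. scale (h q) p)"
      by (rule sw_mult[OF vs_scale, symmetric]) (intro I)+
    then have "sw v (\<lambda>r t. sw x (\<lambda>p q. scale (h (q * t)) (p * r))) = scale (h (x * v)) 1"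
      by (subst sw_swap) (simp add: h(2))
    then have "sw v (\<lambda>r t. sw x (\<lambda>p q. scale (h (q * t)) (p * r))) * T u = scale (h (x * v)) (T u)"
      by (simp add: scale_mult_left)
    then show ?thesis by (simp add: sw_mult_right[symmetric] scale_mult_left mult.assoc)
  qed
  then have 1: "?K = sw y (\<lambda>u v. scale (h (x * v)) (T u))" by simp
  have "?K = sw y (\<lambda>u v. sw u (\<lambda>r t. sw x (\<lambda>p q. scale (h (q * v)) (p * (t * T r)))))"
    by (rule sw_coassoc[OF vs_scale, symmetric]) (intro I)+
  also have "\<dots> = sw y (\<lambda>u v. scale (\<epsilon> u) (sw x (\<lambda>p q. scale (h (q * v)) (p * 1))))"
    by (intro sw_cong T_skew_antipode[where f = "\<lambda>z. sw x (\<lambda>p q. scale (h (q * _)) (p * z))"] I)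
  also have "\<dots> = sw x (\<lambda>p q. scale (h (q * y)) p)"
    by (subst counit_left) (intro I | simp)+
  finally show ?thesis using 1 by simp
qed

section \<open>Simple subcoalgebras and the Haar functional\<close>

lemma subcoalgebra_sw_in:
  assumes "subcoalgebra scale \<Delta> C" "c \<in> C"
    and F: "\<And>b. lin scale (\<lambda>a. F a b)" "\<And>a. lin scale (\<lambda>b. F a b)"
    and V: "subspace V" "\<And>p q. p \<in> C \<Longrightarrow> q \<in> C \<Longrightarrow> F p q \<in> V"
  shows "sw c F \<in> V"
proof -
  obtain xs where xs: "set xs \<subseteq> C \<times> C" "tensor_eq scale (\<Delta> c) xs"
    using assms(1,2) unfolding subcoalgebra_def by blast
  have "sw c F = sum_list (map (\<lambda>(a, b). F a b) xs)"
    unfolding sw_def by (rule tensor_eq_bilinear[OF xs(2) vs_scale F])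
  also have "\<dots> \<in> V"
    using xs(1) by (induction xs) (auto simp: subspace_0[OF V(1)] subspace_add[OF V(1)] V(2))
  finally show ?thesis .
qed

lemma subcoalgebra_subspace: "subcoalgebra scale \<Delta> C \<Longrightarrow> subspace C"
  by (simp add: subcoalgebra_def)

lemma costable_subcoalgebra:
  assumes "subcoalgebra scale \<Delta> C"
  shows "costable C"
  unfolding costable_def
proof (intro conjI ballI allI impI)
  show s: "subspace C" using assms by (rule subcoalgebra_subspace)
  fix x \<mu> assume "x \<in> C" and \<mu>: "lin (*) (\<mu> :: 'a \<Rightarrow> 'k)"
  then show "sw x (\<lambda>p q. scale (\<mu> p) q) \<in> C"
    by (intro subcoalgebra_sw_in[OF assms]) (auto intro!: lin_intros \<mu> subspace_scale s)
qed

lemma costable_span: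
  assumes "\<And>b \<mu>. b \<in> B \<Longrightarrow> lin (*) \<mu> \<Longrightarrow> sw b (\<lambda>p q. scale (\<mu> p) q) \<in> span B"
  shows "costable (span B)"
  unfolding costable_def
proof (intro conjI ballI allI impI)
  fix x \<mu> assume x: "x \<in> span B" and \<mu>: "lin (*) (\<mu> :: 'a \<Rightarrow> 'k)"
  have l: "lin scale (\<lambda>x. sw x (\<lambda>p q. scale (\<mu> p) q))" by (intro lin_intros \<mu>)
  show "sw x (\<lambda>p q. scale (\<mu> p) q) \<in> span B"
    using x
  proof (induction rule: span_induct_alt)
    case base then show ?case using lin_zeroD[OF l] by (simp add: span_zero)
  next
    case (step c x y)
    then show ?case using lin_addD[OF l] lin_scaleD[OF l] assms[OF _ \<mu>] by (simp add: span_add span_scale)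
  qed
qed simp

lemma costable_span_Union:
  assumes "\<And>C. C \<in> \<C> \<Longrightarrow> costable C"
  shows "costable (span (\<Union>\<C>))"
proof (rule costable_span)
  fix b \<mu> assume "b \<in> \<Union>\<C>" "lin (*) (\<mu> :: 'a \<Rightarrow> 'k)"
  then have "sw b (\<lambda>p q. scale (\<mu> p) q) \<in> \<Union>\<C>" using assms unfolding costable_def by blast
  then show "sw b (\<lambda>p q. scale (\<mu> p) q) \<in> span (\<Union>\<C>)" by (rule span_base)
qed

lemma subcoalgebra_span_one: "subcoalgebra scale \<Delta> (span {1})"
  unfolding subcoalgebra_def
proof (intro conjI ballI)
  fix c assume "c \<in> span {1::'a}"
  then obtain k where k: "c = scale k 1" by (auto simp: span_singleton)
  have "tensor_eq scale (\<Delta> c) [(c, 1)]"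
    unfolding tensor_eq_def
  proof (intro allI impI)
    fix \<phi> \<psi> assume *: "lin_fun scale \<phi> \<and> lin_fun scale \<psi>"
    then have l: "lin (*) \<phi>" "lin (*) \<psi>" by (simp_all add: lin_fun_lin)
    have "sw (scale k 1) (\<lambda>a b. \<phi> a * \<psi> b) = k * sw 1 (\<lambda>a b. \<phi> a * \<psi> b)"
      by (rule sw_scale[OF vs_field]) (intro lin_intros l)+
    also have "sw 1 (\<lambda>a b. \<phi> a * \<psi> b) = \<phi> 1 * \<psi> 1"
      by (rule sw_one[OF vs_field]) (intro lin_intros l)+
    finally show "sum_list (map (\<lambda>(a, b). \<phi> a * \<psi> b) (\<Delta> c)) = sum_list (map (\<lambda>(a, b). \<phi> a * \<psi> b) [(c, 1)])"
      using lin_scaleD[OF l(1)] by (simp add: sw_def k)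
  qed
  moreover have "set [(c, 1)] \<subseteq> span {1} \<times> span {1}" using \<open>c \<in> span {1}\<close> by (simp add: span_base)
  ultimately show "\<exists>xs. set xs \<subseteq> span {1} \<times> span {1} \<and> tensor_eq scale (\<Delta> c) xs" by blast
qed simp

text \<open>The part of the directness of sums of simple subcoalgebras that concerns the unit
  coalgebra. By induction the unit lies outside the sum D of the earlier ones, so a functional
  separates it from D.\<close>

lemma one_not_in_sum_simples:
  assumes "finite \<C>" "\<And>C. C \<in> \<C> \<Longrightarrow> simple_subcoalgebra scale \<Delta> C \<and> C \<noteq> span {1}"
  shows "1 \<notin> span (\<Union>\<C>)"
  using assms
proof (induction \<C> rule: finite_induct)
  case empty then show ?case by simp
next
  case (insert E \<C>)
  let ?D = "span (\<Union>\<C>)"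
  have 1: "1 \<notin> ?D" using insert by blast
  have E: "subcoalgebra scale \<Delta> E" "E \<noteq> span {1}"
      "\<And>D. subcoalgebra scale \<Delta> D \<Longrightarrow> D \<subseteq> E \<Longrightarrow> D = {0} \<or> D = E"
    using insert.prems[of E] by (auto simp: simple_subcoalgebra_def)
  have sE: "subspace E" using E(1) by (rule subcoalgebra_subspace)
  have cD: "costable ?D"
    using insert.prems by (intro costable_span_Union costable_subcoalgebra) (auto simp: simple_subcoalgebra_def)
  show ?case
  proof
    assume "1 \<in> span (\<Union>(insert E \<C>))"
    then have "1 \<in> {x + y |x y. x \<in> span E \<and> y \<in> ?D}" by (simp add: span_Un)
    moreover have "span E = E" using sE by (simp add: span_eq_iff)
    ultimately obtain e d where ed: "e \<in> E" "d \<in> ?D" "1 = e + d" by auto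
    obtain \<psi> where \<psi>: "lin_fun scale \<psi>" "\<psi> 1 = 1" "\<forall>v\<in>?D. \<psi> v = 0"
      using functional_separating[OF subspace_span 1] by blast
    have l\<psi>: "lin (*) \<psi>" using \<psi>(1) by (simp add: lin_fun_lin)
    \<comment> \<open>This functional vanishes at 1 and agrees with the counit on D. Convolution
      with it kills 1, fixes d and preserves E, so 1 = e + d forces d into E, and then E contains
      the unit coalgebra.\<close>
    define \<phi> where "\<phi> x = \<epsilon> x - \<psi> x" for x
    have l\<phi>: "lin (*) \<phi>" unfolding \<phi>_def by (intro lin_intros l\<psi>)
    let ?f = "\<lambda>x. sw x (\<lambda>p q. scale (\<phi> q) p)"
    have lf: "lin scale ?f" by (intro lin_intros l\<phi>)
    have "?f 1 = scale (\<phi> 1) 1" by (rule sw_one[OF vs_scale]) (intro lin_intros l\<phi>)+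
    then have "?f 1 = 0" by (simp add: \<phi>_def eps_one \<psi>(2))
    moreover have "?f d = d"
    proof -
      have "?f d = sw d (\<lambda>p q. scale (\<epsilon> q) p)"
        by (rule costable_sw_cong[OF cD ed(2) vs_scale])
          (auto intro!: lin_intros l\<phi> l\<psi> simp: \<phi>_def \<psi>(3))
      also have "\<dots> = d" by (rule counit_right) (rule lin_id)
      finally show ?thesis .
    qed
    moreover have "?f e \<in> E"
      by (rule subcoalgebra_sw_in[OF E(1) ed(1)]) (auto intro!: lin_intros l\<phi> subspace_scale sE)
    moreover have "?f 1 = ?f e + ?f d" using lin_addD[OF lf] ed(3) by metis
    ultimately have "d = - ?f e" by (simp add: eq_neg_iff_add_eq_0 add.commute)
    then have "d \<in> E" using subspace_neg[OF sE \<open>?f e \<in> E\<close>] by simp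
    then have "1 \<in> E" using subspace_add[OF sE ed(1)] ed(3) by metis
    then have "span {1} \<subseteq> E" using sE by (intro span_minimal) auto
    then have "span {1} = {0::'a}" using E(2,3) subcoalgebra_span_one by blast
    then show False using span_base[of "1::'a" "{1}"] by simp
  qed
qed

text \<open>h is 1 at the unit and 0 on all other simple subcoalgebras. By cosemisimplicity these
  span everything together with the unit, and invariance is checked on the two parts separately. A
  relation placing 1 in ?H would involve finitely many subcoalgebras only.\<close>

lemma haar_functional_exists:
  assumes "cosemisimple scale \<Delta>"
  shows "\<exists>h. lin (*) h \<and> h 1 = 1 \<and> (\<forall>x. sw x (\<lambda>p q. scale (h q) p) = scale (h x) 1)"
proof -
  define \<C> where "\<C> = {C. simple_subcoalgebra scale \<Delta> C \<and> C \<noteq> span {1}}"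
  let ?H = "span (\<Union>\<C>)"
  have cH: "costable ?H"
    by (intro costable_span_Union costable_subcoalgebra) (auto simp: \<C>_def simple_subcoalgebra_def)
  have "1 \<notin> ?H"
  proof
    assume "1 \<in> ?H"
    then obtain B r where B: "finite B" "B \<subseteq> \<Union>\<C>" "1 = (\<Sum>a\<in>B. scale (r a) a)"
      unfolding span_explicit[of "\<Union>\<C>"] by blast
    have "1 \<in> span B" unfolding B(3) by (intro span_sum span_scale span_base)
    obtain \<C>' where \<C>': "finite \<C>'" "\<C>' \<subseteq> \<C>" "B \<subseteq> \<Union>\<C>'"
      using finite_subset_Union[OF B(1,2)] by blast
    then have "1 \<in> span (\<Union>\<C>')" using \<open>1 \<in> span B\<close> span_mono by blast
    then show False using one_not_in_sum_simples[OF \<C>'(1)] \<C>'(2) by (auto simp: \<C>_def)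
  qed
  then obtain h where h: "lin_fun scale h" "h 1 = 1" "\<forall>v\<in>?H. h v = 0"
    using functional_separating[OF subspace_span] by blast
  have lh: "lin (*) h" using h(1) by (simp add: lin_fun_lin)
  let ?f = "\<lambda>x. sw x (\<lambda>p q. scale (h q) p)"
  have lf: "lin scale ?f" by (intro lin_intros lh)
  have "?f x = scale (h x) 1" for x
  proof -
    have "\<Union>{C. simple_subcoalgebra scale \<Delta> C} \<subseteq> span (insert 1 (\<Union>\<C>))"
    proof
      fix y assume "y \<in> \<Union>{C. simple_subcoalgebra scale \<Delta> C}"
      then obtain C where C: "simple_subcoalgebra scale \<Delta> C" "y \<in> C" by blast
      show "y \<in> span (insert 1 (\<Union>\<C>))"
      proof (cases "C = span {1}")
        case True
        then show ?thesis using C span_mono[of "{1}" "insert 1 (\<Union>\<C>)"] by auto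
      next
        case False
        then show ?thesis using C by (intro span_base) (auto simp: \<C>_def)
      qed
    qed
    then have "span (\<Union>{C. simple_subcoalgebra scale \<Delta> C}) \<subseteq> span (insert 1 (\<Union>\<C>))"
      by (simp add: span_minimal)
    then have "x \<in> span (insert 1 (\<Union>\<C>))" using assms unfolding cosemisimple_def by blast
    then obtain k where k: "x - scale k 1 \<in> ?H" using span_breakdown_eq by blast
    define y where "y = x - scale k 1"
    have y: "y \<in> ?H" "x = scale k 1 + y" using k by (simp_all add: y_def)
    have "?f y = sw y (\<lambda>p q. 0)"
      by (rule costable_sw_cong[OF cH y(1) vs_scale]) (auto intro!: lin_intros lh simp: h(3))
    also have "\<dots> = 0" by (simp add: sw_def case_prod_unfold)
    finally have fy: "?f y = 0" .
    have "?f 1 = scale (h 1) 1" by (rule sw_one[OF vs_scale]) (intro lin_intros lh)+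
    then have "?f x = scale k 1" using lin_addD[OF lf] lin_scaleD[OF lf] fy by (simp add: y(2) h(2))
    moreover have "h x = k" using lin_addD[OF lh] lin_scaleD[OF lh] h y by simp
    ultimately show ?thesis by simp
  qed
  then show ?thesis using lh h(2) by blast
qed

end

section \<open>Relative Hopf modules in coordinates\<close>

text \<open>In the application one index set consists of numbers and the other of pairs, so matrices
  indexed by initial segments are reached through enumerations of both.\<close>

lemma weakly_finite_index:
  fixes x :: "'i \<Rightarrow> 'j \<Rightarrow> 'a::ring_1"
  assumes wf: "weakly_finite TYPE('a)" and fin: "finite I" "finite J" "card I = card J"
    and xy: "\<And>i i'. i \<in> I \<Longrightarrow> i' \<in> I \<Longrightarrow> (\<Sum>j\<in>J. x i j * y j i') = (if i = i' then 1 else 0)"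
    and j: "j \<in> J" "j' \<in> J"
  shows "(\<Sum>i\<in>I. y j i * x i j') = (if j = j' then 1 else 0)"
proof -
  define n where "n = card I"
  obtain b where b: "bij_betw b {..<n} I"
    using ex_bij_betw_nat_finite[OF fin(1)] by (auto simp: n_def atLeast0LessThan)
  obtain c where c: "bij_betw c {..<n} J"
    using ex_bij_betw_nat_finite[OF fin(2)] fin(3) by (auto simp: n_def atLeast0LessThan)
  let ?x = "\<lambda>i j. x (b i) (c j)" and ?y = "\<lambda>j i. y (c j) (b i)"
  have "is_id_mat n (mat_mul n ?x ?y)"
    unfolding is_id_mat_def mat_mul_def
  proof (intro allI impI)
    fix i i' assume i: "i < n" "i' < n"
    have "(\<Sum>l<n. x (b i) (c l) * y (c l) (b i')) = (\<Sum>j\<in>J. x (b i) j * y j (b i'))"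
      by (rule sum.reindex_bij_betw[OF c])
    moreover have "b i \<in> I" "b i' \<in> I" using b i by (auto simp: bij_betw_def)
    moreover have "b i = b i' \<longleftrightarrow> i = i'" using b i by (auto simp: bij_betw_def inj_on_def)
    ultimately show "(\<Sum>l<n. x (b i) (c l) * y (c l) (b i')) = (if i = i' then 1 else 0)"
      using xy by simp
  qed
  then have "is_id_mat n (mat_mul n ?y ?x)" using wf unfolding weakly_finite_def by blast
  then have id: "(\<Sum>l<n. y (c i) (b l) * x (b l) (c i')) = (if i = i' then 1 else 0)" if "i < n" "i' < n" for i i'
    using that unfolding is_id_mat_def mat_mul_def by blast
  obtain i i' where i: "i < n" "i' < n" "j = c i" "j' = c i'" using c j by (auto simp: bij_betw_def)
  have "(\<Sum>l<n. y j (b l) * x (b l) j') = (\<Sum>i\<in>I. y j i * x i j')"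
    by (rule sum.reindex_bij_betw[OF b])
  moreover have "j = j' \<longleftrightarrow> i = i'" using c i by (auto simp: bij_betw_def inj_on_def)
  ultimately show ?thesis using id[OF i(1,2)] i by simp
qed

definition mact :: "'i set \<Rightarrow> ('i \<Rightarrow> 'i \<Rightarrow> 'a \<Rightarrow> 'k::field) \<Rightarrow> 'a \<Rightarrow> ('i \<Rightarrow> 'k) \<Rightarrow> 'i \<Rightarrow> 'k" where
  "mact I \<pi> a f = (\<lambda>i. if i \<in> I then \<Sum>j\<in>I. \<pi> i j a * f j else 0)"

definition (in hopf) coideal_subalg :: "'a set \<Rightarrow> bool" where
  "coideal_subalg A \<longleftrightarrow> costable A \<and> 1 \<in> A \<and> (\<forall>x\<in>A. \<forall>y\<in>A. x * y \<in> A) \<and> fd A"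

text \<open>Coordinates of a finite-dimensional relative Hopf module \<open>M\<close> with basis \<open>m\<close> indexed by \<open>I\<close>:
  \<open>\<pi>\<close> describes the right action, \<open>m\<^sub>i a = \<Sum>\<^sub>j \<pi> i j a m\<^sub>j\<close>, and \<open>u\<close> the coaction,
  \<open>m\<^sub>i \<mapsto> \<Sum>\<^sub>j u i j \<otimes> m\<^sub>j\<close>.  Column vectors form the dual left module.\<close>
locale hopf_rep = hopf scale \<Delta> \<epsilon> S
  for scale :: "'k::field \<Rightarrow> 'a::ring_1 \<Rightarrow> 'a" and \<Delta> \<epsilon> S +
  fixes A :: "'a set" and I :: "'i set" and \<pi> :: "'i \<Rightarrow> 'i \<Rightarrow> 'a \<Rightarrow> 'k" and u :: "'i \<Rightarrow> 'i \<Rightarrow> 'a"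
  assumes A: "coideal_subalg A" and finite_I: "finite I"
    and lin_\<pi>: "lin (*) (\<pi> i j)"
    and \<pi>_one: "i \<in> I \<Longrightarrow> j \<in> I \<Longrightarrow> \<pi> i j 1 = (if i = j then 1 else 0)"
    and \<pi>_mult: "a \<in> A \<Longrightarrow> b \<in> A \<Longrightarrow> i \<in> I \<Longrightarrow> j \<in> I \<Longrightarrow> \<pi> i j (a * b) = (\<Sum>l\<in>I. \<pi> i l a * \<pi> l j b)"
    and \<pi>_u: "a \<in> A \<Longrightarrow> i \<in> I \<Longrightarrow> l \<in> I \<Longrightarrow>
      (\<Sum>j\<in>I. scale (\<pi> i j a) (u j l)) = (\<Sum>j\<in>I. u i j * sw a (\<lambda>p q. scale (\<pi> j l q) p))"
    and u_T: "i \<in> I \<Longrightarrow> l \<in> I \<Longrightarrow> (\<Sum>j\<in>I. u j l * T (u i j)) = (if i = l then 1 else 0)"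
begin

lemma A_costable: "costable A" and A_one: "1 \<in> A" and A_mult: "x \<in> A \<Longrightarrow> y \<in> A \<Longrightarrow> x * y \<in> A"
    and A_fd: "fd A"
  using A by (auto simp: coideal_subalg_def)

lemma A_subspace: "subspace A"
  using A_costable by (rule costable_subspace)

lemma mact_supp: "mact I \<pi> a f \<in> supp_fun I"
  by (simp add: mact_def supp_fun_def)

lemma mact_add_left: "mact I \<pi> (a + b) f = mact I \<pi> a f + mact I \<pi> b f"
  by (auto simp: fun_eq_iff mact_def lin_addD[OF lin_\<pi>] distrib_right sum.distrib)

lemma mact_scale_left: "mact I \<pi> (scale c a) f = fscale c (mact I \<pi> a f)"
  by (auto simp: fun_eq_iff mact_def lin_scaleD[OF lin_\<pi>] sum_distrib_left mult.assoc)

lemma mact_zero_left: "mact I \<pi> 0 f = 0"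
  by (auto simp: fun_eq_iff mact_def lin_zeroD[OF lin_\<pi>])

lemma mact_sum_left: "mact I \<pi> (\<Sum>x\<in>X. a x) f = (\<Sum>x\<in>X. mact I \<pi> (a x) f)"
  by (induction X rule: infinite_finite_induct) (auto simp: mact_zero_left mact_add_left)

lemma mact_diff_left: "mact I \<pi> (a - b) f = mact I \<pi> a f - mact I \<pi> b f"
  using mact_add_left[of "a - b" b f] by (simp add: eq_diff_eq)

end

sublocale hopf_rep \<subseteq> m: alg_module fscale scale A "mact I \<pi>" "supp_fun I"
proof
  show "1 \<in> A" by (rule A_one)
  show "a * b \<in> A" if "a \<in> A" "b \<in> A" for a b using that by (rule A_mult)
  show "a + b \<in> A" if "a \<in> A" "b \<in> A" for a b using that A_subspace by (simp add: subspace_add)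
  show "scale c a \<in> A" if "a \<in> A" for a c using that A_subspace by (simp add: subspace_scale)
  show "mact I \<pi> a (x + y) = mact I \<pi> a x + mact I \<pi> a y" for a x y
    by (auto simp: fun_eq_iff mact_def distrib_left sum.distrib)
  show "mact I \<pi> a (fscale c x) = fscale c (mact I \<pi> a x)" for a c x
    by (auto simp: fun_eq_iff mact_def sum_distrib_left mult.left_commute)
  show "mact I \<pi> (a + b) y = mact I \<pi> a y + mact I \<pi> b y" for a b y by (rule mact_add_left)
  show "mact I \<pi> (scale c a) y = fscale c (mact I \<pi> a y)" for a c y by (rule mact_scale_left)
  show "mact I \<pi> 1 y = y" if "y \<in> supp_fun I" for y
  proof
    fix i
    show "mact I \<pi> 1 y i = y i"
    proof (cases "i \<in> I")
      case True
      then have "(\<Sum>j\<in>I. \<pi> i j 1 * y j) = (\<Sum>j\<in>I. if i = j then y j else 0)"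
        by (intro sum.cong) (auto simp: \<pi>_one)
      then show ?thesis using True finite_I by (simp add: mact_def)
    next
      case False
      then show ?thesis using that by (simp add: mact_def supp_fun_def)
    qed
  qed
  show "mact I \<pi> (a * b) y = mact I \<pi> a (mact I \<pi> b y)" if "a \<in> A" "b \<in> A" for a b y
  proof
    fix i
    have "(\<Sum>j\<in>I. \<pi> i j (a * b) * y j) = (\<Sum>j\<in>I. \<pi> i j a * (\<Sum>l\<in>I. \<pi> j l b * y l))" if i: "i \<in> I"
    proof -
      have "(\<Sum>j\<in>I. \<pi> i j (a * b) * y j) = (\<Sum>j\<in>I. \<Sum>l\<in>I. \<pi> i l a * (\<pi> l j b * y j))"
        using i \<open>a \<in> A\<close> \<open>b \<in> A\<close> by (intro sum.cong) (auto simp: \<pi>_mult sum_distrib_right mult.assoc)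
      also have "\<dots> = (\<Sum>l\<in>I. \<Sum>j\<in>I. \<pi> i l a * (\<pi> l j b * y j))" by (rule sum.swap)
      finally show ?thesis by (simp add: sum_distrib_left)
    qed
    then show "mact I \<pi> (a * b) y i = mact I \<pi> a (mact I \<pi> b y) i"
      by (simp add: mact_def cong: sum.cong)
  qed
  show "mact I \<pi> a y \<in> supp_fun I" for a y by (rule mact_supp)
  show "fv.subspace (supp_fun I)" by (rule subspace_supp_fun)
  show "fv.fd (supp_fun I)" using finite_I by (rule fd_supp_fun)
qed

context hopf_rep
begin

abbreviation act :: "'a \<Rightarrow> ('i \<Rightarrow> 'k) \<Rightarrow> 'i \<Rightarrow> 'k" where
  "act \<equiv> mact I \<pi>"

abbreviation Y :: "('i \<Rightarrow> 'k) set" where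
  "Y \<equiv> supp_fun I"

text \<open>For the matrix coefficients of a representation, these are the entries of its base
  change: a goes to the matrix with entries a1 \<theta>(a2) over the Hopf algebra.\<close>

definition twisted :: "('a \<Rightarrow> 'k) \<Rightarrow> 'a \<Rightarrow> 'a" where
  "twisted \<theta> a = sw a (\<lambda>p q. scale (\<theta> q) p)"

lemma lin_fun_add: "lin_fun fscale g \<Longrightarrow> g (x + y) = g x + g y"
  and lin_fun_scale: "lin_fun fscale g \<Longrightarrow> g (fscale c x) = c * g x"
  by (auto simp: fv.lin_fun_iff)

lemma lin_fun_zero: "lin_fun fscale g \<Longrightarrow> g 0 = 0"
  using lin_fun_scale[of g 0 0] by simp

lemma lin_fun_sum: "lin_fun fscale g \<Longrightarrow> g (\<Sum>x\<in>X. f x) = (\<Sum>x\<in>X. g (f x))"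
  by (induction X rule: infinite_finite_induct) (auto simp: lin_fun_zero lin_fun_add)

text \<open>Seen in M, the dual of \<open>Y\<close>: elements without a common annihilated vector
  generate M. The combinations on the left form a space of functionals that separates
  \<open>Y\<close>, hence the whole dual.\<close>

lemma cogenerators_span_dual:
  fixes r :: nat
  assumes g: "\<And>k. k < r \<Longrightarrow> lin_fun fscale (g k)"
    and cogen: "\<And>y. y \<in> Y \<Longrightarrow> (\<And>k a. k < r \<Longrightarrow> a \<in> A \<Longrightarrow> g k (act a y) = 0) \<Longrightarrow> y = 0"
    and \<alpha>: "lin_fun fscale \<alpha>"
  shows "\<exists>b. (\<forall>k<r. b k \<in> A) \<and> (\<forall>y\<in>Y. (\<Sum>k<r. g k (act (b k) y)) = \<alpha> y)"
proof -
  let ?\<Phi> = "\<lambda>b y. \<Sum>k<r. g k (act (b k) y)"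
  define F where "F = {?\<Phi> b |b. \<forall>k<r. b k \<in> A}"
  have A0: "0 \<in> A" using A_subspace by (rule subspace_0)
  have FI: "f \<in> F" if "f = ?\<Phi> b" "\<And>k. k < r \<Longrightarrow> b k \<in> A" for b f
    using that unfolding F_def by blast
  have "\<exists>f\<in>F. \<forall>v\<in>Y. f v = \<alpha> v"
  proof (rule fv.functionals_onto_dual[OF fd_supp_fun[OF finite_I] subspace_supp_fun _ _ _ _ _ \<alpha>])
    show "lin_fun fscale f" if f: "f \<in> F" for f
    proof -
      obtain b where "f = ?\<Phi> b" using f unfolding F_def by blast
      then show ?thesis
        unfolding fv.lin_fun_iff
        using lin_fun_add[OF g] lin_fun_scale[OF g]
        by (simp add: m.act_add m.act_scale sum.distrib sum_distrib_left)
    qed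
    show "(\<lambda>_. 0) \<in> F"
      by (rule FI[of _ "\<lambda>_. 0"]) (auto simp: fun_eq_iff mact_zero_left lin_fun_zero[OF g] A0)
    show "(\<lambda>x. f1 x + f2 x) \<in> F" if f: "f1 \<in> F" "f2 \<in> F" for f1 f2
    proof -
      obtain b1 b2 where b: "f1 = ?\<Phi> b1" "f2 = ?\<Phi> b2" "\<forall>k<r. b1 k \<in> A" "\<forall>k<r. b2 k \<in> A"
        using f unfolding F_def by blast
      have "(\<lambda>x. f1 x + f2 x) = ?\<Phi> (\<lambda>k. b1 k + b2 k)"
        unfolding b(1,2) using lin_fun_add[OF g] by (simp add: fun_eq_iff mact_add_left sum.distrib)
      then show ?thesis by (rule FI) (use b A_subspace subspace_add in blast)
    qed
    show "(\<lambda>x. c * f x) \<in> F" if f: "f \<in> F" for c f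
    proof -
      obtain b where b: "f = ?\<Phi> b" "\<forall>k<r. b k \<in> A" using f unfolding F_def by blast
      have "(\<lambda>x. c * f x) = ?\<Phi> (\<lambda>k. scale c (b k))"
        unfolding b(1) using lin_fun_scale[OF g] by (simp add: fun_eq_iff mact_scale_left sum_distrib_left)
      then show ?thesis by (rule FI) (use b A_subspace subspace_scale in blast)
    qed
    show "v = 0" if v: "v \<in> Y" "\<And>f. f \<in> F \<Longrightarrow> f v = 0" for v
    proof (rule cogen[OF v(1)])
      fix k a assume ka: "k < r" "a \<in> A"
      let ?b = "\<lambda>k'. if k' = k then a else 0"
      have "?\<Phi> ?b \<in> F" by (rule FI[OF refl]) (use ka A0 in auto)
      then have "?\<Phi> ?b v = 0" by (rule v(2))
      moreover have "?\<Phi> ?b v = (\<Sum>k'<r. if k' = k then g k (act a v) else 0)"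
        using lin_fun_zero[OF g] by (intro sum.cong) (auto simp: mact_zero_left)
      ultimately show "g k (act a v) = 0" using ka by simp
    qed
  qed
  then show ?thesis unfolding F_def by auto
qed

text \<open>Put V = A w and let H be the Hopf algebra. A vector dominated by w is a homomorphism
  from V to \<open>Y\<close>; the coaction followed by pairing with it is an A-linear map from M to
  rows of length d over H, where A acts through \<open>twisted\<close>. Applying q independent maps
  of this kind to the r generators gives a matrix Q over H with q rows and r * d columns. It is
  square by \<open>dimeq\<close> and has a right inverse Z, so weak finiteness makes it invertible.
  A relation among the generators, after twisting, is a column killed by Q.\<close>

lemma relations_twisted_zero:
  assumes wf: "weakly_finite TYPE('a)"
    and w: "w \<in> Y" and d: "d = fv.dim (m.orb w)"
    and dimeq: "fv.dim (m.dominated w) = r * d"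
    and g: "\<And>k. k < r \<Longrightarrow> lin_fun fscale (g k)"
    and cogen: "\<And>y. y \<in> Y \<Longrightarrow> (\<And>k a. k < r \<Longrightarrow> a \<in> A \<Longrightarrow> g k (act a y) = 0) \<Longrightarrow> y = 0"
    and c: "\<And>e. e < d \<Longrightarrow> c e \<in> A" "fv.span ((\<lambda>e. act (c e) w) ` {..<d}) = m.orb w"
      "inj_on (\<lambda>e. act (c e) w) {..<d}"
    and \<theta>: "\<And>f e. lin (*) (\<theta> f e)"
      "\<And>a e. a \<in> A \<Longrightarrow> e < d \<Longrightarrow> act a (act (c e) w) = (\<Sum>f<d. fscale (\<theta> f e a) (act (c f) w))"
    and a: "\<And>k. k < r \<Longrightarrow> a k \<in> A" "\<And>y. y \<in> Y \<Longrightarrow> (\<Sum>k<r. g k (act (a k) y)) = 0"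
    and kfe: "k0 < r" "f0 < d" "e0 < d"
  shows "twisted (\<theta> f0 e0) (a k0) = 0"
proof -
  define q where "q = r * d"
  have dom: "z \<in> Y" "\<And>a. a \<in> A \<Longrightarrow> act a w = 0 \<Longrightarrow> act a z = 0" if "z \<in> m.dominated w" for z
    using that by (auto simp: m.dominated_def)
  \<comment> \<open>The identity holds at w by \<theta>, which says that ?b annihilates w;
    everything dominated by w is then annihilated too. \<open>lam_dom\<close> transfers the
    expansion of w in the same way.\<close>
  have act_c: "act x (act (c e) z) = (\<Sum>f<d. fscale (\<theta> f e x) (act (c f) z))"
    if z: "z \<in> m.dominated w" and x: "x \<in> A" and e: "e < d" for x e z
  proof -
    let ?b = "x * c e - (\<Sum>f<d. scale (\<theta> f e x) (c f))"
    have bA: "?b \<in> A"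
      using x e c(1) A_subspace by (intro subspace_diff subspace_sum subspace_scale A_mult) auto
    have eq: "act ?b v = act x (act (c e) v) - (\<Sum>f<d. fscale (\<theta> f e x) (act (c f) v))" if "v \<in> Y" for v
      using x c(1)[OF e] that by (simp add: mact_diff_left mact_sum_left mact_scale_left m.mult_act)
    have "act ?b w = 0" using eq[OF w] \<theta>(2)[OF x e] by simp
    then have "act ?b z = 0" using dom(2)[OF z bA] by blast
    then show ?thesis using eq[OF dom(1)[OF z]] by simp
  qed
  \<comment> \<open>w need not occur among the basis vectors c e w of its own orbit; lam contains
    its coordinates.\<close>
  obtain lam where lam: "w = (\<Sum>e<d. fscale (lam e) (act (c e) w))"
  proof -
    have "w \<in> fv.span ((\<lambda>e. act (c e) w) ` {..<d})" using c(2) m.self_in_orb[OF w] by simp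
    then obtain v where "w = (\<Sum>x\<in>(\<lambda>e. act (c e) w) ` {..<d}. fscale (v x) x)"
      using fv.span_finite_sum[of "(\<lambda>e. act (c e) w) ` {..<d}" w] by blast
    then have "w = (\<Sum>e<d. fscale (v (act (c e) w)) (act (c e) w))"
      by (simp add: sum.reindex[OF c(3)])
    then show thesis using that[of "\<lambda>e. v (act (c e) w)"] by blast
  qed
  have lam_dom: "z = (\<Sum>e<d. fscale (lam e) (act (c e) z))" if z: "z \<in> m.dominated w" for z
  proof -
    let ?b = "1 - (\<Sum>e<d. scale (lam e) (c e))"
    have bA: "?b \<in> A"
      using c(1) A_subspace A_one by (intro subspace_diff subspace_sum subspace_scale) auto
    have eq: "act ?b v = v - (\<Sum>e<d. fscale (lam e) (act (c e) v))" if "v \<in> Y" for v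
      using that by (simp add: mact_diff_left mact_sum_left mact_scale_left m.one_act)
    have "act ?b w = 0" using eq[OF w] lam by simp
    then have "act ?b z = 0" using dom(2)[OF z bA] by blast
    then show ?thesis using eq[OF dom(1)[OF z]] by simp
  qed
  obtain B where B: "finite B" "fv.independent B" "B \<subseteq> m.dominated w" "card B = q"
    using fv.fd_basis[OF m.fd_dominated m.subspace_dominated, of w] dimeq unfolding q_def by auto
  obtain yp where yp: "bij_betw yp {..<q} B"
    using B ex_bij_betw_nat_finite[of B] by (auto simp: atLeast0LessThan)
  have ypd: "yp p \<in> m.dominated w" if "p < q" for p using yp B(3) that by (auto simp: bij_betw_def)
  have "\<exists>t. lin_fun fscale t \<and> (\<forall>p<q. t (yp p) = (if p = p' then 1 else 0))" if p': "p' < q" for p'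
  proof -
    obtain t where t: "lin_fun fscale t" "\<forall>b\<in>B. t b = (if b = yp p' then 1 else 0)"
      using fv.functional_extend[OF B(2), of "\<lambda>b. if b = yp p' then 1 else 0"] by blast
    have "t (yp p) = (if p = p' then 1 else 0)" if p: "p < q" for p
    proof -
      have "yp p \<in> B" using yp p by (auto simp: bij_betw_def)
      moreover have "yp p = yp p' \<longleftrightarrow> p = p'" using yp p p' by (auto simp: bij_betw_def inj_on_def)
      ultimately show ?thesis using t(2) by simp
    qed
    then show ?thesis using t(1) by blast
  qed
  then obtain t where t: "\<And>p'. p' < q \<Longrightarrow> lin_fun fscale (t p') \<and> (\<forall>p<q. t p' (yp p) = (if p = p' then 1 else 0))"
    by metis
  \<comment> \<open>The basis vector m_j of M, which is the j-th coordinate functional on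
    \<open>Y\<close>, written in the generators.\<close>
  have "\<exists>b. (\<forall>k<r. b k \<in> A) \<and> (\<forall>y\<in>Y. (\<Sum>k<r. g k (act (b k) y)) = y j)" for j
    by (rule cogenerators_span_dual[OF g cogen]) (auto simp: fv.lin_fun_iff)
  then obtain b where b: "\<And>j k. k < r \<Longrightarrow> b j k \<in> A"
      "\<And>j y. y \<in> Y \<Longrightarrow> (\<Sum>k<r. g k (act (b j k) y)) = y j" by metis
  \<comment> \<open>The entry at e of the image of m_j under the map attached to yp p: the coaction
    of m_j, paired with c e yp p.\<close>
  define X where "X p j e = (\<Sum>l\<in>I. scale (act (c e) (yp p) l) (u j l))" for p j e
  let ?G = "\<lambda>k l. g k (unit_fun l)"
  \<comment> \<open>A-linearity of this map: the compatibility of action and coaction turns \<pi>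
    into the twisted action on rows.\<close>
  have X_act: "(\<Sum>j\<in>I. scale (\<pi> i j x) (X p j e)) = (\<Sum>f<d. X p i f * twisted (\<theta> f e) x)"
    if x: "x \<in> A" and i: "i \<in> I" and e: "e < d" and p: "p < q" for x i e p
  proof -
    let ?F = "\<lambda>l e. act (c e) (yp p) l"
    have "(\<Sum>j\<in>I. scale (\<pi> i j x) (X p j e)) = (\<Sum>j\<in>I. \<Sum>l\<in>I. scale (?F l e) (scale (\<pi> i j x) (u j l)))"
      unfolding X_def by (simp add: scale_sum_right mult.commute)
    also have "\<dots> = (\<Sum>l\<in>I. scale (?F l e) (\<Sum>j\<in>I. scale (\<pi> i j x) (u j l)))"
      by (subst sum.swap) (simp add: scale_sum_right)
    also have "\<dots> = (\<Sum>l\<in>I. scale (?F l e) (\<Sum>j\<in>I. u i j * sw x (\<lambda>p q. scale (\<pi> j l q) p)))"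
      using x i by (intro sum.cong) (auto simp: \<pi>_u)
    also have "\<dots> = (\<Sum>j\<in>I. u i j * (\<Sum>l\<in>I. scale (?F l e) (sw x (\<lambda>p q. scale (\<pi> j l q) p))))"
      by (simp add: scale_sum_right sum_distrib_left scale_mult_right) (rule sum.swap)
    also have "\<dots> = (\<Sum>j\<in>I. u i j * (\<Sum>f<d. scale (?F j f) (twisted (\<theta> f e) x)))"
    proof (intro sum.cong refl arg_cong2[where f = "(*)"])
      fix j assume j: "j \<in> I"
      have "(\<Sum>l\<in>I. scale (?F l e) (sw x (\<lambda>p q. scale (\<pi> j l q) p))) =
          sw x (\<lambda>p q. scale (\<Sum>l\<in>I. \<pi> j l q * ?F l e) p)"
        by (simp add: sw_sum scale_sum_left sw_scaled[OF vs_scale, symmetric] mult.commute)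
      also have "\<dots> = sw x (\<lambda>p q. scale (\<Sum>f<d. \<theta> f e q * ?F j f) p)"
      proof (rule costable_sw_cong[OF A_costable x vs_scale])
        fix p' q' assume "q' \<in> A"
        then have "act q' (act (c e) (yp p)) j = (\<Sum>f<d. fscale (\<theta> f e q') (act (c f) (yp p))) j"
          using act_c[OF ypd[OF p] _ e] by simp
        then have "(\<Sum>l\<in>I. \<pi> j l q' * ?F l e) = (\<Sum>f<d. \<theta> f e q' * ?F j f)"
          using j by (simp add: mact_def[of I \<pi> q'] sum_fun_apply)
        then show "scale (\<Sum>l\<in>I. \<pi> j l q' * ?F l e) p' = scale (\<Sum>f<d. \<theta> f e q' * ?F j f) p'" by simp
      qed (intro lin_intros lin_\<pi> \<theta>(1))+
      also have "\<dots> = (\<Sum>f<d. scale (?F j f) (twisted (\<theta> f e) x))"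
        unfolding twisted_def
        by (simp add: sw_sum scale_sum_left sw_scaled[OF vs_scale, symmetric] mult.commute)
      finally show "(\<Sum>l\<in>I. scale (?F l e) (sw x (\<lambda>p q. scale (\<pi> j l q) p))) =
          (\<Sum>f<d. scale (?F j f) (twisted (\<theta> f e) x))" .
    qed
    also have "\<dots> = (\<Sum>f<d. X p i f * twisted (\<theta> f e) x)"
      unfolding X_def
      by (simp add: sum_distrib_left sum_distrib_right scale_mult_left scale_mult_right) (rule sum.swap)
    finally show ?thesis .
  qed
  define Q where "Q p z = (\<Sum>j\<in>I. scale (?G (fst z) j) (X p j (snd z)))" for p z
  have Q_twisted: "(\<Sum>k<r. \<Sum>f<d. Q p (k, f) * twisted (\<theta> f e) (x k)) =
      (\<Sum>l\<in>I. scale (\<Sum>k<r. g k (act (x k) (unit_fun l))) (X p l e))"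
    if x: "\<And>k. k < r \<Longrightarrow> x k \<in> A" and e: "e < d" and p: "p < q" for x e p
  proof -
    have "(\<Sum>f<d. Q p (k, f) * twisted (\<theta> f e) (x k)) = (\<Sum>l\<in>I. scale (g k (act (x k) (unit_fun l))) (X p l e))"
      if k: "k < r" for k
    proof -
      have "(\<Sum>f<d. Q p (k, f) * twisted (\<theta> f e) (x k)) =
          (\<Sum>j\<in>I. scale (?G k j) (\<Sum>f<d. X p j f * twisted (\<theta> f e) (x k)))"
        unfolding Q_def
        by (simp add: sum_distrib_right scale_sum_right scale_mult_left) (rule sum.swap)
      also have "\<dots> = (\<Sum>j\<in>I. scale (?G k j) (\<Sum>l\<in>I. scale (\<pi> j l (x k)) (X p l e)))"
        using x[OF k] e p by (intro sum.cong) (auto simp: X_act)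
      also have "\<dots> = (\<Sum>l\<in>I. scale (\<Sum>j\<in>I. ?G k j * \<pi> j l (x k)) (X p l e))"
        by (simp add: scale_sum_right scale_sum_left) (rule sum.swap)
      also have "\<dots> = (\<Sum>l\<in>I. scale (g k (act (x k) (unit_fun l))) (X p l e))"
      proof (intro sum.cong refl arg_cong2[where f = scale])
        fix l assume l: "l \<in> I"
        have "g k (act (x k) (unit_fun l)) = (\<Sum>j\<in>I. ?G k j * act (x k) (unit_fun l) j)"
          by (rule lin_fun_supp_expand[OF finite_I mact_supp g[OF k]])
        also have "\<dots> = (\<Sum>j\<in>I. ?G k j * \<pi> j l (x k))"
          using l finite_I
          by (intro sum.cong) (auto simp: mact_def unit_fun_apply if_distrib cong: if_cong)
        finally show "(\<Sum>j\<in>I. ?G k j * \<pi> j l (x k)) = g k (act (x k) (unit_fun l))" by simp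
      qed
      finally show ?thesis .
    qed
    then have "(\<Sum>k<r. \<Sum>f<d. Q p (k, f) * twisted (\<theta> f e) (x k)) =
        (\<Sum>k<r. \<Sum>l\<in>I. scale (g k (act (x k) (unit_fun l))) (X p l e))" by simp
    also have "\<dots> = (\<Sum>l\<in>I. scale (\<Sum>k<r. g k (act (x k) (unit_fun l))) (X p l e))"
      by (subst sum.swap) (simp add: scale_sum_left)
    finally show ?thesis .
  qed
  have Q_b: "(\<Sum>k<r. \<Sum>f<d. Q p (k, f) * twisted (\<theta> f e) (b j k)) = X p j e"
    if "j \<in> I" "e < d" "p < q" for j e p
  proof -
    have "(\<Sum>k<r. \<Sum>f<d. Q p (k, f) * twisted (\<theta> f e) (b j k)) =
        (\<Sum>l\<in>I. scale (\<Sum>k<r. g k (act (b j k) (unit_fun l))) (X p l e))"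
      by (rule Q_twisted) (use b that in auto)
    also have "\<dots> = (\<Sum>l\<in>I. if l = j then X p j e else 0)"
      by (intro sum.cong) (auto simp: b(2)[OF unit_fun_in_supp] unit_fun_apply)
    finally show ?thesis using that finite_I by simp
  qed
  \<comment> \<open>Three inversions in one formula: b expresses each m_j by the generators, T (u l
    j) undoes the coaction, and lam with the dual functional t p' extracts the coefficient of yp
    p'.\<close>
  define Z where "Z z p' = (\<Sum>e<d. \<Sum>j\<in>I. \<Sum>l\<in>I.
      twisted (\<theta> (snd z) e) (b j (fst z)) * scale (lam e * t p' (unit_fun l)) (T (u l j)))" for z p'
  have QZ: "(\<Sum>z\<in>{..<r}\<times>{..<d}. Q p z * Z z p') = (if p = p' then 1 else 0)" if pp: "p < q" "p' < q" for p p'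
  proof -
    have "(\<Sum>z\<in>{..<r}\<times>{..<d}. Q p z * Z z p') = (\<Sum>k<r. \<Sum>f<d. Q p (k, f) * Z (k, f) p')"
      by (simp add: sum.cartesian_product)
    also have "\<dots> = (\<Sum>k<r. \<Sum>f<d. \<Sum>e<d. \<Sum>j\<in>I. \<Sum>l\<in>I.
        Q p (k, f) * twisted (\<theta> f e) (b j k) * scale (lam e * t p' (unit_fun l)) (T (u l j)))"
      unfolding Z_def by (simp add: sum_distrib_left mult.assoc)
    also have "\<dots> = (\<Sum>e<d. \<Sum>j\<in>I. \<Sum>l\<in>I. \<Sum>k<r. \<Sum>f<d.
        Q p (k, f) * twisted (\<theta> f e) (b j k) * scale (lam e * t p' (unit_fun l)) (T (u l j)))"
      by (subst (2) sum.swap, subst (1) sum.swap, subst (3) sum.swap, subst (2) sum.swap,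
          subst (4) sum.swap, subst (3) sum.swap) (rule refl)
    also have "\<dots> = (\<Sum>e<d. \<Sum>j\<in>I. \<Sum>l\<in>I. X p j e * scale (lam e * t p' (unit_fun l)) (T (u l j)))"
      using pp by (intro sum.cong refl) (simp add: Q_b flip: sum_distrib_right)
    also have "\<dots> = (\<Sum>e<d. \<Sum>l\<in>I. scale (lam e * t p' (unit_fun l)) (\<Sum>j\<in>I. X p j e * T (u l j)))"
      by (rule sum.cong[OF refl], subst sum.swap) (simp add: scale_mult_right scale_sum_right)
    also have "\<dots> = (\<Sum>e<d. \<Sum>l\<in>I. scale (lam e * t p' (unit_fun l)) (scale (act (c e) (yp p) l) 1))"
    proof (intro sum.cong refl arg_cong2[where f = scale])
      fix e l assume l: "l \<in> I"
      have "(\<Sum>j\<in>I. X p j e * T (u l j)) = (\<Sum>i\<in>I. scale (act (c e) (yp p) i) (\<Sum>j\<in>I. u j i * T (u l j)))"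
        unfolding X_def by (simp add: sum_distrib_right scale_sum_right scale_mult_left) (rule sum.swap)
      also have "\<dots> = (\<Sum>i\<in>I. if i = l then scale (act (c e) (yp p) l) 1 else 0)"
        using l by (intro sum.cong) (auto simp: u_T)
      finally show "(\<Sum>j\<in>I. X p j e * T (u l j)) = scale (act (c e) (yp p) l) 1"
        using l finite_I by simp
    qed
    also have "\<dots> = scale (\<Sum>e<d. lam e * (\<Sum>l\<in>I. t p' (unit_fun l) * act (c e) (yp p) l)) 1"
      by (simp add: scale_sum_left sum_distrib_left mult.assoc)
    also have "(\<Sum>e<d. lam e * (\<Sum>l\<in>I. t p' (unit_fun l) * act (c e) (yp p) l)) = t p' (yp p)"
    proof -
      have lt: "lin_fun fscale (t p')" using t pp by blast
      have "t p' (yp p) = t p' (\<Sum>e<d. fscale (lam e) (act (c e) (yp p)))"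
        using lam_dom[OF ypd[OF pp(1)]] by simp
      also have "\<dots> = (\<Sum>e<d. lam e * t p' (act (c e) (yp p)))"
        by (simp add: lin_fun_sum[OF lt] lin_fun_scale[OF lt])
      also have "\<dots> = (\<Sum>e<d. lam e * (\<Sum>l\<in>I. t p' (unit_fun l) * act (c e) (yp p) l))"
        using lin_fun_supp_expand[OF finite_I mact_supp lt] by simp
      finally show ?thesis by simp
    qed
    finally show ?thesis using t pp by simp
  qed
  \<comment> \<open>Weak finiteness is used here, and q = r * d makes the two index sets equally
    large.\<close>
  have ZQ: "(\<Sum>p<q. Z z p * Q p z') = (if z = z' then 1 else 0)"
    if "z \<in> {..<r} \<times> {..<d}" "z' \<in> {..<r} \<times> {..<d}" for z z'
    by (rule weakly_finite_index[OF wf, where J = "{..<r} \<times> {..<d}"]) (use QZ that in \<open>auto simp: q_def\<close>)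
  \<comment> \<open>By linearity the row p of Q sends the twisted coefficients of a to the image of
    the sum of the g k a k, which is the zero element of M.\<close>
  have zero: "(\<Sum>z\<in>{..<r}\<times>{..<d}. Q p z * twisted (\<theta> (snd z) e0) (a (fst z))) = 0" if p: "p < q" for p
  proof -
    have "(\<Sum>z\<in>{..<r}\<times>{..<d}. Q p z * twisted (\<theta> (snd z) e0) (a (fst z))) =
        (\<Sum>k<r. \<Sum>f<d. Q p (k, f) * twisted (\<theta> f e0) (a k))"
      by (simp add: sum.cartesian_product case_prod_unfold)
    also have "\<dots> = (\<Sum>l\<in>I. scale (\<Sum>k<r. g k (act (a k) (unit_fun l))) (X p l e0))"
      by (rule Q_twisted) (use a kfe p in auto)
    also have "\<dots> = 0" by (intro sum.neutral) (auto simp: a(2)[OF unit_fun_in_supp])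
    finally show ?thesis .
  qed
  let ?ZZ = "{..<r} \<times> {..<d}"
  have in0: "(k0, f0) \<in> ?ZZ" using kfe by simp
  have "twisted (\<theta> f0 e0) (a k0) = (\<Sum>z\<in>?ZZ. (if (k0, f0) = z then 1 else 0) * twisted (\<theta> (snd z) e0) (a (fst z)))"
    using in0 by (simp add: if_distrib[where f = "\<lambda>x. x * _"] cong: if_cong)
  also have "\<dots> = (\<Sum>z\<in>?ZZ. (\<Sum>p<q. Z (k0, f0) p * Q p z) * twisted (\<theta> (snd z) e0) (a (fst z)))"
    using ZQ[OF in0] by (intro sum.cong) auto
  also have "\<dots> = (\<Sum>p<q. Z (k0, f0) p * (\<Sum>z\<in>?ZZ. Q p z * twisted (\<theta> (snd z) e0) (a (fst z))))"
    by (simp add: sum_distrib_left sum_distrib_right mult.assoc) (rule sum.swap)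
  also have "\<dots> = 0" using zero by simp
  finally show ?thesis .
qed

end

definition (in hopf) costable_ideal :: "'a set \<Rightarrow> 'a set \<Rightarrow> bool" where
  "costable_ideal A J \<longleftrightarrow> costable J \<and> J \<subseteq> A \<and> (\<forall>a\<in>A. \<forall>x\<in>J. a * x \<in> J \<and> x * a \<in> J)"

context hopf_rep
begin

lemma lin_act_functional:
  assumes "lin_fun fscale \<chi>"
  shows "lin (*) (\<lambda>a. \<chi> (act a y))"
  unfolding lin_def
  by (simp add: mact_add_left mact_scale_left lin_fun_add[OF assms] lin_fun_scale[OF assms])

lemma lin_twisted: "lin (*) \<theta> \<Longrightarrow> lin scale (twisted \<theta>)"
  unfolding twisted_def by (intro lin_intros)

text \<open>By coassociativity, slicing the first leg commutes with twisting, so the kernel of a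
  twisted functional is stable under slices.\<close>

lemma twisted_costable:
  assumes \<theta>: "lin (*) \<theta>" and \<mu>: "lin (*) \<mu>" and x: "twisted \<theta> x = 0"
  shows "twisted \<theta> (sw x (\<lambda>p q. scale (\<mu> p) q)) = 0"
proof -
  let ?G = "\<lambda>z. sw z (\<lambda>p q. scale (\<mu> p) q)"
  have \<theta>': "lin (*) (\<lambda>x. \<theta> (f x))" if "lin scale f" for f using lin_comp[OF \<theta> that] .
  have \<mu>': "lin (*) (\<lambda>x. \<mu> (f x))" if "lin scale f" for f using lin_comp[OF \<mu> that] .
  note I = lin_intros \<theta>' \<mu>'
  have lG: "lin scale ?G" by (intro I)
  have "twisted \<theta> (?G x) = sw x (\<lambda>p q. scale (\<mu> p) (twisted \<theta> q))"
    by (simp add: sw_lin[OF lin_twisted[OF \<theta>]] lin_scaleD[OF lin_twisted[OF \<theta>]])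
  also have "\<dots> = sw x (\<lambda>p q. sw q (\<lambda>r t. scale (\<mu> p) (scale (\<theta> t) r)))"
    unfolding twisted_def by (simp only: sw_scaled[OF vs_scale])
  also have "\<dots> = sw x (\<lambda>p q. sw p (\<lambda>p1 p2. scale (\<mu> p1) (scale (\<theta> q) p2)))"
    by (rule sw_coassoc[OF vs_scale, symmetric]) (intro I)+
  also have "\<dots> = sw x (\<lambda>p q. scale (\<theta> q) (?G p))"
    by (simp add: sw_scaled[OF vs_scale, symmetric] mult.commute)
  also have "\<dots> = ?G (twisted \<theta> x)"
    unfolding twisted_def by (simp add: sw_lin[OF lG] lin_scaleD[OF lG])
  finally show ?thesis using x lin_zeroD[OF lG] by simp
qed

lemma eps_twisted: "lin (*) \<theta> \<Longrightarrow> \<epsilon> (twisted \<theta> x) = \<theta> x"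
  unfolding twisted_def
  using counit_left[of "(*)" \<theta> x] by (simp add: sw_lin[OF lin_eps_id] eps_scale mult.commute)

lemma twisted_mult:
  assumes \<theta>: "\<And>f e. lin (*) (\<theta> f e)"
    and mult: "\<And>x y. x \<in> A \<Longrightarrow> y \<in> A \<Longrightarrow> \<theta> f e (x * y) = (\<Sum>l<d. \<theta> f l x * \<theta> l e y)"
    and ab: "a \<in> A" "b \<in> A"
  shows "twisted (\<theta> f e) (a * b) = (\<Sum>l<d. twisted (\<theta> f l) a * twisted (\<theta> l e) b)"
proof -
  have \<theta>': "lin (*) (\<lambda>x. \<theta> f e (h x))" if "lin scale h" for f e h using lin_comp[OF \<theta> that] .
  note I = lin_intros \<theta>'
  have "twisted (\<theta> f e) (a * b) = sw a (\<lambda>p q. sw b (\<lambda>r t. scale (\<theta> f e (q * t)) (p * r)))"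
    unfolding twisted_def by (rule sw_mult[OF vs_scale]) (intro I)+
  also have "\<dots> = sw a (\<lambda>p q. sw b (\<lambda>r t. scale (\<Sum>l<d. \<theta> f l q * \<theta> l e t) (p * r)))"
  proof (rule costable_sw_cong[OF A_costable ab(1) vs_scale])
    fix p q assume "q \<in> A"
    then show "sw b (\<lambda>r t. scale (\<theta> f e (q * t)) (p * r)) =
        sw b (\<lambda>r t. scale (\<Sum>l<d. \<theta> f l q * \<theta> l e t) (p * r))"
      by (intro costable_sw_cong[OF A_costable ab(2) vs_scale]) (auto simp: mult intro!: I)
  qed (intro I)+
  also have "\<dots> = (\<Sum>l<d. sw a (\<lambda>p q. sw b (\<lambda>r t. scale (\<theta> f l q) p * scale (\<theta> l e t) r)))"
    by (simp add: scale_sum_left sw_sum scale_mult_left scale_mult_right mult.commute)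
  also have "\<dots> = (\<Sum>l<d. twisted (\<theta> f l) a * twisted (\<theta> l e) b)"
    unfolding twisted_def by (simp add: sw_mult_left sw_mult_right)
  finally show ?thesis .
qed

text \<open>J is the kernel of the base change of the representation on A w. If J were 0, the r
  generators of M would satisfy no relation and M would be free, but a nonzero free module cannot
  equal M Q for a proper left ideal Q. The hypothesis \<open>faithful\<close> is M = M Q in dual
  form.\<close>

lemma costable_ideal_of_extremal:
  assumes wf: "weakly_finite TYPE('a)"
    and w: "m.simple w" "fv.dim (m.dominated w) = r * fv.dim (m.orb w)"
    and le: "\<And>y. m.simple y \<Longrightarrow> fv.dim (m.dominated y) \<le> r * fv.dim (m.orb y)"
    and Q: "subspace Q" "Q \<subseteq> A" "1 \<notin> Q" "\<And>a q. a \<in> A \<Longrightarrow> q \<in> Q \<Longrightarrow> a * q \<in> Q"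
    and faithful: "\<And>y. y \<in> Y \<Longrightarrow> (\<And>q. q \<in> Q \<Longrightarrow> act q y = 0) \<Longrightarrow> y = 0"
  shows "\<exists>J. costable_ideal A J \<and> J \<noteq> {0} \<and> (\<forall>x\<in>J. act x w = 0)"
proof -
  define d where "d = fv.dim (m.orb w)"
  have wY: "w \<in> Y" "w \<noteq> 0" using w(1) by (auto simp: m.simple_def)
  obtain c where c: "\<And>e. e < d \<Longrightarrow> c e \<in> A" "inj_on (\<lambda>e. act (c e) w) {..<d}"
      "fv.independent ((\<lambda>e. act (c e) w) ` {..<d})" "fv.span ((\<lambda>e. act (c e) w) ` {..<d}) = m.orb w"
    using m.orb_basis[OF wY(1)] unfolding d_def by blast
  have "\<exists>\<chi>. lin_fun fscale \<chi> \<and> (\<forall>e<d. \<chi> (act (c e) w) = (if e = f then 1 else 0))" if f: "f < d" for f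
  proof -
    obtain \<chi> where \<chi>: "lin_fun fscale \<chi>"
        "\<forall>b\<in>(\<lambda>e. act (c e) w) ` {..<d}. \<chi> b = (if b = act (c f) w then 1 else 0)"
      using fv.functional_extend[OF c(3), of "\<lambda>b. if b = act (c f) w then 1 else 0"] by blast
    have "\<chi> (act (c e) w) = (if e = f then 1 else 0)" if "e < d" for e
      using \<chi>(2) that f c(2) by (auto simp: inj_on_def)
    then show ?thesis using \<chi>(1) by blast
  qed
  then obtain \<chi>' where \<chi>': "\<And>f. f < d \<Longrightarrow> lin_fun fscale (\<chi>' f) \<and> (\<forall>e<d. \<chi>' f (act (c e) w) = (if e = f then 1 else 0))"
    by metis
  define \<chi> where "\<chi> f = (if f < d then \<chi>' f else (\<lambda>_. 0))" for f
  have \<chi>l: "lin_fun fscale (\<chi> f)" for f using \<chi>' by (simp add: \<chi>_def fv.lin_fun_iff)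
  have \<chi>c: "\<chi> f (act (c e) w) = (if e = f then 1 else 0)" if "e < d" "f < d" for e f
    using \<chi>' that by (simp add: \<chi>_def)
  have orb_expand: "v = (\<Sum>f<d. fscale (\<chi> f v) (act (c f) w))" if v: "v \<in> m.orb w" for v
  proof -
    obtain k where "v = (\<Sum>x\<in>(\<lambda>e. act (c e) w) ` {..<d}. fscale (k x) x)"
      using fv.span_finite_sum[of "(\<lambda>e. act (c e) w) ` {..<d}" v] c(4) v by blast
    then have k: "v = (\<Sum>e<d. fscale (k (act (c e) w)) (act (c e) w))"
      by (simp add: sum.reindex[OF c(2)])
    have "\<chi> f v = k (act (c f) w)" if f: "f < d" for f
    proof -
      have "\<chi> f v = (\<Sum>e<d. k (act (c e) w) * \<chi> f (act (c e) w))"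
        by (subst k) (simp add: lin_fun_sum[OF \<chi>l] lin_fun_scale[OF \<chi>l])
      also have "\<dots> = (\<Sum>e<d. if e = f then k (act (c f) w) else 0)"
        using f by (intro sum.cong) (auto simp: \<chi>c)
      finally show ?thesis using f by simp
    qed
    then show ?thesis using k by simp
  qed
  define \<theta> where "\<theta> f e = (\<lambda>a. \<chi> f (act a (act (c e) w)))" for f e
  have \<theta>l: "lin (*) (\<theta> f e)" for f e unfolding \<theta>_def by (rule lin_act_functional[OF \<chi>l])
  have \<theta>: "act a (act (c e) w) = (\<Sum>f<d. fscale (\<theta> f e a) (act (c f) w))" if "a \<in> A" "e < d" for a e
  proof -
    have "act a (act (c e) w) = act (a * c e) w" using that c(1) wY by (simp add: m.mult_act)
    also have "\<dots> \<in> m.orb w" using that c(1) A_mult by (auto simp: m.orb_def)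
    finally show ?thesis unfolding \<theta>_def by (rule orb_expand)
  qed
  have \<theta>_mult: "\<theta> f e (x * y) = (\<Sum>l<d. \<theta> f l x * \<theta> l e y)" if "x \<in> A" "y \<in> A" "e < d" for f e x y
  proof -
    have "act (x * y) (act (c e) w) = act x (\<Sum>l<d. fscale (\<theta> l e y) (act (c l) w))"
      using that \<theta>[of y e] by (simp add: m.mult_act mact_supp)
    then show ?thesis
      unfolding \<theta>_def[of f e]
      by (simp add: m.act_sum m.act_scale lin_fun_sum[OF \<chi>l] lin_fun_scale[OF \<chi>l])
        (simp add: \<theta>_def mult.commute)
  qed
  \<comment> \<open>Composing the twisted coefficients with the counit returns \<theta>, so elements
    of J act as zero on A w.\<close>
  define J where "J = {x \<in> A. \<forall>f<d. \<forall>e<d. twisted (\<theta> f e) x = 0}"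
  note lt = lin_twisted[OF \<theta>l]
  have sJ: "subspace J"
    unfolding subspace_def J_def using A_subspace
    by (auto simp: subspace_0 subspace_add subspace_scale lin_zeroD[OF lt] lin_addD[OF lt] lin_scaleD[OF lt])
  have "costable J"
    unfolding costable_def
    using sJ A_costable twisted_costable[OF \<theta>l] by (auto simp: J_def costable_def)
  moreover have "a * x \<in> J \<and> x * a \<in> J" if "a \<in> A" "x \<in> J" for a x
  proof -
    have x: "x \<in> A" "\<And>f e. f < d \<Longrightarrow> e < d \<Longrightarrow> twisted (\<theta> f e) x = 0" using that by (auto simp: J_def)
    have "twisted (\<theta> f e) (a * x) = 0 \<and> twisted (\<theta> f e) (x * a) = 0" if "f < d" "e < d" for f e
      using twisted_mult[of \<theta> f e d, OF \<theta>l \<theta>_mult] x that \<open>a \<in> A\<close> by simp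
    then show ?thesis using x that A_mult by (simp add: J_def)
  qed
  ultimately have ideal: "costable_ideal A J"
    by (auto simp: costable_ideal_def J_def)
  have kill: "act x w = 0" if x: "x \<in> J" for x
  proof -
    have xA: "x \<in> A" using x by (simp add: J_def)
    have "\<theta> f e x = 0" if "f < d" "e < d" for f e
      using eps_twisted[OF \<theta>l, of f e x] x that lin_zeroD[OF lin_eps_id] by (simp add: J_def)
    then have z: "act x (act (c e) w) = 0" if "e < d" for e using \<theta>[OF xA that] that by (simp add: fun_eq_iff sum_fun_apply)
    have "act x w = act x (\<Sum>f<d. fscale (\<chi> f w) (act (c f) w))"
      using orb_expand[OF m.self_in_orb[OF wY(1)]] by simp
    then show ?thesis using z by (simp add: m.act_sum m.act_scale)
  qed
  have "J \<noteq> {0}"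
  proof
    assume J0: "J = {0}"
    obtain g where g: "\<And>k. k < r \<Longrightarrow> lin_fun fscale (g k)"
        and cogen: "\<forall>y\<in>Y. (\<forall>k<r. \<forall>a\<in>A. g k (act a y) = 0) \<longrightarrow> y = 0"
      using m.cogenerators_exist[OF le] by blast
    \<comment> \<open>Freeness: a relation has all its twisted coefficients zero, hence coefficients
      in J = 0.\<close>
    have rel: "a k = 0" if a: "\<And>k. k < r \<Longrightarrow> a k \<in> A" "\<And>y. y \<in> Y \<Longrightarrow> (\<Sum>k<r. g k (act (a k) y)) = 0"
        and k: "k < r" for a k
    proof -
      have "twisted (\<theta> f e) (a k) = 0" if "f < d" "e < d" for f e
        by (rule relations_twisted_zero[OF wf wY(1) d_def w(2)[folded d_def] g _ c(1) c(4) c(2) \<theta>l \<theta> a k that])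
          (use cogen in blast)+
      then have "a k \<in> J" using a(1)[OF k] by (simp add: J_def)
      then show ?thesis using J0 by simp
    qed
    have r: "0 < r"
    proof (rule ccontr)
      assume "\<not> 0 < r"
      then have "fv.dim (m.dominated w) = 0" using w(2) by simp
      then show False
        using fv.dim_pos_fd[OF m.fd_dominated m.subspace_dominated m.self_dominated[OF wY(1)] wY(2)] by simp
    qed
    obtain B where B: "finite B" "independent B" "B \<subseteq> A" "span B = A"
      using fd_basis[OF A_fd A_subspace] by blast
    obtain \<alpha> where \<alpha>: "lin_fun scale \<alpha>" "\<alpha> 1 = 1" "\<forall>v\<in>Q. \<alpha> v = 0"
      using functional_separating[OF Q(1,3)] by blast
    have \<alpha>l: "lin (*) \<alpha>" using \<alpha>(1) by (simp add: lin_fun_lin)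
    define Z where "Z = {..<r} \<times> B"
    \<comment> \<open>The values of y on all g k b with b in a basis of A. By freeness these values
      can be prescribed arbitrarily: a vector annihilating the range of E would be a nontrivial
      relation among the generators.\<close>
    define E where "E y = (\<lambda>(k, b). if (k, b) \<in> Z then g k (act b y) else 0)" for y
    have E_add: "E (x + y) = E x + E y" and E_scale: "E (fscale c x) = fscale c (E x)" for x y c
      using lin_fun_add[OF g] lin_fun_scale[OF g]
      by (auto simp: fun_eq_iff E_def Z_def m.act_add m.act_scale)
    have sE: "fv.subspace (E ` Y)"
      unfolding fv.subspace_def
    proof (intro conjI ballI allI)
      have "E 0 = 0" using E_scale[of 0 0] by simp
      then show "0 \<in> E ` Y" using fv.subspace_0[OF subspace_supp_fun] by (metis imageI)
      show "x + y \<in> E ` Y" if "x \<in> E ` Y" "y \<in> E ` Y" for x y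
        using that by (auto simp flip: E_add intro!: imageI fv.subspace_add[OF subspace_supp_fun])
      show "fscale c x \<in> E ` Y" if "x \<in> E ` Y" for c x
        using that by (auto simp flip: E_scale intro!: imageI fv.subspace_scale[OF subspace_supp_fun])
    qed
    \<comment> \<open>Prescribes \<alpha> on the free generator g 0 and zero on the others; r > 0
      ensures that g 0 exists.\<close>
    define t where "t = (\<lambda>(k, b). if (k, b) \<in> Z \<and> k = 0 then \<alpha> b else 0)"
    have "t \<in> E ` Y"
    proof (rule ccontr)
      assume "t \<notin> E ` Y"
      moreover have "finite Z" using B(1) by (simp add: Z_def)
      moreover have "E ` Y \<subseteq> supp_fun Z" by (auto simp: supp_fun_def E_def)
      moreover have "t \<in> supp_fun Z" by (auto simp: supp_fun_def t_def)
      ultimately obtain co where co: "\<exists>z\<in>Z. co z \<noteq> 0" "\<forall>f\<in>E ` Y. (\<Sum>z\<in>Z. co z * f z) = 0"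
        using annihilator_exists[of Z "E ` Y" t] sE by blast
      define a where "a k = (\<Sum>b\<in>B. scale (co (k, b)) b)" for k
      have aA: "a k \<in> A" for k
        unfolding a_def using B A_subspace by (intro subspace_sum subspace_scale) auto
      have "(\<Sum>k<r. g k (act (a k) y)) = 0" if y: "y \<in> Y" for y
      proof -
        have "(\<Sum>k<r. g k (act (a k) y)) = (\<Sum>k<r. \<Sum>b\<in>B. co (k, b) * g k (act b y))"
          unfolding a_def
          by (intro sum.cong refl) (simp add: mact_sum_left mact_scale_left lin_fun_sum[OF g] lin_fun_scale[OF g])
        also have "\<dots> = (\<Sum>z\<in>Z. co z * E y z)"
          unfolding Z_def sum.cartesian_product by (intro sum.cong) (auto simp: E_def Z_def)
        finally show ?thesis using co(2) y by simp
      qed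
      then have a0: "a k = 0" if "k < r" for k using rel[of a k] aA that by blast
      obtain k b where kb: "k < r" "b \<in> B" "co (k, b) \<noteq> 0" using co(1) by (auto simp: Z_def)
      then show False
        using independentD[OF B(2) B(1) subset_refl, of "\<lambda>b. co (k, b)" b] a0[of k] by (simp add: a_def)
    qed
    then obtain y where y: "y \<in> Y" "t = E y" by blast
    have gy: "g k (act a y) = (if k = 0 then \<alpha> a else 0)" if k: "k < r" and a: "a \<in> A" for k a
    proof -
      obtain co where co: "a = (\<Sum>b\<in>B. scale (co b) b)"
        using span_finite_sum[OF B(1), of a] B(4) a by blast
      have b: "g k (act b y) = (if k = 0 then \<alpha> b else 0)" if "b \<in> B" for b
        using fun_cong[OF y(2), of "(k, b)"] that k by (simp add: t_def E_def Z_def)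
      have "g k (act a y) = (\<Sum>b\<in>B. co b * g k (act b y))"
        unfolding co by (simp add: mact_sum_left mact_scale_left lin_fun_sum[OF g[OF k]] lin_fun_scale[OF g[OF k]])
      also have "\<dots> = (\<Sum>b\<in>B. co b * (if k = 0 then \<alpha> b else 0))" using b by simp
      also have "\<dots> = (if k = 0 then \<alpha> a else 0)"
        unfolding co by (simp add: lin_sumD[OF \<alpha>l] lin_scaleD[OF \<alpha>l])
      finally show ?thesis .
    qed
    \<comment> \<open>The functionals take a q y to \<alpha> (a q) or to 0, and a q lies in the left
      ideal Q, on which \<alpha> vanishes. So \<open>cogen\<close> applies, although g 0 has the
      value \<alpha> 1 = 1 at y.\<close>
    have "act q y = 0" if q: "q \<in> Q" for q
    proof -
      have qA: "q \<in> A" using q Q by blast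
      have "g k (act a (act q y)) = 0" if "k < r" "a \<in> A" for k a
      proof -
        have "act a (act q y) = act (a * q) y" using that qA y by (simp add: m.mult_act)
        then show ?thesis using gy[of k "a * q"] that qA A_mult Q(4) q \<alpha>(3) by simp
      qed
      then show ?thesis using cogen mact_supp by blast
    qed
    then have "y = 0" using faithful y by blast
    then have "g 0 (act 1 y) = 0" using lin_fun_zero[OF g] r by simp
    then show False using gy[of 0 1] r A_one \<alpha>(2) by simp
  qed
  then show ?thesis using ideal kill by blast
qed

end

section \<open>Powers of a relative Hopf module\<close>

lemma sum_prod_delta:
  fixes s t :: nat
  assumes "finite I" "t < s"
  shows "(\<Sum>z\<in>I \<times> {..<s}. if t = snd z then f (fst z) else 0) = (\<Sum>i\<in>I. f i)"
proof -
  have "(\<Sum>z\<in>I \<times> {..<s}. if t = snd z then f (fst z) else 0) = (\<Sum>i\<in>I. \<Sum>t'<s. if t = t' then f i else 0)"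
    by (simp only: sum.cartesian_product case_prod_unfold)
  also have "\<dots> = (\<Sum>i\<in>I. f i)" using assms by simp
  finally show ?thesis .
qed

definition comp_at :: "nat \<Rightarrow> ('i \<times> nat \<Rightarrow> 'k) \<Rightarrow> 'i \<Rightarrow> 'k" where
  "comp_at t f = (\<lambda>i. f (i, t))"

definition embed_at :: "nat \<Rightarrow> ('i \<Rightarrow> 'k::field) \<Rightarrow> 'i \<times> nat \<Rightarrow> 'k" where
  "embed_at t f = (\<lambda>z. if snd z = t then f (fst z) else 0)"

lemma comp_at_add: "comp_at t (x + y) = comp_at t x + comp_at t y"
  and comp_at_scale: "comp_at t (fscale c x) = fscale c (comp_at t x)"
  and comp_at_zero: "comp_at t 0 = 0"
  by (auto simp: comp_at_def fun_eq_iff)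

lemma comp_at_sum: "comp_at t (\<Sum>x\<in>X. f x) = (\<Sum>x\<in>X. comp_at t (f x))"
  by (simp add: comp_at_def fun_eq_iff sum_fun_apply)

lemma comp_embed: "comp_at t (embed_at t' f) = (if t = t' then f else 0)"
  by (auto simp: comp_at_def embed_at_def fun_eq_iff)

lemma linear_comp_at: "Vector_Spaces.linear fscale fscale (comp_at t)"
  unfolding linear_iff by (auto simp: comp_at_add comp_at_scale intro: fv.vector_space_axioms)

lemma embed_at_supp: "f \<in> supp_fun I \<Longrightarrow> t < s \<Longrightarrow> embed_at t f \<in> supp_fun (I \<times> {..<s})"
  by (auto simp: supp_fun_def embed_at_def)

lemma comp_at_supp: "f \<in> supp_fun (I \<times> {..<s}) \<Longrightarrow> comp_at t f \<in> supp_fun I"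
  by (auto simp: supp_fun_def comp_at_def)

lemma comp_at_eq_zero:
  assumes "f \<in> supp_fun (I \<times> {..<s})" "\<And>t. t < s \<Longrightarrow> comp_at t f = 0"
  shows "f = 0"
proof
  fix z :: "'a \<times> nat"
  show "f z = 0 z"
    using assms(1) fun_cong[OF assms(2), of "snd z" "fst z"]
    by (cases z; cases "snd z < s") (auto simp: supp_fun_def comp_at_def)
qed

definition pow_space :: "'i set \<Rightarrow> nat \<Rightarrow> ('i \<Rightarrow> 'k::field) set \<Rightarrow> ('i \<times> nat \<Rightarrow> 'k) set" where
  "pow_space I s D = {z \<in> supp_fun (I \<times> {..<s}). \<forall>t<s. comp_at t z \<in> D}"

lemma subspace_pow_space: "fv.subspace D \<Longrightarrow> fv.subspace (pow_space I s D)"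
  unfolding pow_space_def fv.subspace_def[of "{z \<in> supp_fun (I \<times> {..<s}). \<forall>t<s. comp_at t z \<in> D}"]
  by (auto simp: comp_at_add comp_at_scale comp_at_zero fv.subspace_0 fv.subspace_add fv.subspace_scale
      subspace_supp_fun)

lemma dim_pow_space:
  fixes D :: "('i \<Rightarrow> 'k::field) set"
  assumes "finite I" "fv.subspace D" "D \<subseteq> supp_fun I"
  shows "fv.dim (pow_space I s D) = s * fv.dim D"
proof -
  obtain B where B: "finite B" "fv.independent B" "B \<subseteq> D" "fv.span B = D" "card B = fv.dim D"
    using fv.fd_basis[OF fv.fd_subset[OF fd_supp_fun[OF assms(1)] assms(3)] assms(2)] by blast
  define e where "e z = embed_at (fst z) (snd z)" for z :: "nat \<times> ('i \<Rightarrow> 'k)"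
  let ?P = "{..<s} \<times> B"
  have b0: "b \<noteq> 0" if "b \<in> B" for b using B(2) that fv.dependent_zero by blast
  have inj: "inj_on e ?P"
  proof (rule inj_onI)
    fix z z' assume z: "z \<in> ?P" "z' \<in> ?P" "e z = e z'"
    have c: "comp_at (fst z) (e z) = snd z" by (simp add: e_def comp_embed)
    have "comp_at (fst z) (e z') = (if fst z = fst z' then snd z' else 0)" by (simp add: e_def comp_embed)
    then have "fst z = fst z'" "snd z = snd z'" using z c b0 by (auto split: if_splits)
    then show "z = z'" by (rule prod_eqI)
  qed
  have indep: "fv.independent (e ` ?P)"
  proof (rule fv.independent_if_scalars_zero)
    show "finite (e ` ?P)" using B(1) by simp
    fix c x assume s0: "(\<Sum>x\<in>e ` ?P. fscale (c x) x) = 0" and "x \<in> e ` ?P"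
    then obtain t b where tb: "t < s" "b \<in> B" "x = e (t, b)" by auto
    have "(\<Sum>z\<in>?P. fscale (c (e z)) (e z)) = 0" using s0 by (simp add: sum.reindex[OF inj])
    then have "comp_at t (\<Sum>z\<in>?P. fscale (c (e z)) (e z)) = 0" by (simp add: comp_at_zero)
    moreover have "comp_at t (\<Sum>z\<in>?P. fscale (c (e z)) (e z)) = (\<Sum>b\<in>B. fscale (c (e (t, b))) b)"
    proof -
      have "comp_at t (\<Sum>z\<in>?P. fscale (c (e z)) (e z)) = (\<Sum>t'<s. \<Sum>b\<in>B. comp_at t (fscale (c (e (t', b))) (e (t', b))))"
        by (simp add: comp_at_sum sum.cartesian_product case_prod_unfold)
      also have "\<dots> = (\<Sum>t'<s. if t' = t then \<Sum>b\<in>B. fscale (c (e (t, b))) b else 0)"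
        by (intro sum.cong refl) (auto simp: comp_at_scale e_def comp_embed fun_eq_iff sum_fun_apply)
      finally show ?thesis using tb by simp
    qed
    ultimately show "c x = 0"
      using fv.independentD[OF B(2) B(1) subset_refl, of "\<lambda>b. c (e (t, b))" b] tb by simp
  qed
  have "pow_space I s D = fv.span (e ` ?P)"
  proof
    show "fv.span (e ` ?P) \<subseteq> pow_space I s D"
      by (rule fv.span_minimal[OF _ subspace_pow_space[OF assms(2)]])
        (use B(3) assms in \<open>auto simp: pow_space_def e_def comp_embed fv.subspace_0 intro!: embed_at_supp\<close>)
    show "pow_space I s D \<subseteq> fv.span (e ` ?P)"
    proof
      fix z assume z: "z \<in> pow_space I s D"
      have "z = (\<Sum>t<s. embed_at t (comp_at t z))"
        using z by (auto simp: fun_eq_iff sum_fun_apply embed_at_def comp_at_def pow_space_def supp_fun_def)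
      also have "\<dots> \<in> fv.span (e ` ?P)"
      proof (rule fv.span_sum)
        fix t assume t: "t \<in> {..<s}"
        have "comp_at t z \<in> fv.span B" using z t B(4) by (simp add: pow_space_def)
        then obtain co where co: "comp_at t z = (\<Sum>b\<in>B. fscale (co b) b)"
          using fv.span_finite_sum[OF B(1)] by blast
        have "embed_at t (comp_at t z) = (\<Sum>b\<in>B. fscale (co b) (e (t, b)))"
          unfolding co by (auto simp: fun_eq_iff embed_at_def sum_fun_apply e_def)
        also have "\<dots> \<in> fv.span (e ` ?P)"
          using t by (intro fv.span_sum fv.span_scale fv.span_base) auto
        finally show "embed_at t (comp_at t z) \<in> fv.span (e ` ?P)" .
      qed
      finally show "z \<in> fv.span (e ` ?P)" .
    qed
  qed
  then have "fv.dim (pow_space I s D) = card (e ` ?P)"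
    using indep by (simp add: fv.dim_eq_card_independent)
  also have "\<dots> = s * card B" using inj by (simp add: card_image card_cartesian_product)
  finally show ?thesis using B(5) by simp
qed

context hopf_rep
begin

definition pow_\<pi> :: "'i \<times> nat \<Rightarrow> 'i \<times> nat \<Rightarrow> 'a \<Rightarrow> 'k" where
  "pow_\<pi> z z' a = (if snd z = snd z' then \<pi> (fst z) (fst z') a else 0)"

definition pow_u :: "'i \<times> nat \<Rightarrow> 'i \<times> nat \<Rightarrow> 'a" where
  "pow_u z z' = (if snd z = snd z' then u (fst z) (fst z') else 0)"

text \<open>The coefficients of the direct sum of s copies are block diagonal with equal blocks, so
  each axiom reduces to a single block.\<close>

lemma hopf_rep_pow: "hopf_rep scale \<Delta> \<epsilon> S A (I \<times> {..<s}) pow_\<pi> pow_u"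
proof (unfold_locales)
  show "coideal_subalg A" by (rule A)
  show "finite (I \<times> {..<s})" using finite_I by simp
  show "lin (*) (pow_\<pi> i j)" for i j
    using lin_\<pi> by (cases "snd i = snd j") (auto simp: pow_\<pi>_def lin_def)
  show "pow_\<pi> i j 1 = (if i = j then 1 else 0)" if "i \<in> I \<times> {..<s}" "j \<in> I \<times> {..<s}" for i j
    using that by (auto simp: pow_\<pi>_def \<pi>_one split: if_splits)
  have delta: "(\<Sum>l\<in>I \<times> {..<s}. F l) = (\<Sum>l\<in>I. f l)"
    if "t < s" "\<And>l. F l = (if t = snd l then f (fst l) else 0)" for F :: "_ \<Rightarrow> 'z::comm_monoid_add" and f t
    using sum_prod_delta[OF finite_I that(1), of f] that(2) by simp
  show "pow_\<pi> i j (a * b) = (\<Sum>l\<in>I \<times> {..<s}. pow_\<pi> i l a * pow_\<pi> l j b)"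
    if "a \<in> A" "b \<in> A" "i \<in> I \<times> {..<s}" "j \<in> I \<times> {..<s}" for a b i j
  proof -
    have "(\<Sum>l\<in>I \<times> {..<s}. pow_\<pi> i l a * pow_\<pi> l j b) =
        (\<Sum>l\<in>I. if snd i = snd j then \<pi> (fst i) l a * \<pi> l (fst j) b else 0)"
      by (rule delta[of "snd i"]) (use that in \<open>auto simp: pow_\<pi>_def\<close>)
    then show ?thesis using that by (auto simp: pow_\<pi>_def \<pi>_mult)
  qed
  show "(\<Sum>j\<in>I \<times> {..<s}. scale (pow_\<pi> i j a) (pow_u j l)) =
      (\<Sum>j\<in>I \<times> {..<s}. pow_u i j * sw a (\<lambda>p q. scale (pow_\<pi> j l q) p))"
    if "a \<in> A" "i \<in> I \<times> {..<s}" "l \<in> I \<times> {..<s}" for a i l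
  proof -
    have z: "sw a (\<lambda>p q. 0) = (0::'a)" by (simp add: sw_def case_prod_unfold)
    have "(\<Sum>j\<in>I \<times> {..<s}. scale (pow_\<pi> i j a) (pow_u j l)) =
        (\<Sum>j\<in>I. if snd i = snd l then scale (\<pi> (fst i) j a) (u j (fst l)) else 0)"
      by (rule delta[of "snd i"]) (use that in \<open>auto simp: pow_\<pi>_def pow_u_def\<close>)
    moreover have "(\<Sum>j\<in>I \<times> {..<s}. pow_u i j * sw a (\<lambda>p q. scale (pow_\<pi> j l q) p)) =
        (\<Sum>j\<in>I. if snd i = snd l then u (fst i) j * sw a (\<lambda>p q. scale (\<pi> j (fst l) q) p) else 0)"
      by (rule delta[of "snd i"]) (use that in \<open>auto simp: pow_\<pi>_def pow_u_def z\<close>)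
    ultimately show ?thesis
      using \<pi>_u[OF that(1), of "fst i" "fst l"] that(2,3)
      by (cases "snd i = snd l") (simp_all add: mem_Times_iff)
  qed
  have T0: "T 0 = 0" using lin_zeroD[OF lin_T[OF lin_id]] .
  show "(\<Sum>j\<in>I \<times> {..<s}. pow_u j l * T (pow_u i j)) = (if i = l then 1 else 0)"
    if "i \<in> I \<times> {..<s}" "l \<in> I \<times> {..<s}" for i l
  proof -
    have "(\<Sum>j\<in>I \<times> {..<s}. pow_u j l * T (pow_u i j)) =
        (\<Sum>j\<in>I. if snd i = snd l then u j (fst l) * T (u (fst i) j) else 0)"
      by (rule delta[of "snd i"]) (use that in \<open>auto simp: pow_u_def T0\<close>)
    then show ?thesis
      using u_T[of "fst i" "fst l"] that
      by (cases "snd i = snd l") (simp_all add: mem_Times_iff prod_eq_iff)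
  qed
qed

lemma comp_pow_act:
  assumes "t < s"
  shows "comp_at t (mact (I \<times> {..<s}) pow_\<pi> a f) = act a (comp_at t f)"
proof
  fix i
  have "(\<Sum>j\<in>I \<times> {..<s}. pow_\<pi> (i, t) j a * f j) = (\<Sum>j\<in>I. \<pi> i j a * f (j, t))"
  proof -
    have "(\<Sum>j\<in>I \<times> {..<s}. pow_\<pi> (i, t) j a * f j) =
        (\<Sum>z\<in>I \<times> {..<s}. if t = snd z then \<pi> i (fst z) a * f (fst z, t) else 0)"
      by (intro sum.cong refl) (auto simp: pow_\<pi>_def)
    then show ?thesis using sum_prod_delta[OF finite_I assms, of "\<lambda>j. \<pi> i j a * f (j, t)"] by simp
  qed
  then show "comp_at t (mact (I \<times> {..<s}) pow_\<pi> a f) i = act a (comp_at t f) i"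
    using assms by (simp add: comp_at_def mact_def)
qed

text \<open>Maximises the rank dim Hom(A y, Y) / dim (A y) over simple y. The denominators are
  positive and at most dim \<open>Y\<close>, so N, the factorial of dim \<open>Y\<close>, is a
  common multiple and f is N times the rank, a bounded natural number.\<close>

lemma extremal_simple_exists:
  assumes "I \<noteq> {}"
  shows "\<exists>w. m.simple w \<and> (\<forall>y. m.simple y \<longrightarrow>
    fv.dim (m.dominated y) * fv.dim (m.orb w) \<le> fv.dim (m.dominated w) * fv.dim (m.orb y))"
proof -
  let ?n = "fv.dim Y" and ?D = "\<lambda>y. fv.dim (m.dominated y)" and ?O = "\<lambda>y. fv.dim (m.orb y)"
  define N :: nat where "N = (\<Prod>i=1..?n. i)"
  have N: "0 < N" unfolding N_def by (intro prod_pos) auto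
  have O: "0 < ?O y" "?O y \<le> ?n" "?O y dvd N" if "m.simple y" for y
  proof -
    have y: "y \<in> Y" "y \<noteq> 0" using that by (auto simp: m.simple_def)
    show 1: "0 < ?O y" by (rule fv.dim_pos_fd[OF m.fd_orb[OF y(1)] m.subspace_orb m.self_in_orb[OF y(1)] y(2)])
    show 2: "?O y \<le> ?n" by (rule fv.dim_mono_fd[OF m.fd_Y m.orb_subset[OF y(1)] m.subspace_orb m.subspace_Y])
    show "?O y dvd N" unfolding N_def using 1 2 by (intro dvd_prodI) auto
  qed
  have D: "?D y \<le> ?n" for y
    by (rule fv.dim_mono_fd[OF m.fd_Y _ m.subspace_dominated m.subspace_Y]) (auto simp: m.dominated_def)
  define f where "f y = ?D y * (N div ?O y)" for y
  obtain i where i: "i \<in> I" using assms by blast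
  have "unit_fun i \<in> Y" "unit_fun i \<noteq> (0 :: 'i \<Rightarrow> 'k)"
    using i by (auto simp: unit_fun_in_supp fun_eq_iff unit_fun_apply)
  moreover have "m.submod Y" using m.subspace_Y m.act_in by (auto simp: m.submod_def)
  ultimately obtain w0 where w0: "m.simple w0" using m.submod_contains_simple by blast
  have bound: "f y < ?n * N + 1" for y
    unfolding f_def using mult_le_mono[OF D, of "N div ?O y" N y] by (simp add: div_le_dividend)
  obtain w where w: "m.simple w" "\<And>y. m.simple y \<Longrightarrow> f y \<le> f w"
    using ex_has_greatest_nat[of m.simple w0 f "?n * N + 1"] w0 bound by (metis less_imp_le)
  have "?D y * ?O w \<le> ?D w * ?O y" if y: "m.simple y" for y
  proof -
    have "f y * (?O y * ?O w) \<le> f w * (?O y * ?O w)" using w(2)[OF y] by (rule mult_le_mono1)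
    moreover have "f y * (?O y * ?O w) = (?D y * ?O w) * N"
      unfolding f_def using O(3)[OF y] by (simp add: ac_simps)
    moreover have "f w * (?O y * ?O w) = (?D w * ?O y) * N"
      unfolding f_def using O(3)[OF w(1)] by (simp add: ac_simps)
    ultimately show ?thesis using N by simp
  qed
  then show ?thesis using w(1) by blast
qed

text \<open>The maximal rank of M is r / s, with s the dimension of the orbit of w and r that of its
  dominated space. In the sum of s copies the rank at w is the integer r and still maximal, so the
  extremal case applies there; its ideal annihilates the copy of w in component 0.\<close>

lemma costable_ideal_exists:
  assumes wf: "weakly_finite TYPE('a)" and ne: "I \<noteq> {}"
    and Q: "subspace Q" "Q \<subseteq> A" "1 \<notin> Q" "\<And>a q. a \<in> A \<Longrightarrow> q \<in> Q \<Longrightarrow> a * q \<in> Q"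
    and faithful: "\<And>y. y \<in> Y \<Longrightarrow> (\<And>q. q \<in> Q \<Longrightarrow> act q y = 0) \<Longrightarrow> y = 0"
  shows "\<exists>J w. costable_ideal A J \<and> J \<noteq> {0} \<and> w \<in> Y \<and> w \<noteq> 0 \<and> (\<forall>x\<in>J. act x w = 0)"
proof -
  obtain w where w: "m.simple w"
      and max: "\<And>y. m.simple y \<Longrightarrow>
        fv.dim (m.dominated y) * fv.dim (m.orb w) \<le> fv.dim (m.dominated w) * fv.dim (m.orb y)"
    using extremal_simple_exists[OF ne] by blast
  have wY: "w \<in> Y" "w \<noteq> 0" using w by (auto simp: m.simple_def)
  define s where "s = fv.dim (m.orb w)"
  define r where "r = fv.dim (m.dominated w)"
  have s: "0 < s"
    unfolding s_def by (rule fv.dim_pos_fd[OF m.fd_orb[OF wY(1)] m.subspace_orb m.self_in_orb[OF wY(1)] wY(2)])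
  interpret P: hopf_rep scale \<Delta> \<epsilon> S A "I \<times> {..<s}" pow_\<pi> pow_u by (rule hopf_rep_pow)
  interpret V: vector_space_pair "fscale :: 'k \<Rightarrow> ('i \<times> nat \<Rightarrow> 'k) \<Rightarrow> 'i \<times> nat \<Rightarrow> 'k"
    "fscale :: 'k \<Rightarrow> ('i \<Rightarrow> 'k) \<Rightarrow> 'i \<Rightarrow> 'k" by unfold_locales
  have comp0: "P.act a y = 0 \<longleftrightarrow> (\<forall>t<s. act a (comp_at t y) = 0)" for a y
  proof
    assume "P.act a y = 0"
    then show "\<forall>t<s. act a (comp_at t y) = 0" by (auto simp flip: comp_pow_act simp: comp_at_zero)
  next
    assume "\<forall>t<s. act a (comp_at t y) = 0"
    then show "P.act a y = 0" by (intro comp_at_eq_zero[OF P.mact_supp]) (simp add: comp_pow_act)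
  qed
  \<comment> \<open>A nonzero component has the same annihilator as the simple vector y, since some
    b returns each nonzero a y to y. The components thus generate isomorphic simple modules, and the
    space of homomorphisms is multiplied by s.\<close>
  have pow_simple: "m.simple (comp_at t y) \<and> fv.dim (P.m.orb y) = fv.dim (m.orb (comp_at t y))
      \<and> P.m.dominated y = pow_space I s (m.dominated (comp_at t y))"
    if y: "P.m.simple y" and t: "t < s" "comp_at t y \<noteq> 0" for y t
  proof -
    let ?v = "comp_at t y"
    have yY: "y \<in> P.Y" using y by (simp add: P.m.simple_def)
    have vY: "?v \<in> Y" using yY by (rule comp_at_supp)
    have ann: "P.act a y = 0 \<longleftrightarrow> act a ?v = 0" if a: "a \<in> A" for a
    proof
      assume "P.act a y = 0" then show "act a ?v = 0" using comp0 t by blast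
    next
      assume av: "act a ?v = 0"
      show "P.act a y = 0"
      proof (rule ccontr)
        assume "P.act a y \<noteq> 0"
        then obtain b where b: "b \<in> A" "P.act b (P.act a y) = y" using y a by (auto simp: P.m.simple_def)
        then have "?v = act b (act a ?v)" using comp_pow_act[OF t(1)] by metis
        then show False using av t(2) by simp
      qed
    qed
    have "\<exists>b\<in>A. act b (act a ?v) = ?v" if a: "a \<in> A" "act a ?v \<noteq> 0" for a
    proof -
      have "P.act a y \<noteq> 0" using ann a by blast
      then obtain b where "b \<in> A" "P.act b (P.act a y) = y" using y a by (auto simp: P.m.simple_def)
      then show ?thesis using comp_pow_act[OF t(1)] by metis
    qed
    then have sv: "m.simple ?v" using vY t by (simp add: m.simple_def)
    have "fv.dim (comp_at t ` P.m.orb y) = fv.dim (P.m.orb y)"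
    proof (rule V.dim_image_inj_on[OF linear_comp_at P.m.fd_orb[OF yY] P.m.subspace_orb])
      fix x assume "x \<in> P.m.orb y" "comp_at t x = 0"
      then obtain a where "a \<in> A" "x = P.act a y" "act a ?v = 0"
        using comp_pow_act[OF t(1)] by (auto simp: P.m.orb_def)
      then show "x = 0" using ann by blast
    qed
    moreover have "comp_at t ` P.m.orb y = m.orb ?v"
      using comp_pow_act[OF t(1)] by (simp add: P.m.orb_def m.orb_def image_image)
    moreover have "P.m.dominated y = pow_space I s (m.dominated ?v)"
      unfolding P.m.dominated_def m.dominated_def pow_space_def
      using ann comp0 comp_at_supp by blast
    ultimately show ?thesis using sv by simp
  qed
  have dimpow: "fv.dim (pow_space I s (m.dominated v)) = s * fv.dim (m.dominated v)" for v
    by (rule dim_pow_space[OF finite_I m.subspace_dominated]) (auto simp: m.dominated_def)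
  let ?w = "embed_at 0 w"
  have cw: "comp_at 0 ?w = w" by (simp add: comp_embed)
  have act_embed: "P.act a (embed_at 0 x) = embed_at 0 (act a x)" for a x
  proof -
    have "P.act a (embed_at 0 x) - embed_at 0 (act a x) = 0"
    proof (rule comp_at_eq_zero)
      show "P.act a (embed_at 0 x) - embed_at 0 (act a x) \<in> supp_fun (I \<times> {..<s})"
        using embed_at_supp[OF mact_supp s] P.mact_supp by (intro fv.subspace_diff subspace_supp_fun)
      fix t assume t: "t < s"
      have "comp_at t (P.act a (embed_at 0 x)) = comp_at t (embed_at 0 (act a x))"
        using t by (simp add: comp_pow_act comp_embed)
      then show "comp_at t (P.act a (embed_at 0 x) - embed_at 0 (act a x)) = 0"
        by (simp add: comp_at_def fun_eq_iff)
    qed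
    then show ?thesis by simp
  qed
  have wP: "P.m.simple ?w"
    unfolding P.m.simple_def
  proof (intro conjI ballI impI)
    show "?w \<in> P.Y" by (rule embed_at_supp[OF wY(1) s])
    show "?w \<noteq> 0" using cw wY(2) by (metis comp_at_zero)
    fix a assume a: "a \<in> A" "P.act a ?w \<noteq> 0"
    moreover have "embed_at 0 (0 :: 'i \<Rightarrow> 'k) = 0" by (simp add: embed_at_def fun_eq_iff)
    ultimately have "act a w \<noteq> 0" using act_embed by metis
    then obtain b where "b \<in> A" "act b (act a w) = w" using w a(1) by (auto simp: m.simple_def)
    then show "\<exists>b\<in>A. P.act b (P.act a ?w) = ?w" using act_embed by metis
  qed
  have "\<exists>J. costable_ideal A J \<and> J \<noteq> {0} \<and> (\<forall>x\<in>J. P.act x ?w = 0)"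
  proof (rule P.costable_ideal_of_extremal[OF wf wP _ _ Q(1-3)])
    have ww: "fv.dim (P.m.orb ?w) = s" "fv.dim (P.m.dominated ?w) = s * r"
      using pow_simple[OF wP s] wY(2) by (simp_all add: cw s_def r_def dimpow[unfolded s_def])
    then show "fv.dim (P.m.dominated ?w) = r * fv.dim (P.m.orb ?w)" by simp
    show "fv.dim (P.m.dominated y) \<le> r * fv.dim (P.m.orb y)" if y: "P.m.simple y" for y
    proof -
      have "y \<in> P.Y" "y \<noteq> 0" using y by (auto simp: P.m.simple_def)
      then obtain t where t: "t < s" "comp_at t y \<noteq> 0" using comp_at_eq_zero by blast
      show ?thesis
        using pow_simple[OF y t] max[of "comp_at t y"]
        by (simp add: dimpow mult.commute flip: s_def r_def)
    qed
    show "a * q \<in> Q" if "a \<in> A" "q \<in> Q" for a q using that by (rule Q(4))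
    show "y = 0" if y: "y \<in> P.Y" "\<And>q. q \<in> Q \<Longrightarrow> P.act q y = 0" for y
    proof (rule comp_at_eq_zero[OF y(1)])
      fix t assume t: "t < s"
      show "comp_at t y = 0"
      proof (rule faithful)
        show "comp_at t y \<in> Y" using y(1) by (rule comp_at_supp)
        show "act q (comp_at t y) = 0" if "q \<in> Q" for q using y(2)[OF that] comp0 t by blast
      qed
    qed
  qed
  then obtain J where J: "costable_ideal A J" "J \<noteq> {0}" "\<forall>x\<in>J. P.act x ?w = 0" by blast
  have "act x w = 0" if "x \<in> J" for x
    using J(3) that comp0[of x ?w] s cw by auto
  then show ?thesis using J wY by blast
qed

end

section \<open>Nondegeneracy of the Haar functional on coideal subalgebras\<close>

context hopf
begin

text \<open>Applies the preceding result to M / R. The elements I of a basis of M outside a basis of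
  R represent a basis of the quotient, and the coordinates \<kappa> c with c in I vanish on R, so
  action and coaction are read off on representatives.\<close>

lemma costable_ideal_of_quotient:
  assumes wf: "weakly_finite TYPE('a)" and A: "coideal_subalg A"
    and M: "costable M" "M \<subseteq> A" "\<And>x a. x \<in> M \<Longrightarrow> a \<in> A \<Longrightarrow> x * a \<in> M"
    and R: "costable R" "R \<subseteq> M" "R \<noteq> M" "\<And>x a. x \<in> R \<Longrightarrow> a \<in> A \<Longrightarrow> x * a \<in> R"
    and Q: "subspace Q" "Q \<subseteq> A" "1 \<notin> Q" "\<And>a q. a \<in> A \<Longrightarrow> q \<in> Q \<Longrightarrow> a * q \<in> Q"
    and MQ: "M \<subseteq> span ({x * q |x q. x \<in> M \<and> q \<in> Q} \<union> R)"
  shows "\<exists>J. costable_ideal A J \<and> J \<noteq> {0} \<and> \<not> M \<subseteq> span ({x * q |x q. x \<in> M \<and> q \<in> J} \<union> R)"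
proof -
  have Ac: "costable A" and Afd: "fd A" using A by (auto simp: coideal_subalg_def)
  have sM: "subspace M" and sR: "subspace R" using M(1) R(1) by (auto simp: costable_def)
  have fM: "fd M" and fR: "fd R" using fd_subset[OF Afd] M(2) R(2) by auto
  obtain BR where BR: "independent BR" "BR \<subseteq> R" "span BR = R"
    using fd_basis[OF fR sR] by blast
  obtain BM where BM: "BR \<subseteq> BM" "finite BM" "independent BM" "BM \<subseteq> M" "span BM = M"
    using fd_basis_extend[OF fM sM BR(1)] BR(2) R(2) by blast
  define I where "I = BM - BR"
  have I: "finite I" "I \<subseteq> M" using BM by (auto simp: I_def)
  have "I \<noteq> {}"
  proof
    assume "I = {}"
    then have "BM \<subseteq> BR" by (auto simp: I_def)
    then show False using BM BR R(3) by auto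
  qed
  have "\<exists>\<phi>. lin (*) \<phi> \<and> (\<forall>b\<in>BM. \<phi> b = (if b = c then 1 else 0))" for c
    using functional_extend[OF BM(3), of "\<lambda>b. if b = c then 1 else 0"] unfolding lin_fun_lin by blast
  then obtain \<kappa> where \<kappa>: "\<And>c. lin (*) (\<kappa> c)" "\<And>c b. b \<in> BM \<Longrightarrow> \<kappa> c b = (if b = c then 1 else 0)"
    by metis
  have M_expand: "x = (\<Sum>b\<in>BM. scale (\<kappa> b x) b)" if x: "x \<in> M" for x
  proof -
    obtain f where f: "x = (\<Sum>b\<in>BM. scale (f b) b)" using span_finite_sum[OF BM(2), of x] BM(5) x by blast
    have "\<kappa> c x = f c" if c: "c \<in> BM" for c
    proof -
      have "\<kappa> c x = (\<Sum>b\<in>BM. f b * \<kappa> c b)" unfolding f by (simp add: lin_sumD[OF \<kappa>(1)] lin_scaleD[OF \<kappa>(1)])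
      also have "\<dots> = (\<Sum>b\<in>BM. if b = c then f c else 0)" by (intro sum.cong) (auto simp: \<kappa>(2))
      finally show ?thesis using c BM(2) by simp
    qed
    then show ?thesis using f by simp
  qed
  have lin_R: "f x = 0" if "lin s f" "\<And>b. b \<in> BR \<Longrightarrow> f b = 0" "x \<in> R" "vector_space s"
    for f :: "'a \<Rightarrow> 'z::ab_group_add" and s x
  proof -
    interpret s: vector_space s by fact
    have "x \<in> span BR" using that BR(3) by simp
    then show ?thesis
    proof (induction rule: span_induct_alt)
      case base then show ?case using lin_zeroD[OF that(1)] .
    next
      case (step c x y) then show ?case using lin_addD[OF that(1)] lin_scaleD[OF that(1)] that(2) by simp
    qed
  qed
  \<comment> \<open>Replaces linear maps on the quotient: a linear map vanishing on R is determined
    on M by its values on I.\<close>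
  have lin_M: "f x = (\<Sum>d\<in>I. s (\<kappa> d x) (f d))"
    if f: "lin s f" "\<And>b. b \<in> R \<Longrightarrow> f b = 0" and x: "x \<in> M" and s: "vector_space s"
    for f :: "'a \<Rightarrow> 'z::ab_group_add" and s x
  proof -
    interpret s: vector_space s by (rule s)
    have "f x = f (\<Sum>b\<in>BM. scale (\<kappa> b x) b)" using M_expand[OF x] by simp
    also have "\<dots> = (\<Sum>b\<in>BM. s (\<kappa> b x) (f b))" by (simp add: lin_sumD[OF f(1)] lin_scaleD[OF f(1)])
    also have "\<dots> = (\<Sum>d\<in>I. s (\<kappa> d x) (f d))"
      unfolding I_def using BM(2) f(2) BR(2) by (intro sum.mono_neutral_right) auto
    finally show ?thesis .
  qed
  have \<kappa>R: "\<kappa> c x = 0" if "c \<in> I" "x \<in> R" for c x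
    by (rule lin_R[OF \<kappa>(1) _ that(2) vs_field]) (use that(1) BM(1) \<kappa>(2) in \<open>auto simp: I_def\<close>)
  have \<kappa>I: "\<kappa> c b = (if b = c then 1 else 0)" if "b \<in> I" for b c using \<kappa>(2) that by (simp add: I_def)
  have \<kappa>': "lin (*) (\<lambda>x. \<kappa> c (f x))" if "lin scale f" for c f using lin_comp[OF \<kappa>(1) that] .
  note LI = lin_intros \<kappa>' lin_T
  define \<rho> where "\<rho> c x = sw x (\<lambda>p q. scale (\<kappa> c q) p)" for c x
  have \<rho>l: "lin scale (\<rho> c)" for c unfolding \<rho>_def by (intro LI)
  have \<rho>R: "\<rho> c x = 0" if "c \<in> I" "x \<in> R" for c x
  proof -
    have "\<rho> c x = sw x (\<lambda>p q. 0)"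
      unfolding \<rho>_def by (rule costable_sw_cong[OF R(1) that(2) vs_scale]) (auto intro!: LI simp: \<kappa>R that)
    then show ?thesis by (simp add: sw_def case_prod_unfold)
  qed
  define \<pi> where "\<pi> b c a = \<kappa> c (b * a)" for b c a
  define u where "u b c = \<rho> c b" for b c
  have \<rho>M: "\<rho> c x = (\<Sum>d\<in>I. scale (\<kappa> d x) (u d c))" if "c \<in> I" "x \<in> M" for c x
    unfolding u_def using lin_M[OF \<rho>l \<rho>R[OF that(1)] that(2) vs_scale] .
  interpret H: hopf_rep scale \<Delta> \<epsilon> S A I \<pi> u
  proof unfold_locales
    show "coideal_subalg A" by (rule A)
    show "finite I" by (rule I)
    show "lin (*) (\<pi> i j)" for i j unfolding \<pi>_def by (intro LI)
    show "\<pi> i j 1 = (if i = j then 1 else 0)" if "i \<in> I" for i j using that by (simp add: \<pi>_def \<kappa>I)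
    show "\<pi> i j (a * b) = (\<Sum>l\<in>I. \<pi> i l a * \<pi> l j b)" if "a \<in> A" "b \<in> A" "i \<in> I" "j \<in> I" for a b i j
    proof -
      have "\<kappa> j (i * a * b) = (\<Sum>l\<in>I. \<kappa> l (i * a) * \<kappa> j (l * b))"
        by (rule lin_M[of "(*)" "\<lambda>x. \<kappa> j (x * b)"])
          (use that I M R \<kappa>R in \<open>auto intro!: LI\<close>)
      then show ?thesis by (simp add: \<pi>_def mult.assoc)
    qed
    show "(\<Sum>j\<in>I. scale (\<pi> i j a) (u j l)) = (\<Sum>j\<in>I. u i j * sw a (\<lambda>p q. scale (\<pi> j l q) p))"
      if a: "a \<in> A" and i: "i \<in> I" and l: "l \<in> I" for a i l
    proof -
      let ?f = "\<lambda>x. sw a (\<lambda>r t. scale (\<kappa> l (x * t)) r)"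
      have iM: "i \<in> M" using i I by blast
      have fR: "?f x = 0" if "x \<in> R" for x
      proof -
        have "?f x = sw a (\<lambda>p q. 0)"
          by (rule costable_sw_cong[OF Ac a vs_scale]) (auto intro!: LI simp: \<kappa>R l R(4) that)
        then show ?thesis by (simp add: sw_def case_prod_unfold)
      qed
      have "(\<Sum>j\<in>I. scale (\<pi> i j a) (u j l)) = \<rho> l (i * a)"
        unfolding \<pi>_def using \<rho>M[OF l M(3)[OF iM a]] by simp
      also have "\<dots> = sw i (\<lambda>p q. sw a (\<lambda>r t. scale (\<kappa> l (q * t)) (p * r)))"
        unfolding \<rho>_def by (rule sw_mult[OF vs_scale]) (intro LI)+
      also have "\<dots> = sw i (\<lambda>p q. p * ?f q)"
        by (simp add: sw_mult_left[symmetric] scale_mult_right)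
      also have "\<dots> = sw i (\<lambda>p q. p * (\<Sum>j\<in>I. scale (\<kappa> j q) (?f j)))"
      proof (rule costable_sw_cong[OF M(1) iM vs_scale])
        fix p q assume q: "q \<in> M"
        have "?f q = (\<Sum>j\<in>I. scale (\<kappa> j q) (?f j))"
          by (rule lin_M[of scale ?f, OF _ fR q vs_scale]) (intro LI)
        then show "p * ?f q = p * (\<Sum>j\<in>I. scale (\<kappa> j q) (?f j))" by simp
      qed (intro LI)+
      also have "\<dots> = (\<Sum>j\<in>I. sw i (\<lambda>p q. scale (\<kappa> j q) p * ?f j))"
        by (simp add: sum_distrib_left sw_sum scale_mult_left scale_mult_right)
      also have "\<dots> = (\<Sum>j\<in>I. u i j * ?f j)"
        by (simp add: sw_mult_right u_def \<rho>_def)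
      finally show ?thesis by (simp add: \<pi>_def)
    qed
    \<comment> \<open>The comultiplication of u i l is the sum of u i j \<otimes> u j l, and the
      skew antipode axiom reduces the left side to the counit of u i l, the coordinate of i at
      l.\<close>
    show "(\<Sum>j\<in>I. u j l * T (u i j)) = (if i = l then 1 else 0)" if i: "i \<in> I" and l: "l \<in> I" for i l
    proof -
      have iM: "i \<in> M" using i I by blast
      let ?G = "\<lambda>x. sw x (\<lambda>p q. q * T p)"
      have lG: "lin scale ?G" by (intro LI)
      have "?G (u i l) = sw i (\<lambda>p q. scale (\<kappa> l q) (?G p))"
        unfolding u_def \<rho>_def by (simp add: sw_lin[OF lG] lin_scaleD[OF lG])
      also have "\<dots> = sw i (\<lambda>p q. sw p (\<lambda>p1 p2. scale (\<kappa> l q) (p2 * T p1)))"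
        by (simp only: sw_scaled[OF vs_scale])
      also have "\<dots> = sw i (\<lambda>p q. sw q (\<lambda>q1 q2. scale (\<kappa> l q2) (q1 * T p)))"
        by (rule sw_coassoc[OF vs_scale]) (intro LI)+
      also have "\<dots> = sw i (\<lambda>p q. \<rho> l q * T p)"
        by (simp add: \<rho>_def sw_mult_right[symmetric] scale_mult_left)
      also have "\<dots> = sw i (\<lambda>p q. (\<Sum>j\<in>I. scale (\<kappa> j q) (u j l)) * T p)"
        by (rule costable_sw_cong[OF M(1) iM vs_scale])
          (auto intro!: LI \<rho>l lin_comp[OF \<rho>l] simp: \<rho>M l)
      also have "\<dots> = (\<Sum>j\<in>I. u j l * T (u i j))"
        using lin_scaleD[OF lin_T[OF lin_id]]
        by (simp add: sum_distrib_right sw_sum u_def \<rho>_def sw_lin[OF lin_T[OF lin_id]]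
            sw_mult_left[symmetric] scale_mult_left scale_mult_right)
      finally have "(\<Sum>j\<in>I. u j l * T (u i j)) = scale (\<epsilon> (u i l)) 1"
        using T_skew_antipode[OF lin_id, of "u i l"] by simp
      also have "\<epsilon> (u i l) = \<kappa> l i"
        unfolding u_def \<rho>_def
        using counit_left[OF \<kappa>(1), of i l] by (simp add: sw_lin[OF lin_eps_id] eps_scale mult.commute)
      finally show ?thesis using i by (simp add: \<kappa>I)
    qed
  qed
  \<comment> \<open>\<open>Yf\<close> is the functional on M / R with coordinates y. It kills M X
    and R, hence all of M. With X = Q this is faithfulness; with X = J it turns the annihilated
    vector w into the failure of the inclusion.\<close>
  have vanish: "y = 0" if y: "y \<in> H.Y" and X: "X \<subseteq> A" and kill: "\<And>x. x \<in> X \<Longrightarrow> H.act x y = 0"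
      and MX: "M \<subseteq> span ({x * q |x q. x \<in> M \<and> q \<in> X} \<union> R)" for y X
  proof -
    define Yf where "Yf x = (\<Sum>c\<in>I. \<kappa> c x * y c)" for x
    have Yl: "lin (*) Yf" unfolding Yf_def by (intro LI)
    have YR: "Yf x = 0" if "x \<in> R" for x using \<kappa>R that by (simp add: Yf_def)
    have YX: "Yf (x * q) = 0" if x: "x \<in> M" and q: "q \<in> X" for x q
    proof -
      have "Yf (x * q) = (\<Sum>d\<in>I. \<kappa> d x * Yf (d * q))"
        by (rule lin_M[of "(*)" "\<lambda>x. Yf (x * q)"])
          (use x q X R YR in \<open>auto intro!: LI lin_comp[OF Yl]\<close>)
      also have "\<dots> = 0"
      proof (intro sum.neutral ballI)
        fix d assume d: "d \<in> I"
        have "Yf (d * q) = H.act q y d" using d by (simp add: Yf_def mact_def \<pi>_def)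
        then show "\<kappa> d x * Yf (d * q) = 0" using kill[OF q] by simp
      qed
      finally show ?thesis .
    qed
    have YM: "Yf x = 0" if "x \<in> M" for x
    proof -
      have "x \<in> span ({x * q |x q. x \<in> M \<and> q \<in> X} \<union> R)" using that MX by blast
      then show ?thesis
      proof (induction rule: span_induct_alt)
        case base then show ?case using lin_zeroD[OF Yl] .
      next
        case (step c x y) then show ?case using lin_addD[OF Yl] lin_scaleD[OF Yl] YR YX by auto
      qed
    qed
    show "y = 0"
    proof
      fix i
      show "y i = 0 i"
      proof (cases "i \<in> I")
        case True
        have "Yf i = (\<Sum>c\<in>I. if i = c then y c else 0)" unfolding Yf_def using \<kappa>I[OF True] by (intro sum.cong) auto
        then show ?thesis using YM[of i] True I by auto
      next
        case False then show ?thesis using y by (simp add: supp_fun_def)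
      qed
    qed
  qed
  have "\<exists>J w. costable_ideal A J \<and> J \<noteq> {0} \<and> w \<in> H.Y \<and> w \<noteq> 0 \<and> (\<forall>x\<in>J. H.act x w = 0)"
    by (rule H.costable_ideal_exists[OF wf \<open>I \<noteq> {}\<close> Q]) (use vanish[OF _ Q(2) _ MQ] in blast)+
  then obtain J w where J: "costable_ideal A J" "J \<noteq> {0}" "w \<in> H.Y" "w \<noteq> 0" "\<forall>x\<in>J. H.act x w = 0" by blast
  have "\<not> M \<subseteq> span ({x * q |x q. x \<in> M \<and> q \<in> J} \<union> R)"
    using vanish[of w J] J by (auto simp: costable_ideal_def)
  then show ?thesis using J by blast
qed

text \<open>x is the sum of x1 \<epsilon>(x2) with second legs in X, so the counit cannot vanish on
  X.\<close>

lemma costable_eps: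
  assumes "costable X" "x \<in> X" "x \<noteq> 0"
  shows "\<exists>y\<in>X. \<epsilon> y = 1"
proof (rule ccontr)
  assume n: "\<not> ?thesis"
  have "\<epsilon> y = 0" if y: "y \<in> X" for y
  proof (rule ccontr)
    assume "\<epsilon> y \<noteq> 0"
    then have "\<epsilon> (scale (inverse (\<epsilon> y)) y) = 1" by (simp add: eps_scale)
    then show False using n subspace_scale[OF costable_subspace[OF assms(1)] y] by blast
  qed
  then have "sw x (\<lambda>p q. scale (\<epsilon> q) p) = sw x (\<lambda>p q. 0)"
    by (intro costable_sw_cong[OF assms(1,2) vs_scale]) (auto intro!: lin_intros)
  also have "\<dots> = 0" by (simp add: sw_def case_prod_unfold)
  finally show False using counit_right[OF lin_id, of x] assms(3) by simp
qed

lemma costable_span_products: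
  assumes "costable X" "costable Z"
  shows "costable (span {x * y |x y. x \<in> X \<and> y \<in> Z})"
proof (rule costable_span)
  fix b \<mu> assume "b \<in> {x * y |x y. x \<in> X \<and> y \<in> Z}" and \<mu>: "lin (*) (\<mu> :: 'a \<Rightarrow> 'k)"
  then obtain x y where xy: "x \<in> X" "y \<in> Z" "b = x * y" by blast
  have \<mu>': "lin (*) (\<lambda>x. \<mu> (f x))" if "lin scale f" for f using lin_comp[OF \<mu> that] .
  note LI = lin_intros \<mu>'
  let ?V = "span {x * y |x y. x \<in> X \<and> y \<in> Z}"
  have "sw b (\<lambda>p q. scale (\<mu> p) q) = sw x (\<lambda>p q. sw y (\<lambda>r t. scale (\<mu> (p * r)) (q * t)))"
    unfolding xy(3) by (rule sw_mult[OF vs_scale]) (intro LI)+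
  also have "\<dots> \<in> ?V"
  proof (rule costable_sw_in[OF assms(1) xy(1) vs_scale])
    fix p q assume q: "q \<in> X"
    show "sw y (\<lambda>r t. scale (\<mu> (p * r)) (q * t)) \<in> ?V"
    proof (rule costable_sw_in[OF assms(2) xy(2) vs_scale])
      fix r t assume "t \<in> Z"
      then show "scale (\<mu> (p * r)) (q * t) \<in> ?V" using q by (intro span_scale span_base) auto
    qed (intro LI | rule subspace_span)+
  qed (intro LI | rule subspace_span)+
  finally show "sw b (\<lambda>p q. scale (\<mu> p) q) \<in> ?V" .
qed

text \<open>The product is nonzero because the counit is multiplicative and takes the value 1 on
  both factors. Thus nonzero costable ideals meet, and one of least dimension lies inside every
  other.\<close>

lemma costable_ideal_product:
  assumes X: "costable_ideal A X" "X \<noteq> {0}" and Z: "costable_ideal A Z" "Z \<noteq> {0}"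
  shows "costable_ideal A (span {x * y |x y. x \<in> X \<and> y \<in> Z})"
    "span {x * y |x y. x \<in> X \<and> y \<in> Z} \<noteq> {0}"
    "span {x * y |x y. x \<in> X \<and> y \<in> Z} \<subseteq> X" "span {x * y |x y. x \<in> X \<and> y \<in> Z} \<subseteq> Z"
proof -
  let ?V = "span {x * y |x y. x \<in> X \<and> y \<in> Z}"
  have sX: "costable X" "subspace X" "X \<subseteq> A" "\<And>a x. a \<in> A \<Longrightarrow> x \<in> X \<Longrightarrow> a * x \<in> X" "\<And>a x. a \<in> A \<Longrightarrow> x \<in> X \<Longrightarrow> x * a \<in> X"
    using X(1) by (auto simp: costable_ideal_def costable_def)
  have sZ: "costable Z" "subspace Z" "Z \<subseteq> A" "\<And>a x. a \<in> A \<Longrightarrow> x \<in> Z \<Longrightarrow> a * x \<in> Z" "\<And>a x. a \<in> A \<Longrightarrow> x \<in> Z \<Longrightarrow> x * a \<in> Z"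
    using Z(1) by (auto simp: costable_ideal_def costable_def)
  show VX: "?V \<subseteq> X" using sX sZ(3) by (intro span_minimal) auto
  show "?V \<subseteq> Z" using sZ sX(3) by (intro span_minimal) auto
  have mem: "a * v \<in> ?V \<and> v * a \<in> ?V" if a: "a \<in> A" and v: "v \<in> ?V" for a v
    using v
  proof (induction rule: span_induct_alt)
    case base then show ?case by (simp add: span_zero)
  next
    case (step c x y)
    then obtain p q where pq: "p \<in> X" "q \<in> Z" "x = p * q" by blast
    have "a * x = (a * p) * q" "x * a = p * (q * a)" using pq by (simp_all add: mult.assoc)
    then have "a * x \<in> ?V" "x * a \<in> ?V" using pq sX(4)[OF a] sZ(5)[OF a] by (auto intro!: span_base)
    then show ?case using step
      by (simp add: distrib_left distrib_right scale_mult_left scale_mult_right span_add span_scale)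
  qed
  show "costable_ideal A ?V"
    unfolding costable_ideal_def
    using costable_span_products[OF sX(1) sZ(1)] VX sX(3) mem by blast
  obtain x where "x \<in> X" "\<epsilon> x = 1"
    using costable_eps[OF sX(1)] X(2) subspace_0[OF sX(2)] by blast
  moreover obtain y where "y \<in> Z" "\<epsilon> y = 1"
    using costable_eps[OF sZ(1)] Z(2) subspace_0[OF sZ(2)] by blast
  ultimately have "x * y \<in> ?V" "\<epsilon> (x * y) = 1" by (auto simp: eps_mult intro!: span_base)
  then show "?V \<noteq> {0}" using lin_zeroD[OF lin_eps_id] by auto
qed

text \<open>An ideal X of least dimension satisfies X Z = X for every nonzero costable ideal Z, in
  particular X X = X. If X were proper, the quotient lemma with M = Q = X and R = 0 would give a Z
  for which this fails.\<close>

theorem costable_ideal_trivial: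
  assumes wf: "weakly_finite TYPE('a)" and A: "coideal_subalg A"
    and J: "costable_ideal A J" "J \<noteq> {0}"
  shows "J = A"
proof -
  let ?P = "\<lambda>X. costable_ideal A X \<and> X \<noteq> {0}"
  have Afd: "fd A" "subspace A" using A by (auto simp: coideal_subalg_def costable_def)
  obtain X where X: "?P X" and Xmin: "\<And>Z. ?P Z \<Longrightarrow> dim X \<le> dim Z"
    using ex_has_least_nat[of ?P J dim] J by blast
  have sX: "costable X" "subspace X" "X \<subseteq> A" and Xid: "\<And>a x. a \<in> A \<Longrightarrow> x \<in> X \<Longrightarrow> a * x \<in> X \<and> x * a \<in> X"
    using X by (auto simp: costable_ideal_def costable_def)
  have fX: "fd X" using fd_subset[OF Afd(1) sX(3)] .
  have prod: "span {x * y |x y. x \<in> X \<and> y \<in> Z} = X" if Z: "?P Z" for Z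
  proof (rule ccontr)
    let ?V = "span {x * y |x y. x \<in> X \<and> y \<in> Z}"
    assume ne: "?V \<noteq> X"
    note pr = costable_ideal_product[OF conjunct1[OF X] conjunct2[OF X] conjunct1[OF Z] conjunct2[OF Z]]
    then obtain x where "x \<in> X" "x \<notin> ?V" using ne by blast
    then have "dim ?V < dim X" using dim_strict_mono_fd[OF fX pr(3) subspace_span sX(2)] by blast
    then show False using Xmin[of ?V] pr(1,2) by simp
  qed
  have XA: "X = A"
  proof (rule ccontr)
    assume "X \<noteq> A"
    have "1 \<notin> X"
    proof
      assume "1 \<in> X"
      then have "a \<in> X" if "a \<in> A" for a using Xid[OF that, of 1] by simp
      then show False using \<open>X \<noteq> A\<close> sX(3) by blast
    qed
    have c0: "costable {0}"
    proof -
      have "sw 0 (\<lambda>p q. scale (\<mu> p) q) = 0" if \<mu>: "lin (*) \<mu>" for \<mu> :: "'a \<Rightarrow> 'k"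
        by (rule lin_zeroD[of scale "\<lambda>x. sw x (\<lambda>p q. scale (\<mu> p) q)"]) (intro lin_intros \<mu>)
      then show ?thesis by (simp add: costable_def subspace_single_0)
    qed
    have "\<exists>J. costable_ideal A J \<and> J \<noteq> {0} \<and> \<not> X \<subseteq> span ({x * q |x q. x \<in> X \<and> q \<in> J} \<union> {0})"
      by (rule costable_ideal_of_quotient[OF wf A sX(1,3) _ c0, where Q = X])
        (use X sX Xid \<open>1 \<notin> X\<close> subspace_0[OF sX(2)] prod[OF X] in auto)
    then obtain J where "?P J" "\<not> X \<subseteq> span ({x * q |x q. x \<in> X \<and> q \<in> J} \<union> {0})" by blast
    then show False using prod[of J] span_mono[of "{x * q |x q. x \<in> X \<and> q \<in> J}" "{x * q |x q. x \<in> X \<and> q \<in> J} \<union> {0}"]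
      by blast
  qed
  have "X \<subseteq> J" using prod[OF conjI[OF J]] costable_ideal_product(4)[OF conjunct1[OF X] conjunct2[OF X] J] by simp
  then show ?thesis using XA J(1) by (auto simp: costable_ideal_def)
qed

theorem haar_nondegenerate:
  assumes wf: "weakly_finite TYPE('a)" and A: "coideal_subalg A"
    and h: "lin (*) h" "h 1 = 1" "\<And>x. sw x (\<lambda>p q. scale (h q) p) = scale (h x) 1"
    and a: "a \<in> A" "\<And>b. b \<in> A \<Longrightarrow> h (a * b) = 0"
  shows "a = 0"
proof (rule ccontr)
  assume a0: "a \<noteq> 0"
  have Ac: "costable A" "subspace A" "1 \<in> A" "\<And>x y. x \<in> A \<Longrightarrow> y \<in> A \<Longrightarrow> x * y \<in> A"
    using A by (auto simp: coideal_subalg_def costable_def)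
  define R where "R = {a \<in> A. \<forall>b\<in>A. h (a * b) = 0}"
  have h': "lin (*) (\<lambda>x. h (f x))" if "lin scale f" for f using lin_comp[OF h(1) that] .
  have sR: "subspace R"
    unfolding R_def subspace_def using Ac(2)
    by (auto simp: subspace_0 subspace_add subspace_scale distrib_right scale_mult_left lin_zeroD[OF h(1)]
        lin_addD[OF h(1)] lin_scaleD[OF h(1)])
  have Rc: "costable R"
    unfolding costable_def
  proof (intro conjI ballI allI impI)
    fix x \<mu> assume x: "x \<in> R" and \<mu>: "lin (*) (\<mu> :: 'a \<Rightarrow> 'k)"
    let ?x = "sw x (\<lambda>p q. scale (\<mu> p) q)"
    have "h (?x * b) = 0" if b: "b \<in> A" for b
    proof -
      \<comment> \<open>The slice of b by \<mu> composed with T. It stays in A, and invariance of h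
        moves the slice of x onto it.\<close>
      let ?b = "sw b (\<lambda>u v. scale (\<mu> (T u)) v)"
      have "h (?x * b) = sw x (\<lambda>p q. \<mu> p * h (q * b))"
        by (simp add: sw_mult_right[symmetric] scale_mult_left sw_lin[OF h(1)] lin_scaleD[OF h(1)])
      also have "\<dots> = \<mu> (sw x (\<lambda>p q. scale (h (q * b)) p))"
        by (simp add: sw_lin[OF \<mu>] lin_scaleD[OF \<mu>] mult.commute)
      also have "\<dots> = \<mu> (sw b (\<lambda>u v. scale (h (x * v)) (T u)))"
        using invariant_functional_shift[OF h(1,3)] by simp
      also have "\<dots> = h (x * ?b)"
        by (simp add: sw_lin[OF \<mu>] lin_scaleD[OF \<mu>] sw_mult_left[symmetric] scale_mult_right
            sw_lin[OF h(1)] lin_scaleD[OF h(1)] mult.commute)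
      also have "?b \<in> A"
        using Ac(1) b lin_comp[OF \<mu> lin_T[OF lin_id]] by (simp add: costable_def)
      then have "h (x * ?b) = 0" using x by (simp add: R_def)
      finally show ?thesis .
    qed
    moreover have "?x \<in> A" using Ac(1) x \<mu> by (simp add: costable_def R_def)
    ultimately show "?x \<in> R" by (simp add: R_def)
  qed (rule sR)
  have R1: "1 \<notin> R" using h(2) Ac(3) by (force simp: R_def)
  \<comment> \<open>With this x every b in A splits as (b - \<epsilon>(b) x) + \<epsilon>(b) x, so
    the kernel Q of the counit on A and R together fill A: the fibre of A / R at the counit is
    zero.\<close>
  obtain x where x: "x \<in> R" "\<epsilon> x = 1" using costable_eps[OF Rc, of a] a a0 by (auto simp: R_def)
  define Q where "Q = {q \<in> A. \<epsilon> q = 0}"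
  have RA: "x * a \<in> R" if "x \<in> R" "a \<in> A" for x a
    using that Ac(4) by (auto simp: R_def mult.assoc)
  have "\<exists>J. costable_ideal A J \<and> J \<noteq> {0} \<and> \<not> A \<subseteq> span ({x * q |x q. x \<in> A \<and> q \<in> J} \<union> R)"
  proof (rule costable_ideal_of_quotient[OF wf A Ac(1) subset_refl Ac(4) Rc, where Q = Q])
    show "R \<subseteq> A" by (auto simp: R_def)
    show "R \<noteq> A" using R1 Ac(3) by blast
    show "x * a \<in> R" if "x \<in> R" "a \<in> A" for x a using that by (rule RA)
    show "subspace Q" unfolding Q_def subspace_def using Ac(2)
      by (auto simp: subspace_0 subspace_add subspace_scale lin_zeroD[OF lin_eps_id] lin_addD[OF lin_eps_id] eps_scale)
    show "Q \<subseteq> A" by (auto simp: Q_def)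
    show "1 \<notin> Q" by (simp add: Q_def eps_one)
    show "a * q \<in> Q" if "a \<in> A" "q \<in> Q" for a q using that Ac(4) by (simp add: Q_def eps_mult)
    show "A \<subseteq> span ({x * q |x q. x \<in> A \<and> q \<in> Q} \<union> R)"
    proof
      fix b assume b: "b \<in> A"
      let ?q = "b - scale (\<epsilon> b) x"
      have "x \<in> A" using x by (simp add: R_def)
      then have "?q \<in> A" using b Ac(2) by (simp add: subspace_diff subspace_scale)
      moreover have "\<epsilon> ?q = 0"
        using lin_addD[OF lin_eps_id, of ?q "scale (\<epsilon> b) x"] by (simp add: eps_scale x(2))
      ultimately have "?q \<in> Q" by (simp add: Q_def)
      then have "1 * ?q \<in> {x * q |x q. x \<in> A \<and> q \<in> Q}" using Ac(3) by blast
      then have "?q \<in> span ({x * q |x q. x \<in> A \<and> q \<in> Q} \<union> R)" by (intro span_base) simp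
      moreover have "scale (\<epsilon> b) x \<in> span ({x * q |x q. x \<in> A \<and> q \<in> Q} \<union> R)"
        using x(1) by (intro span_scale span_base) simp
      ultimately have "?q + scale (\<epsilon> b) x \<in> span ({x * q |x q. x \<in> A \<and> q \<in> Q} \<union> R)" by (rule span_add)
      then show "b \<in> span ({x * q |x q. x \<in> A \<and> q \<in> Q} \<union> R)" by simp
    qed
  qed
  then obtain J where J: "costable_ideal A J" "J \<noteq> {0}" "\<not> A \<subseteq> span ({x * q |x q. x \<in> A \<and> q \<in> J} \<union> R)" by blast
  have "J = A" by (rule costable_ideal_trivial[OF wf A J(1,2)])
  have "A \<subseteq> span ({x * q |x q. x \<in> A \<and> q \<in> J} \<union> R)"
  proof
    fix b assume "b \<in> A"
    then have "1 * b \<in> {x * q |x q. x \<in> A \<and> q \<in> J}" using \<open>J = A\<close> Ac(3) by blast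
    then show "b \<in> span ({x * q |x q. x \<in> A \<and> q \<in> J} \<union> R)" by (intro span_base) simp
  qed
  then show False using J(3) by blast
qed

end

section \<open>Integrals in coideal subalgebras\<close>

text \<open>A is a Frobenius algebra for the form h(a b). The functional h is a separate parameter,
  so that one Haar functional serves all coideal subalgebras.\<close>

locale frobenius_coideal = hopf scale \<Delta> \<epsilon> S
  for scale :: "'k::field \<Rightarrow> 'a::ring_1 \<Rightarrow> 'a" and \<Delta> \<epsilon> S +
  fixes h :: "'a \<Rightarrow> 'k" and A :: "'a set"
  assumes h_lin: "lin (*) h" and h_inv: "\<And>x. sw x (\<lambda>p q. scale (h q) p) = scale (h x) 1"
    and A: "coideal_subalg A"
    and nondeg_left: "\<And>a. a \<in> A \<Longrightarrow> (\<And>b. b \<in> A \<Longrightarrow> h (a * b) = 0) \<Longrightarrow> a = 0"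
begin

lemma A_costable: "costable A" and A_subspace: "subspace A" and A_one: "1 \<in> A"
    and A_mult: "x \<in> A \<Longrightarrow> y \<in> A \<Longrightarrow> x * y \<in> A" and A_fd: "fd A"
  using A by (auto simp: coideal_subalg_def costable_def)

lemma h_lin_comp: "lin scale f \<Longrightarrow> lin (*) (\<lambda>x. h (f x))"
  using lin_comp[OF h_lin] .

lemma h_scale: "h (scale c x) = c * h x"
  using lin_scaleD[OF h_lin] .

lemma h_diff: "h (x - y) = h x - h y"
  using lin_addD[OF h_lin, of "x - y" y] by (simp add: eq_diff_eq)

lemma dual_left:
  assumes \<alpha>: "lin (*) \<alpha>"
  shows "\<exists>c\<in>A. \<forall>a\<in>A. h (a * c) = \<alpha> a"
proof -
  let ?F = "{\<lambda>x. h (x * c) |c. c \<in> A}"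
  have "\<exists>f\<in>?F. \<forall>v\<in>A. f v = \<alpha> v"
  proof (rule functionals_onto_dual[OF A_fd A_subspace])
    show "lin_fun scale f" if "f \<in> ?F" for f
      using that h_lin_comp[OF lin_ml[OF lin_id]] by (auto simp: lin_fun_lin)
    show "(\<lambda>_. 0) \<in> ?F"
      using subspace_0[OF A_subspace] lin_zeroD[OF h_lin] by (auto intro!: exI[of _ 0])
    show "(\<lambda>x. f x + g x) \<in> ?F" if fg: "f \<in> ?F" "g \<in> ?F" for f g
    proof -
      obtain c d where "c \<in> A" "d \<in> A" "f = (\<lambda>x. h (x * c))" "g = (\<lambda>x. h (x * d))" using fg by blast
      then show ?thesis
        using subspace_add[OF A_subspace] by (auto simp: distrib_left lin_addD[OF h_lin] intro!: exI[of _ "c + d"])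
    qed
    show "(\<lambda>x. k * f x) \<in> ?F" if f: "f \<in> ?F" for k f
    proof -
      obtain c where "c \<in> A" "f = (\<lambda>x. h (x * c))" using f by blast
      then show ?thesis
        using subspace_scale[OF A_subspace] by (auto simp: scale_mult_right h_scale intro!: exI[of _ "scale k c"])
    qed
    show "v = 0" if v: "v \<in> A" "\<And>f. f \<in> ?F \<Longrightarrow> f v = 0" for v
    proof (rule nondeg_left[OF v(1)])
      fix b assume "b \<in> A"
      then show "h (v * b) = 0" using v(2)[of "\<lambda>x. h (x * b)"] by blast
    qed
    show "lin_fun scale \<alpha>" using \<alpha> by (simp add: lin_fun_lin)
  qed
  then show ?thesis by auto
qed

text \<open>By \<open>dual_left\<close>, sending x to the values h(y x) on a basis maps A onto a
  space of the same dimension, hence injectively; b lies in the kernel.\<close>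

lemma nondeg_right:
  assumes b: "b \<in> A" "\<And>a. a \<in> A \<Longrightarrow> h (a * b) = 0"
  shows "b = 0"
proof (rule ccontr)
  assume b0: "b \<noteq> 0"
  interpret V: vector_space_pair scale "fscale :: 'k \<Rightarrow> ('a \<Rightarrow> 'k) \<Rightarrow> 'a \<Rightarrow> 'k" by unfold_locales
  obtain B where B: "finite B" "independent B" "B \<subseteq> A" "card B = dim A"
    using fd_basis[OF A_fd A_subspace] by blast
  define E where "E x = (\<lambda>y. if y \<in> B then h (y * x) else 0)" for x
  have lE: "Vector_Spaces.linear scale fscale E"
    unfolding linear_iff using vector_space_axioms fv.vector_space_axioms
    by (auto simp: fun_eq_iff E_def distrib_left lin_addD[OF h_lin] scale_mult_right h_scale)
  have "E b = 0" using b B(3) by (auto simp: E_def fun_eq_iff)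
  then have "fv.dim (E ` A) < dim A"
    by (rule V.dim_image_less[OF lE A_fd A_subspace b(1) b0])
  moreover have "E ` A = supp_fun B"
  proof
    show "E ` A \<subseteq> supp_fun B" by (auto simp: E_def supp_fun_def)
    show "supp_fun B \<subseteq> E ` A"
    proof
      fix f :: "'a \<Rightarrow> 'k" assume f: "f \<in> supp_fun B"
      obtain \<alpha> where \<alpha>: "lin_fun scale \<alpha>" "\<forall>b\<in>B. \<alpha> b = f b" using functional_extend[OF B(2)] by blast
      then obtain c where c: "c \<in> A" "\<forall>a\<in>A. h (a * c) = \<alpha> a" using dual_left[of \<alpha>] unfolding lin_fun_lin by blast
      have "f = E c" using f \<alpha>(2) c B(3) by (auto simp: fun_eq_iff E_def supp_fun_def)
      then show "f \<in> E ` A" using c by blast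
    qed
  qed
  ultimately show False using B(1,4) by (simp add: dim_supp_fun)
qed

lemma dual_right:
  assumes \<alpha>: "lin (*) \<alpha>"
  shows "\<exists>c\<in>A. \<forall>a\<in>A. h (c * a) = \<alpha> a"
proof -
  let ?F = "{\<lambda>x. h (c * x) |c. c \<in> A}"
  have "\<exists>f\<in>?F. \<forall>v\<in>A. f v = \<alpha> v"
  proof (rule functionals_onto_dual[OF A_fd A_subspace])
    show "lin_fun scale f" if "f \<in> ?F" for f
      using that h_lin_comp[OF lin_mr[OF lin_id]] by (auto simp: lin_fun_lin)
    show "(\<lambda>_. 0) \<in> ?F"
      using subspace_0[OF A_subspace] lin_zeroD[OF h_lin] by (auto intro!: exI[of _ 0])
    show "(\<lambda>x. f x + g x) \<in> ?F" if fg: "f \<in> ?F" "g \<in> ?F" for f g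
    proof -
      obtain c d where "c \<in> A" "d \<in> A" "f = (\<lambda>x. h (c * x))" "g = (\<lambda>x. h (d * x))" using fg by blast
      then show ?thesis
        using subspace_add[OF A_subspace] by (auto simp: distrib_right lin_addD[OF h_lin] intro!: exI[of _ "c + d"])
    qed
    show "(\<lambda>x. k * f x) \<in> ?F" if f: "f \<in> ?F" for k f
    proof -
      obtain c where "c \<in> A" "f = (\<lambda>x. h (c * x))" using f by blast
      then show ?thesis
        using subspace_scale[OF A_subspace] by (auto simp: scale_mult_left h_scale intro!: exI[of _ "scale k c"])
    qed
    show "v = 0" if v: "v \<in> A" "\<And>f. f \<in> ?F \<Longrightarrow> f v = 0" for v
    proof (rule nondeg_right[OF v(1)])
      fix b assume "b \<in> A"
      then show "h (b * v) = 0" using v(2)[of "\<lambda>x. h (b * x)"] by blast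
    qed
    show "lin_fun scale \<alpha>" using \<alpha> by (simp add: lin_fun_lin)
  qed
  then show ?thesis by auto
qed

definition left_integral :: "'a \<Rightarrow> bool" where
  "left_integral L \<longleftrightarrow> L \<in> A \<and> (\<forall>a\<in>A. a * L = scale (\<epsilon> a) L)"

definition right_integral :: "'a \<Rightarrow> bool" where
  "right_integral L \<longleftrightarrow> L \<in> A \<and> (\<forall>a\<in>A. L * a = scale (\<epsilon> a) L)"

text \<open>The element representing the counit through the form is an integral: both a L and
  \<epsilon>(a) L represent b \<mapsto> \<epsilon>(b a).\<close>

lemma left_integral_exists: "\<exists>L. left_integral L \<and> L \<noteq> 0"
proof -
  obtain L where L: "L \<in> A" "\<forall>a\<in>A. h (a * L) = \<epsilon> a" using dual_left[OF lin_eps_id] by blast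
  have "a * L = scale (\<epsilon> a) L" if a: "a \<in> A" for a
  proof -
    have "a * L - scale (\<epsilon> a) L = 0"
    proof (rule nondeg_right)
      show "a * L - scale (\<epsilon> a) L \<in> A" using a L A_mult A_subspace by (simp add: subspace_diff subspace_scale)
      fix b assume b: "b \<in> A"
      have "h (b * a * L) = \<epsilon> (b * a)" using L A_mult a b by blast
      then show "h (b * (a * L - scale (\<epsilon> a) L)) = 0"
        using L(2) b by (simp add: right_diff_distrib h_diff scale_mult_right h_scale eps_mult mult.assoc mult.commute)
    qed
    then show ?thesis by simp
  qed
  moreover have "L \<noteq> 0" using L(2) A_one lin_zeroD[OF h_lin] by (auto simp: eps_one)
  ultimately show ?thesis using L(1) by (auto simp: left_integral_def)
qed

lemma right_integral_exists: "\<exists>R. right_integral R \<and> (\<forall>a\<in>A. h (R * a) = \<epsilon> a)"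
proof -
  obtain R where R: "R \<in> A" "\<forall>a\<in>A. h (R * a) = \<epsilon> a" using dual_right[OF lin_eps_id] by blast
  have "R * a = scale (\<epsilon> a) R" if a: "a \<in> A" for a
  proof -
    have "R * a - scale (\<epsilon> a) R = 0"
    proof (rule nondeg_left)
      show "R * a - scale (\<epsilon> a) R \<in> A" using a R A_mult A_subspace by (simp add: subspace_diff subspace_scale)
      fix b assume b: "b \<in> A"
      have "h (R * (a * b)) = \<epsilon> (a * b)" using R A_mult a b by blast
      then show "h ((R * a - scale (\<epsilon> a) R) * b) = 0"
        using R(2) b by (simp add: left_diff_distrib h_diff scale_mult_left h_scale eps_mult mult.assoc)
    qed
    then show ?thesis by simp
  qed
  then show ?thesis using R by (auto simp: right_integral_def)
qed

lemma left_integral_haar_nonzero: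
  assumes "left_integral L" "L \<noteq> 0"
  shows "h L \<noteq> 0"
proof
  assume "h L = 0"
  then have "L = 0" using assms(1) by (intro nondeg_right) (auto simp: left_integral_def h_scale)
  then show False using assms(2) by simp
qed

text \<open>The shift moves a to the first leg as S(a), and invariance then contracts L to h L. So S
  on A is visible through h and L alone.\<close>

lemma left_integral_antipode:
  assumes "left_integral L" "a \<in> A"
  shows "sw L (\<lambda>p q. scale (h (a * q)) p) = scale (h L) (S a)"
proof -
  have "sw L (\<lambda>p q. scale (h (a * q)) p) = sw L (\<lambda>p q. scale (h q) (S a * p))"
    by (rule antipode_shift_left[OF A_costable assms(2) _ vs_scale])
      (use assms in \<open>auto simp: left_integral_def intro!: lin_intros h_lin_comp\<close>)
  also have "\<dots> = S a * sw L (\<lambda>p q. scale (h q) p)"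
    by (simp add: sw_mult_left[symmetric] scale_mult_right)
  finally show ?thesis by (simp add: h_inv scale_mult_right)
qed

lemma right_integral_antipode:
  assumes "right_integral L" "a \<in> A"
  shows "sw L (\<lambda>p q. scale (h (q * a)) p) = scale (h L) (T a)"
proof -
  have "sw L (\<lambda>p q. scale (h (q * a)) p) = sw L (\<lambda>p q. scale (h q) (p * T a))"
    by (rule antipode_shift_right[OF A_costable assms(2) _ vs_scale])
      (use assms in \<open>auto simp: right_integral_def intro!: lin_intros h_lin_comp\<close>)
  also have "\<dots> = sw L (\<lambda>p q. scale (h q) p) * T a"
    by (simp add: sw_mult_right[symmetric] scale_mult_left)
  finally show ?thesis by (simp add: h_inv scale_mult_left)
qed

lemma right_integral_sw:
  assumes "right_integral L" "vector_space s" "\<And>b. lin s (\<lambda>a. F a b)" "\<And>a. lin s (\<lambda>b. F a b)"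
  shows "sw L (\<lambda>p q. F p (L * q)) = F L L"
proof -
  have L: "L \<in> A" "\<And>a. a \<in> A \<Longrightarrow> L * a = scale (\<epsilon> a) L" using assms(1) by (auto simp: right_integral_def)
  have "sw L (\<lambda>p q. F p (L * q)) = sw L (\<lambda>p q. s (\<epsilon> q) (F p L))"
  proof (rule costable_sw_cong[OF A_costable L(1) assms(2)])
    show "lin s (\<lambda>p. F p (L * q))" for q by (rule assms(3))
    show "lin s (\<lambda>q. F p (L * q))" for p by (rule lin_comp[OF assms(4)]) (intro lin_intros)
    show "lin s (\<lambda>p. s (\<epsilon> q) (F p L))" for q by (rule lin_scalar_right[OF assms(2,3)])
    show "lin s (\<lambda>q. s (\<epsilon> q) (F p L))" for p by (rule lin_scalar_left[OF assms(2) lin_eps_id])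
    show "F p (L * q) = s (\<epsilon> q) (F p L)" if "q \<in> A" for p q
      using that by (simp add: L(2) lin_scaleD[OF assms(4)])
  qed
  also have "\<dots> = F L L" by (rule counit_right[OF assms(3)])
  finally show ?thesis .
qed

text \<open>Let h(R a) = \<epsilon>(a) on A. The sum of L1 h(R L2) is L by the counit axiom and h(L)
  S(R) by the shift; when S L = L, injectivity of S gives L = h(L) R. Conversely, the sum of L1 h(L
  L2) is h(L) S(L) by the shift and h(L) L for a right integral.\<close>

lemma S_fixed_iff_right_integral:
  assumes L: "left_integral L" "L \<noteq> 0"
  shows "S L = L \<longleftrightarrow> right_integral L"
proof
  assume SL: "S L = L"
  obtain R where R: "right_integral R" "\<forall>a\<in>A. h (R * a) = \<epsilon> a" using right_integral_exists by blast
  have RA: "R \<in> A" and LA: "L \<in> A" using R L by (auto simp: right_integral_def left_integral_def)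
  have "sw L (\<lambda>p q. scale (h (R * q)) p) = sw L (\<lambda>p q. scale (\<epsilon> q) p)"
    by (rule costable_sw_cong[OF A_costable LA vs_scale]) (use R in \<open>auto intro!: lin_intros h_lin_comp\<close>)
  also have "\<dots> = L" by (rule counit_right[OF lin_id])
  finally have "S L = S (scale (h L) R)" using left_integral_antipode[OF L(1) RA] SL by (simp add: S_scale)
  then have "L = scale (h L) R" by (simp add: S_eq_iff)
  then show "right_integral L"
    using R(1) subspace_scale[OF A_subspace RA] unfolding right_integral_def
    by (metis scale_mult_left scale_left_commute)
next
  assume R: "right_integral L"
  have LA: "L \<in> A" using L by (simp add: left_integral_def)
  have "sw L (\<lambda>p q. scale (h (L * q)) p) = scale (h L) L"
    by (rule right_integral_sw[OF R vs_scale]) (intro lin_intros h_lin_comp)+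
  then have "scale (h L) (S L) = scale (h L) L" using left_integral_antipode[OF L(1) LA] by simp
  then show "S L = L" using left_integral_haar_nonzero[OF L] by simp
qed

text \<open>S S is a Nakayama automorphism here. If h(x a) = h(c x) on A, comparing L1 h(L2 a) with
  L1 h(c L2) gives T a = S c, that is a = S (S c). Nondegeneracy supplies an a for each c and a c
  for each a.\<close>

lemma unimodular_S_squared:
  assumes L: "left_integral L" "right_integral L" "L \<noteq> 0"
  shows "(S \<circ> S) ` A = A"
proof -
  have hL: "h L \<noteq> 0" using left_integral_haar_nonzero L by blast
  have LA: "L \<in> A" using L by (simp add: left_integral_def)
  have eq: "S (S c) = a" if ac: "a \<in> A" "c \<in> A" and e: "\<And>x. x \<in> A \<Longrightarrow> h (x * a) = h (c * x)" for a c
  proof -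
    have "scale (h L) (T a) = sw L (\<lambda>p q. scale (h (q * a)) p)"
      using right_integral_antipode[OF L(2) ac(1)] by simp
    also have "\<dots> = sw L (\<lambda>p q. scale (h (c * q)) p)"
      by (rule costable_sw_cong[OF A_costable LA vs_scale]) (auto simp: e intro!: lin_intros h_lin_comp)
    also have "\<dots> = scale (h L) (S c)" using left_integral_antipode[OF L(1) ac(2)] .
    finally have "T a = S c" using hL by simp
    then show ?thesis by (metis S_T)
  qed
  show ?thesis
  proof (intro subset_antisym subsetI)
    fix x assume "x \<in> (S \<circ> S) ` A"
    then obtain c where c: "c \<in> A" "x = S (S c)" by auto
    obtain a where "a \<in> A" "\<forall>x\<in>A. h (x * a) = h (c * x)"
      using dual_left[OF h_lin_comp[OF lin_mr[OF lin_id]], of c] by blast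
    then show "x \<in> A" using eq[of a c] c by simp
  next
    fix a assume a: "a \<in> A"
    obtain c where "c \<in> A" "\<forall>x\<in>A. h (c * x) = h (x * a)"
      using dual_right[OF h_lin_comp[OF lin_ml[OF lin_id]], of a] by blast
    then have "c \<in> A" "S (S c) = a" using eq[of a c] a by auto
    then show "a \<in> (S \<circ> S) ` A" by force
  qed
qed

text \<open>Idempotence forces \<epsilon> P = 1. For a nonzero right integral R the product R P
  equals both \<epsilon>(R) P and R, so P is a multiple of R.\<close>

lemma idempotent_left_integral:
  assumes P: "left_integral P" "P * P = P" "P \<noteq> 0"
  shows "right_integral P"
proof -
  have PA: "P \<in> A" using P by (simp add: left_integral_def)
  have "scale (\<epsilon> P) P = P" using P(1,2) PA by (simp add: left_integral_def)
  then have eP: "\<epsilon> P = 1" using P(3) by (metis scale_one scale_right_imp_eq)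
  obtain R where R: "right_integral R" "\<forall>a\<in>A. h (R * a) = \<epsilon> a" using right_integral_exists by blast
  have RA: "R \<in> A" using R by (simp add: right_integral_def)
  have "R \<noteq> 0" using R(2) A_one eps_one lin_zeroD[OF h_lin] by auto
  moreover have "R = scale (\<epsilon> R) P"
    using P(1) R(1) PA RA eP by (auto simp: left_integral_def right_integral_def)
  ultimately have "\<epsilon> R \<noteq> 0" by auto
  then have "P = scale (inverse (\<epsilon> R)) R" using \<open>R = scale (\<epsilon> R) P\<close> by (metis scale_scale left_inverse scale_one)
  then show ?thesis
    using R(1) subspace_scale[OF A_subspace RA] unfolding right_integral_def
    by (metis scale_mult_left scale_left_commute)
qed

end

section \<open>Elements of integral type and the three assertions\<close>

context hopf
begin

lemma integral_type_sw:
  assumes "integral_type scale \<Delta> L" "vector_space s" "\<And>b. lin s (\<lambda>a. F a b)" "\<And>a. lin s (\<lambda>b. F a b)"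
  shows "sw L (\<lambda>p q. F p (q * L)) = F L L"
proof -
  have "tensor_eq scale (map (\<lambda>(a, b). (a, b * L)) (\<Delta> L)) [(L, L)]"
    using assms(1) by (simp add: integral_type_def)
  from tensor_eq_bilinear[OF this assms(2-4)] show ?thesis
    by (simp add: sw_def case_prod_unfold o_def)
qed

text \<open>The second legs of \<open>\<Delta> L\<close> together with the unit span the coideal subalgebra.\<close>
lemma integral_type_coideal_subalg:
  assumes L: "integral_type scale \<Delta> L"
  shows "\<exists>A. coideal_subalg A \<and> L \<in> A \<and> (\<forall>a\<in>A. a * L = scale (\<epsilon> a) L)"
proof -
  define leg where "leg \<mu> = sw L (\<lambda>p q. scale (\<mu> p) q)" for \<mu> :: "'a \<Rightarrow> 'k"
  define B where "B = insert 1 {leg \<mu> |\<mu>. lin (*) \<mu>}"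
  let ?A = "span B"
  have cA: "costable ?A"
  proof (rule costable_span)
    fix b \<nu> assume b: "b \<in> B" and \<nu>: "lin (*) (\<nu> :: 'a \<Rightarrow> 'k)"
    let ?G = "\<lambda>x. sw x (\<lambda>p q. scale (\<nu> p) q)"
    have lG: "lin scale ?G" by (intro lin_intros \<nu>)
    show "?G b \<in> ?A"
    proof (cases "b = 1")
      case True
      have "?G 1 = scale (\<nu> 1) 1" by (rule sw_one[OF vs_scale]) (intro lin_intros \<nu>)+
      then show ?thesis using True by (simp add: B_def span_scale span_base)
    next
      case False
      then obtain \<mu> where \<mu>: "lin (*) \<mu>" "b = leg \<mu>" using b by (auto simp: B_def)
      have "?G b = sw L (\<lambda>p q. sw q (\<lambda>r t. scale (\<mu> p) (scale (\<nu> r) t)))"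
        unfolding \<mu>(2) leg_def by (simp only: sw_lin[OF lG] lin_scaleD[OF lG] sw_scaled[OF vs_scale])
      also have "\<dots> = sw L (\<lambda>p q. sw p (\<lambda>r t. scale (\<mu> r) (scale (\<nu> t) q)))"
        by (rule sw_coassoc[OF vs_scale, symmetric]) (intro lin_intros \<mu> \<nu>)+
      also have "\<dots> = leg (\<lambda>x. sw x (\<lambda>r t. \<mu> r * \<nu> t))"
        unfolding leg_def by (rule sw_cong) (simp add: sw_hom[where f = "\<lambda>c. scale c _"] scale_left_distrib)
      finally have "?G b = leg (\<lambda>x. sw x (\<lambda>r t. \<mu> r * \<nu> t))" .
      moreover have "lin (*) (\<lambda>x. sw x (\<lambda>r t. \<mu> r * \<nu> t))" by (intro lin_intros \<mu> \<nu>)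
      ultimately show ?thesis by (auto simp: B_def intro!: span_base)
    qed
  qed
  have int: "a * L = scale (\<epsilon> a) L" if "a \<in> ?A" for a
    using that
  proof (induction rule: span_induct_alt)
    case base then show ?case using lin_zeroD[OF lin_eps_id] by simp
  next
    case (step c x y)
    have "x * L = scale (\<epsilon> x) L"
    proof (cases "x = 1")
      case True then show ?thesis by (simp add: eps_one)
    next
      case False
      then obtain \<mu> where \<mu>: "lin (*) \<mu>" "x = leg \<mu>" using step by (auto simp: B_def)
      have "x * L = sw L (\<lambda>p q. scale (\<mu> p) (q * L))"
        unfolding \<mu>(2) leg_def by (simp add: sw_mult_right[symmetric] scale_mult_left)
      also have "\<dots> = scale (\<mu> L) L" by (rule integral_type_sw[OF L vs_scale]) (intro lin_intros \<mu>)+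
      also have "\<mu> L = \<epsilon> x"
        unfolding \<mu>(2) leg_def
        using counit_right[OF \<mu>(1), of L] by (simp add: sw_lin[OF lin_eps_id] eps_scale mult.commute)
      finally show ?thesis .
    qed
    then show ?case
      using step by (simp add: distrib_right scale_mult_left lin_addD[OF lin_eps_id] eps_scale scale_left_distrib)
  qed
  \<comment> \<open>The shift gives a \<open>leg \<mu>\<close> = \<open>leg\<close> of p \<mapsto>
    \<mu>(S(a) p), so the legs are stable under left multiplication by the span, and the unit adds
    nothing outside it.\<close>
  have left: "a * b \<in> ?A" if a: "a \<in> ?A" and b: "b \<in> ?A" for a b
    using b
  proof (induction rule: span_induct_alt)
    case base then show ?case by (simp add: span_zero)
  next
    case (step c x y)
    have "a * x \<in> ?A"
    proof (cases "x = 1")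
      case True then show ?thesis using a by simp
    next
      case False
      then obtain \<mu> where \<mu>: "lin (*) \<mu>" "x = leg \<mu>" using step by (auto simp: B_def)
      have "a * x = sw L (\<lambda>p q. scale (\<mu> p) (a * q))"
        unfolding \<mu>(2) leg_def by (simp add: sw_mult_left[symmetric] scale_mult_right)
      also have "\<dots> = leg (\<lambda>p. \<mu> (S a * p))"
        unfolding leg_def
        by (rule antipode_shift_left[OF cA a int vs_scale]) (assumption | intro lin_intros \<mu>)+
      finally have "a * x = leg (\<lambda>p. \<mu> (S a * p))" .
      moreover have "lin (*) (\<lambda>p. \<mu> (S a * p))" by (rule lin_comp[OF \<mu>(1)]) (intro lin_intros)
      ultimately show ?thesis by (auto simp: B_def intro!: span_base)
    qed
    then show ?case using step by (simp add: distrib_left scale_mult_right span_add span_scale)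
  qed
  \<comment> \<open>There are infinitely many slicing functionals in general, but all slices lie in
    the span of the finitely many second components of the chosen representative.\<close>
  have "B \<subseteq> span (insert 1 (snd ` set (\<Delta> L)))"
  proof
    fix b assume b: "b \<in> B"
    show "b \<in> span (insert 1 (snd ` set (\<Delta> L)))"
    proof (cases "b = 1")
      case True then show ?thesis by (simp add: span_base)
    next
      case False
      then obtain \<mu> where "b = leg \<mu>" using b by (auto simp: B_def)
      moreover have "sum_list (map (\<lambda>(p, q). scale (\<mu> p) q) xs) \<in> span (insert 1 (snd ` set xs'))"
        if "set xs \<subseteq> set xs'" for xs xs'
        using that
      proof (induction xs)
        case (Cons x xs)
        have "snd x \<in> span (insert 1 (snd ` set xs'))" using Cons.prems by (intro span_base) auto
        then show ?case using Cons by (simp add: case_prod_unfold span_add span_scale)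
      qed (simp add: span_zero)
      ultimately show ?thesis by (simp add: leg_def sw_def)
    qed
  qed
  then have "?A \<subseteq> span (insert 1 (snd ` set (\<Delta> L)))" by (simp add: span_minimal)
  then have fA: "fd ?A" unfolding fd_def by (intro exI[of _ "insert 1 (snd ` set (\<Delta> L))"]) simp
  have "L = leg \<epsilon>" unfolding leg_def using counit_left[OF lin_id, of L] by simp
  then have "L \<in> ?A" using lin_eps_id by (auto simp: B_def intro!: span_base)
  then show ?thesis
    using cA fA left int unfolding coideal_subalg_def by (intro exI[of _ ?A]) (auto simp: B_def span_base)
qed

lemma left_coideal_subalgebra_coideal_subalg:
  assumes "left_coideal_subalgebra scale \<Delta> A" "finite_dim_subspace scale A"
  shows "coideal_subalg A"
proof -
  have sA: "subspace A" using assms(1) by (simp add: left_coideal_subalgebra_def)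
  have "costable A"
    unfolding costable_def
  proof (intro conjI ballI allI impI)
    fix x \<mu> assume x: "x \<in> A" and \<mu>: "lin (*) (\<mu> :: 'a \<Rightarrow> 'k)"
    obtain xs where xs: "set xs \<subseteq> UNIV \<times> A" "tensor_eq scale (\<Delta> x) xs"
      using assms(1) x unfolding left_coideal_subalgebra_def by blast
    have "sw x (\<lambda>p q. scale (\<mu> p) q) = sum_list (map (\<lambda>(p, q). scale (\<mu> p) q) xs)"
      unfolding sw_def by (rule tensor_eq_bilinear[OF xs(2) vs_scale]) (intro lin_intros \<mu>)+
    also have "\<dots> \<in> A"
      using xs(1) by (induction xs) (auto simp: subspace_0[OF sA] intro!: subspace_add[OF sA] subspace_scale[OF sA])
    finally show "sw x (\<lambda>p q. scale (\<mu> p) q) \<in> A" .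
  qed (rule sA)
  moreover have "fd A" using assms(2) unfolding finite_dim_subspace_def fd_def by blast
  ultimately show ?thesis using assms(1) by (simp add: coideal_subalg_def left_coideal_subalgebra_def)
qed

lemma frobenius_coideal_exists:
  assumes "cosemisimple scale \<Delta>" "weakly_finite TYPE('a)"
  shows "\<exists>h. \<forall>A. coideal_subalg A \<longrightarrow> frobenius_coideal scale \<Delta> \<epsilon> S h A"
proof -
  obtain h where h: "lin (*) h" "h 1 = 1" "\<And>x. sw x (\<lambda>p q. scale (h q) p) = scale (h x) 1"
    using haar_functional_exists[OF assms(1)] by blast
  have "frobenius_coideal scale \<Delta> \<epsilon> S h A" if A: "coideal_subalg A" for A
  proof unfold_locales
    show "a = 0" if "a \<in> A" "\<And>b. b \<in> A \<Longrightarrow> h (a * b) = 0" for a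
      by (rule haar_nondegenerate[OF assms(2) A h]) (use that in auto)
  qed (use h A in auto)
  then show ?thesis by blast
qed

lemma S_fixed_iff_two_sided:
  assumes H: "\<And>A. coideal_subalg A \<Longrightarrow> frobenius_coideal scale \<Delta> \<epsilon> S h A"
    and L: "integral_type scale \<Delta> L"
  shows "S L = L \<longleftrightarrow> tensor_eq scale (map (\<lambda>(a, b). (a, L * b)) (\<Delta> L)) [(L, L)]"
proof -
  obtain A where A: "coideal_subalg A" "L \<in> A" "\<forall>a\<in>A. a * L = scale (\<epsilon> a) L"
    using integral_type_coideal_subalg[OF L] by blast
  interpret F: frobenius_coideal scale \<Delta> \<epsilon> S h A by (rule H[OF A(1)])
  have int: "F.left_integral L" using A by (simp add: F.left_integral_def)
  have L0: "L \<noteq> 0" using L by (simp add: integral_type_def)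
  show ?thesis
  proof
    assume "S L = L"
    then have R: "F.right_integral L" using F.S_fixed_iff_right_integral[OF int L0] by simp
    show "tensor_eq scale (map (\<lambda>(a, b). (a, L * b)) (\<Delta> L)) [(L, L)]"
      unfolding tensor_eq_def lin_fun_lin
    proof (intro allI impI, elim conjE)
      fix \<phi> \<psi> assume l: "lin (*) \<phi>" "lin (*) \<psi>"
      have "sw L (\<lambda>p q. \<phi> p * \<psi> (L * q)) = \<phi> L * \<psi> L"
        by (rule F.right_integral_sw[OF R vs_field]) (intro lin_intros l)+
      then show "sum_list (map (\<lambda>(a, b). \<phi> a * \<psi> b) (map (\<lambda>(a, b). (a, L * b)) (\<Delta> L))) =
          sum_list (map (\<lambda>(a, b). \<phi> a * \<psi> b) [(L, L)])"
        by (simp add: sw_def case_prod_unfold o_def)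
    qed
  next
    assume t: "tensor_eq scale (map (\<lambda>(a, b). (a, L * b)) (\<Delta> L)) [(L, L)]"
    \<comment> \<open>Applying h to the second leg gives L1 h(L L2) = h(L) L, whose left side is
      h(L) S(L) by the shift.\<close>
    have "sum_list (map (\<lambda>(p, q). scale (h q) p) (map (\<lambda>(a, b). (a, L * b)) (\<Delta> L))) =
        sum_list (map (\<lambda>(p, q). scale (h q) p) [(L, L)])"
      by (rule tensor_eq_bilinear[OF t vs_scale]) (intro lin_intros F.h_lin)+
    then have "sw L (\<lambda>p q. scale (h (L * q)) p) = scale (h L) L"
      by (simp add: sw_def case_prod_unfold o_def)
    then have "scale (h L) (S L) = scale (h L) L" using F.left_integral_antipode[OF int A(2)] by simp
    then show "S L = L" using F.left_integral_haar_nonzero[OF int L0] by simp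
  qed
qed

lemma unimodular_S_squared_image:
  assumes H: "\<And>A. coideal_subalg A \<Longrightarrow> frobenius_coideal scale \<Delta> \<epsilon> S h A"
    and A: "left_coideal_subalgebra scale \<Delta> A" "finite_dim_subspace scale A" "unimodular scale \<epsilon> A"
  shows "(S \<circ> S) ` A = A"
proof -
  interpret F: frobenius_coideal scale \<Delta> \<epsilon> S h A
    by (rule H[OF left_coideal_subalgebra_coideal_subalg[OF A(1,2)]])
  obtain L where L: "F.left_integral L" "L \<noteq> 0" using F.left_integral_exists by blast
  then have "F.right_integral L"
    using A(3) unfolding unimodular_def F.left_integral_def F.right_integral_def by blast
  then show ?thesis using F.unimodular_S_squared L by blast
qed

lemma idempotent_integral_type_two_sided:
  assumes H: "\<And>A. coideal_subalg A \<Longrightarrow> frobenius_coideal scale \<Delta> \<epsilon> S h A"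
    and P: "P * P = P" "integral_type scale \<Delta> P"
  shows "two_sided_grouplike_projection scale \<Delta> P"
proof -
  obtain A where A: "coideal_subalg A" "P \<in> A" "\<forall>a\<in>A. a * P = scale (\<epsilon> a) P"
    using integral_type_coideal_subalg[OF P(2)] by blast
  interpret F: frobenius_coideal scale \<Delta> \<epsilon> S h A by (rule H[OF A(1)])
  have int: "F.left_integral P" using A by (simp add: F.left_integral_def)
  have P0: "P \<noteq> 0" using P(2) by (simp add: integral_type_def)
  have R: "F.right_integral P" by (rule F.idempotent_left_integral[OF int P(1) P0])
  have SP: "S P = P" using F.S_fixed_iff_right_integral[OF int P0] R by simp
  have TP: "T P = P" using SP T_S by metis
  \<comment> \<open>The identities in the second leg hold since P is a right integral and of
    integral type. Those in the first leg follow by shifting P across, where S P = P and T P =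
    P.\<close>
  have 2: "sw P (\<lambda>p q. F p (P * q)) = F P P" and 1: "sw P (\<lambda>p q. F p (q * P)) = F P P"
    and 4: "sw P (\<lambda>p q. F (P * p) q) = F P P" and 3: "sw P (\<lambda>p q. F (p * P) q) = F P P"
    if F: "\<And>b. lin (*) (\<lambda>a. F a b)" "\<And>a. lin (*) (\<lambda>b. F a b)" for F :: "'a \<Rightarrow> 'a \<Rightarrow> 'k"
  proof -
    show 2: "sw P (\<lambda>p q. F p (P * q)) = F P P" by (rule F.right_integral_sw[OF R vs_field F])
    show 1: "sw P (\<lambda>p q. F p (q * P)) = F P P" by (rule integral_type_sw[OF P(2) vs_field F])
    have "sw P (\<lambda>p q. F p (P * q)) = sw P (\<lambda>p q. F (S P * p) q)"
      by (rule antipode_shift_left[OF F.A_costable A(2) _ vs_field F]) (use A(3) in auto)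
    then show "sw P (\<lambda>p q. F (P * p) q) = F P P" using 2 SP by simp
    have "sw P (\<lambda>p q. F p (q * P)) = sw P (\<lambda>p q. F (p * T P) q)"
      by (rule antipode_shift_right[OF F.A_costable A(2) _ vs_field F]) (use R in \<open>auto simp: F.right_integral_def\<close>)
    then show "sw P (\<lambda>p q. F (p * P) q) = F P P" using 1 TP by simp
  qed
  have t: "tensor_eq scale (map (\<lambda>(a, b). (f a, g b)) (\<Delta> P)) [(P, P)]"
    if "\<And>\<phi> \<psi>. lin (*) \<phi> \<Longrightarrow> lin (*) \<psi> \<Longrightarrow> sw P (\<lambda>p q. \<phi> (f p) * \<psi> (g q)) = \<phi> P * \<psi> P" for f g
    unfolding tensor_eq_def lin_fun_lin using that by (simp add: sw_def case_prod_unfold o_def)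
  show ?thesis
    unfolding two_sided_grouplike_projection_def
    by (intro conjI P0 P(1) t 1 2 3 4) (intro lin_intros; assumption)+
qed

end

theorem mainTheorem18:
  fixes scale :: "'k::field \<Rightarrow> 'a::ring_1 \<Rightarrow> 'a"
    and \<Delta> :: "'a \<Rightarrow> ('a \<times> 'a) list"
    and \<epsilon> :: "'a \<Rightarrow> 'k"
    and S :: "'a \<Rightarrow> 'a"
  assumes "hopf_algebra scale \<Delta> \<epsilon> S"
    and "cosemisimple scale \<Delta>"
    and "weakly_finite TYPE('a)"
  shows "(\<forall>L. integral_type scale \<Delta> L \<longrightarrow>
            (S L = L \<longleftrightarrow> tensor_eq scale (map (\<lambda>(a,b). (a, L * b)) (\<Delta> L)) [(L, L)]))
       \<and> (\<forall>A. left_coideal_subalgebra scale \<Delta> A \<and> finite_dim_subspace scale A \<and> unimodular scale \<epsilon> A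
            \<longrightarrow> (S \<circ> S) ` A = A)
       \<and> (\<forall>P. P * P = P \<and> integral_type scale \<Delta> P \<longrightarrow> two_sided_grouplike_projection scale \<Delta> P)"
proof -
  interpret hopf scale \<Delta> \<epsilon> S using assms(1) by unfold_locales
  obtain h where H: "\<And>A. coideal_subalg A \<Longrightarrow> frobenius_coideal scale \<Delta> \<epsilon> S h A"
    using frobenius_coideal_exists[OF assms(2,3)] by blast
  show ?thesis
    using S_fixed_iff_two_sided[OF H] unimodular_S_squared_image[OF H]
      idempotent_integral_type_two_sided[OF H] by blast
qed

end
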